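(* In every categorical model of the plain language, the interpretation $[\![-]\!]_u$ preserves judgemental equality: if $\Gamma\vdash s=t:A$ is derivable in the plain language, then $[\![s]\!]_u=[\![t]\!]_u$ as morphisms $[\![\Gamma]\!]_u\to[\![A]\!]_u$.
   Context: Fix a set $\mathbf{Q}$ of qubits and a set $\mathbf{G}$ of gates; each gate $G$ acts on a tuple $(q_1,\dots,q_n)$ of distinct qubits (durations play no role here). **Plain language.** Types: $A,B::=1\mid q\mid A\otimes B$ ($q\in\mathbf{Q}$). Contexts: lists of declarations $x:A$ with distinct variables. Terms: $x$, $*$, $\mathrm{let}\ *=s\ \mathrm{in}\ t$, $G(t_1,\dots,t_n)$, $(s,t)$, $\mathrm{let}\ (x,y)=s\ \mathrm{in}\ t$, $\mathrm{let}\ x=s\ \mathrm{in}\ t$. Typing rules: - Swap: from $\Gamma,x:A,y:B,\Delta\vdash t:C$ infer $\Gamma,y:B,x:A,\Delta\vdash t:C$. - Var: $x:A\vdash x:A$. Unit-I: $\vdash *:1$. - Unit-E: from $\Gamma\vdash s:1$, $\Delta\vdash t:A$ infer $\Gamma,\Delta\vdash\mathrm{let}\ *=s\ \mathrm{in}\ t:A$. - Gate: from $\Gamma_i\vdash t_i:q_i$ ($1\le i\le n$) infer $\Gamma_1,\dots,\Gamma_n\vdash G(t_1,\dots,t_n):q_1\otimes\cdots\otimes q_n$. - Tens-I: from $\Gamma\vdash s:A$, $\Delta\vdash t:B$ infer $\Gamma,\Delta\vdash(s,t):A\otimes B$. - Tens-E: from $\Gamma\vdash s:A\otimes B$ and $x:A,y:B,\Delta\vdash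 t:C$ infer $\Gamma,\Delta\vdash\mathrm{let}\ (x,y)=s\ \mathrm{in}\ t:C$. - Let: from $\Gamma\vdash s:A$ and $x:A,\Delta\vdash t:C$ infer $\Gamma,\Delta\vdash\mathrm{let}\ x=s\ \mathrm{in}\ t:C$. **Judgemental equality** $\Gamma\vdash s=t:A$ is the least equivalence relation on well-typed terms (up to renaming of bound variables) that is a congruence for all constructors and contains, whenever both sides are well typed with the same context and type and no variable capture occurs: - $\beta$: $(\mathrm{let}\ *=*\ \mathrm{in}\ t)=t$; $(\mathrm{let}\ (x,y)=(s,t)\ \mathrm{in}\ u)=u[x:=s,y:=t]$; $(\mathrm{let}\ x=s\ \mathrm{in}\ t)=t[x:=s]$. - $\eta$: $(\mathrm{let}\ *=t\ \mathrm{in}\ * )=t$; $(\mathrm{let}\ (x,y)=t\ \mathrm{in}\ (x,y))=t$. - Commuting conversions, for patterns $P,R$ each of the form $*$ or $(x,y)$: $(\mathrm{let}\ P=s\ \mathrm{in\ let}\ R=t\ \mathrm{in}\ u)=(\mathrm{let}\ R=(\mathrm{let}\ P=s\ \mathrm{in}\ t)\ \mathrm{in}\ u)$; $(\mathrm{let}\ P=s\ \mathrm{in\ let}\ R=t\ \mathrm{in}\ u)=(\mathrm{let}\ R=t\ \mathrm{in\ let}\ P=s\ \mathrm{in}\ u)$; $(\mathrm{let}\ P=s\ \mathrm{in}\ G(t_1,\dots,t_n))=G(t_1,\dots,\mathrm{let}\ P=s\ \mathrm{in}\ t_i,\dots,t_n)$; $(\mathrm{let}\ P=s\ \mathrm{in}\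 (t,u))=(\mathrm{let}\ P=s\ \mathrm{in}\ t,\,u)$ and $=(t,\,\mathrm{let}\ P=s\ \mathrm{in}\ u)$. **Models.** A categorical model of the plain language is a symmetric monoidal category $\mathcal{C}^\otimes$ with an object $X_q$ for each $q\in\mathbf{Q}$ and, for each gate $G$ acting on $(q_1,\dots,q_n)$, a morphism $f_G:\bigotimes_{i=1}^nX_{q_i}\to\bigotimes_{i=1}^nX_{q_i}$. **Interpretation.** $[\![1]\!]_u=I$, $[\![q]\!]_u=X_q$, $[\![A\otimes B]\!]_u=[\![A]\!]_u\otimes[\![B]\!]_u$; $[\![[]]\!]_u=I$, $[\![x:A,\Gamma]\!]_u=[\![A]\!]_u\otimes[\![\Gamma]\!]_u$. A derivation of $\Gamma\vdash t:A$ is interpreted as a morphism $[\![t]\!]_u:[\![\Gamma]\!]_u\to[\![A]\!]_u$ (inserting canonical coherence isomorphisms): Swap is precomposition with the symmetry; Var and Unit-I are identities; Unit-E and Tens-I are $[\![s]\!]_u\otimes[\![t]\!]_u$; Tens-E and Let are $[\![t]\!]_u\circ([\![s]\!]_u\otimes\mathrm{Id}_{[\![\Delta]\!]_u})$; Gate is $f_G\circ\bigotimes_i[\![t_i]\!]_u$. *)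

theory Defs
  imports Main
begin

section \<open>The plain language\<close>

text \<open>
  Qubits and gates are the elements of the types \<open>'q\<close> and \<open>'g\<close>. A gate signature
  \<open>acts :: 'g \<Rightarrow> 'q list\<close> gives the tuple of qubits on which each gate acts.
\<close>

datatype 'q ty = TUnit | TQubit 'q | TTensor "'q ty" "'q ty"

type_synonym var = nat

type_synonym 'q ctx = "(var \<times> 'q ty) list"

text \<open>Patterns are only \<open>*\<close> and \<open>(x, y)\<close>; the plain \<open>let x = s in t\<close> is a separate constructor.\<close>

datatype pat = PStar | PPair var var

datatype 'g trm =
    Var var
  | Star
  | LetP pat "'g trm" "'g trm"
  | LetV var "'g trm" "'g trm"
  | App 'g "'g trm list"
  | Tup "'g trm" "'g trm"

definition wf_ctx :: "'q ctx \<Rightarrow> bool" where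
  "wf_ctx \<Gamma> \<longleftrightarrow> distinct (map fst \<Gamma>)"

text \<open>\<open>q\<^sub>1 \<otimes> \<dots> \<otimes> q\<^sub>n\<close>, bracketed to the right; it is \<open>q\<^sub>1\<close> for \<open>n = 1\<close> and the unit for \<open>n = 0\<close>.\<close>

fun qubits_ty :: "'q list \<Rightarrow> 'q ty" where
  "qubits_ty [] = TUnit"
| "qubits_ty [q] = TQubit q"
| "qubits_ty (q # r # qs) = TTensor (TQubit q) (qubits_ty (r # qs))"


subsection \<open>Typing derivations\<close>

text \<open>
  The interpretation is a function of the derivation, so derivations are explicit trees.
  Each node carries the data from which its conclusion is determined.
\<close>

datatype ('q, 'g) derivation =
    DSwap "'q ctx" var "'q ty" var "'q ty" "'q ctx" "('q, 'g) derivation"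
  | DVar var "'q ty"
  | DUnitI
  | DUnitE "'q ctx" "'q ctx" "'q ty" "('q, 'g) derivation" "('q, 'g) derivation"
  | DGate 'g "'q ctx list" "('q, 'g) derivation list"
  | DTensI "'q ctx" "'q ctx" "('q, 'g) derivation" "('q, 'g) derivation"
  | DTensE "'q ctx" var "'q ty" var "'q ty" "'q ctx" "('q, 'g) derivation" "('q, 'g) derivation"
  | DLet "'q ctx" var "'q ty" "'q ctx" "('q, 'g) derivation" "('q, 'g) derivation"

text \<open>\<open>derives acts D \<Gamma> t A\<close>: the tree \<open>D\<close> is a valid derivation of \<open>\<Gamma> \<turnstile> t : A\<close>.\<close>

inductive derives ::
  "('g \<Rightarrow> 'q list) \<Rightarrow> ('q, 'g) derivation \<Rightarrow> 'q ctx \<Rightarrow> 'g trm \<Rightarrow> 'q ty \<Rightarrow> bool"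
  for acts :: "'g \<Rightarrow> 'q list"
where
  Swap:
    "derives acts D (\<Gamma> @ (x, A) # (y, B) # \<Delta>) t C \<Longrightarrow>
     derives acts (DSwap \<Gamma> x A y B \<Delta> D) (\<Gamma> @ (y, B) # (x, A) # \<Delta>) t C"
| Var:
    "derives acts (DVar x A) [(x, A)] (Var x) A"
| UnitI:
    "derives acts DUnitI [] Star TUnit"
| UnitE:
    "derives acts D \<Gamma> s TUnit \<Longrightarrow> derives acts E \<Delta> t A \<Longrightarrow> wf_ctx (\<Gamma> @ \<Delta>) \<Longrightarrow>
     derives acts (DUnitE \<Gamma> \<Delta> A D E) (\<Gamma> @ \<Delta>) (LetP PStar s t) A"
| Gate:
    "length \<Gamma>s = length (acts G) \<Longrightarrow> length Ds = length (acts G) \<Longrightarrow>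
     length ts = length (acts G) \<Longrightarrow>
     (\<And>i. i < length (acts G) \<Longrightarrow> derives acts (Ds ! i) (\<Gamma>s ! i) (ts ! i) (TQubit (acts G ! i))) \<Longrightarrow>
     wf_ctx (concat \<Gamma>s) \<Longrightarrow>
     derives acts (DGate G \<Gamma>s Ds) (concat \<Gamma>s) (App G ts) (qubits_ty (acts G))"
| TensI:
    "derives acts D \<Gamma> s A \<Longrightarrow> derives acts E \<Delta> t B \<Longrightarrow> wf_ctx (\<Gamma> @ \<Delta>) \<Longrightarrow>
     derives acts (DTensI \<Gamma> \<Delta> D E) (\<Gamma> @ \<Delta>) (Tup s t) (TTensor A B)"
| TensE:
    "derives acts D \<Gamma> s (TTensor A B) \<Longrightarrow> derives acts E ((x, A) # (y, B) # \<Delta>) t C \<Longrightarrow>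
     wf_ctx (\<Gamma> @ \<Delta>) \<Longrightarrow>
     derives acts (DTensE \<Gamma> x A y B \<Delta> D E) (\<Gamma> @ \<Delta>) (LetP (PPair x y) s t) C"
| Let:
    "derives acts D \<Gamma> s A \<Longrightarrow> derives acts E ((x, A) # \<Delta>) t C \<Longrightarrow> wf_ctx (\<Gamma> @ \<Delta>) \<Longrightarrow>
     derives acts (DLet \<Gamma> x A \<Delta> D E) (\<Gamma> @ \<Delta>) (LetV x s t) C"

definition typed :: "('g \<Rightarrow> 'q list) \<Rightarrow> 'q ctx \<Rightarrow> 'g trm \<Rightarrow> 'q ty \<Rightarrow> bool" where
  "typed acts \<Gamma> t A \<longleftrightarrow> (\<exists>D. derives acts D \<Gamma> t A)"


subsection \<open>Free variables and substitution\<close>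

fun pvars :: "pat \<Rightarrow> var set" where
  "pvars PStar = {}"
| "pvars (PPair x y) = {x, y}"

fun fv :: "'g trm \<Rightarrow> var set" where
  "fv (Var x) = {x}"
| "fv Star = {}"
| "fv (LetP p s t) = fv s \<union> (fv t - pvars p)"
| "fv (LetV x s t) = fv s \<union> (fv t - {x})"
| "fv (App G ts) = (\<Union>t \<in> set ts. fv t)"
| "fv (Tup s t) = fv s \<union> fv t"

definition shadow :: "var set \<Rightarrow> (var \<Rightarrow> 'g trm) \<Rightarrow> var \<Rightarrow> 'g trm" where
  "shadow X \<sigma> = (\<lambda>z. if z \<in> X then Var z else \<sigma> z)"

text \<open>
  Simultaneous substitution on named terms. It does not rename binders, so it is only used
  together with \<open>no_capture\<close>.
\<close>

fun subst :: "(var \<Rightarrow> 'g trm) \<Rightarrow> 'g trm \<Rightarrow> 'g trm" where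
  "subst \<sigma> (Var x) = \<sigma> x"
| "subst \<sigma> Star = Star"
| "subst \<sigma> (LetP p s t) = LetP p (subst \<sigma> s) (subst (shadow (pvars p) \<sigma>) t)"
| "subst \<sigma> (LetV x s t) = LetV x (subst \<sigma> s) (subst (shadow {x} \<sigma>) t)"
| "subst \<sigma> (App G ts) = App G (map (subst \<sigma>) ts)"
| "subst \<sigma> (Tup s t) = Tup (subst \<sigma> s) (subst \<sigma> t)"

fun no_capture :: "(var \<Rightarrow> 'g trm) \<Rightarrow> 'g trm \<Rightarrow> bool" where
  "no_capture \<sigma> (Var x) \<longleftrightarrow> True"
| "no_capture \<sigma> Star \<longleftrightarrow> True"
| "no_capture \<sigma> (LetP p s t) \<longleftrightarrow>
     no_capture \<sigma> s \<and> no_capture (shadow (pvars p) \<sigma>) t \<and>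
     (\<forall>z \<in> fv t - pvars p. fv (\<sigma> z) \<inter> pvars p = {})"
| "no_capture \<sigma> (LetV x s t) \<longleftrightarrow>
     no_capture \<sigma> s \<and> no_capture (shadow {x} \<sigma>) t \<and>
     (\<forall>z \<in> fv t - {x}. x \<notin> fv (\<sigma> z))"
| "no_capture \<sigma> (App G ts) \<longleftrightarrow> (\<forall>t \<in> set ts. no_capture \<sigma> t)"
| "no_capture \<sigma> (Tup s t) \<longleftrightarrow> no_capture \<sigma> s \<and> no_capture \<sigma> t"


subsection \<open>Judgemental equality\<close>

text \<open>
  The basic equations on raw terms. The \<open>Alpha\<close> rules generate renaming of bound variables,
  so that working with named terms agrees with working up to renaming.
\<close>

inductive basic_eq :: "'g trm \<Rightarrow> 'g trm \<Rightarrow> bool" where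
  AlphaPair:
    "{x', y'} \<inter> (fv t - {x, y}) = {} \<Longrightarrow> no_capture (Var(x := Var x', y := Var y')) t \<Longrightarrow>
     basic_eq (LetP (PPair x y) s t)
              (LetP (PPair x' y') s (subst (Var(x := Var x', y := Var y')) t))"
| AlphaLet:
    "x' \<notin> fv t - {x} \<Longrightarrow> no_capture (Var(x := Var x')) t \<Longrightarrow>
     basic_eq (LetV x s t) (LetV x' s (subst (Var(x := Var x')) t))"
| BetaUnit:
    "basic_eq (LetP PStar Star t) t"
| BetaPair:
    "no_capture (Var(x := s, y := t)) u \<Longrightarrow>
     basic_eq (LetP (PPair x y) (Tup s t) u) (subst (Var(x := s, y := t)) u)"
| BetaLet:
    "no_capture (Var(x := s)) t \<Longrightarrow>
     basic_eq (LetV x s t) (subst (Var(x := s)) t)"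
| EtaUnit:
    "basic_eq (LetP PStar t Star) t"
| EtaPair:
    "basic_eq (LetP (PPair x y) t (Tup (Var x) (Var y))) t"
| CommNest:
    "pvars P \<inter> (fv u - pvars R) = {} \<Longrightarrow>
     basic_eq (LetP P s (LetP R t u)) (LetP R (LetP P s t) u)"
| CommSwap:
    "pvars P \<inter> fv t = {} \<Longrightarrow> pvars R \<inter> fv s = {} \<Longrightarrow> pvars P \<inter> pvars R = {} \<Longrightarrow>
     basic_eq (LetP P s (LetP R t u)) (LetP R t (LetP P s u))"
| CommGate:
    "i < length ts \<Longrightarrow> (\<And>j. j < length ts \<Longrightarrow> j \<noteq> i \<Longrightarrow> pvars P \<inter> fv (ts ! j) = {}) \<Longrightarrow>
     basic_eq (LetP P s (App G ts)) (App G (ts[i := LetP P s (ts ! i)]))"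
| CommTensL:
    "pvars P \<inter> fv u = {} \<Longrightarrow>
     basic_eq (LetP P s (Tup t u)) (Tup (LetP P s t) u)"
| CommTensR:
    "pvars P \<inter> fv t = {} \<Longrightarrow>
     basic_eq (LetP P s (Tup t u)) (Tup t (LetP P s u))"

text \<open>
  \<open>judg_eq acts \<Gamma> s t A\<close> is \<open>\<Gamma> \<turnstile> s = t : A\<close>. \<open>CongSwap\<close> makes the congruence rules apply in
  every context in which the compound terms are typable, in particular when the
  variables of the subterms are interleaved.
\<close>

inductive judg_eq ::
  "('g \<Rightarrow> 'q list) \<Rightarrow> 'q ctx \<Rightarrow> 'g trm \<Rightarrow> 'g trm \<Rightarrow> 'q ty \<Rightarrow> bool"
  for acts :: "'g \<Rightarrow> 'q list"
where
  Basic: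
    "basic_eq s t \<Longrightarrow> typed acts \<Gamma> s A \<Longrightarrow> typed acts \<Gamma> t A \<Longrightarrow> judg_eq acts \<Gamma> s t A"
| Refl:
    "typed acts \<Gamma> t A \<Longrightarrow> judg_eq acts \<Gamma> t t A"
| Sym:
    "judg_eq acts \<Gamma> s t A \<Longrightarrow> judg_eq acts \<Gamma> t s A"
| Trans:
    "judg_eq acts \<Gamma> s t A \<Longrightarrow> judg_eq acts \<Gamma> t u A \<Longrightarrow> judg_eq acts \<Gamma> s u A"
| CongSwap:
    "judg_eq acts (\<Gamma> @ (x, A) # (y, B) # \<Delta>) s t C \<Longrightarrow>
     judg_eq acts (\<Gamma> @ (y, B) # (x, A) # \<Delta>) s t C"
| CongUnitE:
    "judg_eq acts \<Gamma> s s' TUnit \<Longrightarrow> judg_eq acts \<Delta> t t' A \<Longrightarrow> wf_ctx (\<Gamma> @ \<Delta>) \<Longrightarrow>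
     judg_eq acts (\<Gamma> @ \<Delta>) (LetP PStar s t) (LetP PStar s' t') A"
| CongGate:
    "length \<Gamma>s = length (acts G) \<Longrightarrow> length ts = length (acts G) \<Longrightarrow>
     length ts' = length (acts G) \<Longrightarrow>
     (\<And>i. i < length (acts G) \<Longrightarrow> judg_eq acts (\<Gamma>s ! i) (ts ! i) (ts' ! i) (TQubit (acts G ! i))) \<Longrightarrow>
     wf_ctx (concat \<Gamma>s) \<Longrightarrow>
     judg_eq acts (concat \<Gamma>s) (App G ts) (App G ts') (qubits_ty (acts G))"
| CongTensI:
    "judg_eq acts \<Gamma> s s' A \<Longrightarrow> judg_eq acts \<Delta> t t' B \<Longrightarrow> wf_ctx (\<Gamma> @ \<Delta>) \<Longrightarrow>
     judg_eq acts (\<Gamma> @ \<Delta>) (Tup s t) (Tup s' t') (TTensor A B)"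
| CongTensE:
    "judg_eq acts \<Gamma> s s' (TTensor A B) \<Longrightarrow> judg_eq acts ((x, A) # (y, B) # \<Delta>) t t' C \<Longrightarrow>
     wf_ctx (\<Gamma> @ \<Delta>) \<Longrightarrow>
     judg_eq acts (\<Gamma> @ \<Delta>) (LetP (PPair x y) s t) (LetP (PPair x y) s' t') C"
| CongLet:
    "judg_eq acts \<Gamma> s s' A \<Longrightarrow> judg_eq acts ((x, A) # \<Delta>) t t' C \<Longrightarrow> wf_ctx (\<Gamma> @ \<Delta>) \<Longrightarrow>
     judg_eq acts (\<Gamma> @ \<Delta>) (LetV x s t) (LetV x s' t') C"


section \<open>Symmetric monoidal categories\<close>

record ('o, 'm) smcat =
  Obj :: "'o set"
  Arr :: "'m set"
  Dom :: "'m \<Rightarrow> 'o"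
  Cod :: "'m \<Rightarrow> 'o"
  ident :: "'o \<Rightarrow> 'm"
  comp :: "'m \<Rightarrow> 'm \<Rightarrow> 'm"  (infixl \<open>\<cdot>\<index>\<close> 55)
  tunit :: 'o  (\<open>\<I>\<index>\<close>)
  tobj :: "'o \<Rightarrow> 'o \<Rightarrow> 'o"  (infixr \<open>\<odot>\<index>\<close> 70)
  tarr :: "'m \<Rightarrow> 'm \<Rightarrow> 'm"  (infixr \<open>\<otimes>\<index>\<close> 70)
  assoc :: "'o \<Rightarrow> 'o \<Rightarrow> 'o \<Rightarrow> 'm"
  lunit :: "'o \<Rightarrow> 'm"
  runit :: "'o \<Rightarrow> 'm"
  symm :: "'o \<Rightarrow> 'o \<Rightarrow> 'm"

definition hom :: "('o, 'm, 'z) smcat_scheme \<Rightarrow> 'o \<Rightarrow> 'o \<Rightarrow> 'm set" where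
  "hom C a b = {f \<in> Arr C. Dom C f = a \<and> Cod C f = b}"

definition inverse_arrs :: "('o, 'm, 'z) smcat_scheme \<Rightarrow> 'm \<Rightarrow> 'm \<Rightarrow> bool" where
  "inverse_arrs C f g \<longleftrightarrow>
     f \<in> Arr C \<and> g \<in> hom C (Cod C f) (Dom C f) \<and>
     comp C g f = ident C (Dom C f) \<and> comp C f g = ident C (Cod C f)"

definition iso :: "('o, 'm, 'z) smcat_scheme \<Rightarrow> 'm \<Rightarrow> bool" where
  "iso C f \<longleftrightarrow> (\<exists>g. inverse_arrs C f g)"

definition inv_arr :: "('o, 'm, 'z) smcat_scheme \<Rightarrow> 'm \<Rightarrow> 'm" where
  "inv_arr C f = (THE g. inverse_arrs C f g)"

text \<open>\<open>f \<cdot> g\<close> is composition in the usual order, \<open>g\<close> first.\<close>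

locale symmetric_monoidal_category =
  fixes C :: "('o, 'm, 'z) smcat_scheme" (structure)
  assumes dom_cod: "f \<in> Arr C \<Longrightarrow> Dom C f \<in> Obj C \<and> Cod C f \<in> Obj C"
    and ident_hom: "a \<in> Obj C \<Longrightarrow> ident C a \<in> hom C a a"
    and comp_hom: "g \<in> hom C b c \<Longrightarrow> f \<in> hom C a b \<Longrightarrow> g \<cdot> f \<in> hom C a c"
    and comp_ident: "f \<in> hom C a b \<Longrightarrow> f \<cdot> ident C a = f"
    and ident_comp: "f \<in> hom C a b \<Longrightarrow> ident C b \<cdot> f = f"
    and comp_assoc:
      "h \<in> hom C c d \<Longrightarrow> g \<in> hom C b c \<Longrightarrow> f \<in> hom C a b \<Longrightarrow> (h \<cdot> g) \<cdot> f = h \<cdot> (g \<cdot> f)"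
    and tunit_obj: "\<I> \<in> Obj C"
    and tobj_obj: "a \<in> Obj C \<Longrightarrow> b \<in> Obj C \<Longrightarrow> a \<odot> b \<in> Obj C"
    and tarr_hom: "f \<in> hom C a b \<Longrightarrow> g \<in> hom C c d \<Longrightarrow> f \<otimes> g \<in> hom C (a \<odot> c) (b \<odot> d)"
    and tarr_ident: "a \<in> Obj C \<Longrightarrow> b \<in> Obj C \<Longrightarrow> ident C a \<otimes> ident C b = ident C (a \<odot> b)"
    and tarr_comp:
      "g \<in> hom C b c \<Longrightarrow> f \<in> hom C a b \<Longrightarrow> g' \<in> hom C b' c' \<Longrightarrow> f' \<in> hom C a' b' \<Longrightarrow>
       (g \<cdot> f) \<otimes> (g' \<cdot> f') = (g \<otimes> g') \<cdot> (f \<otimes> f')"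
    and assoc_hom:
      "a \<in> Obj C \<Longrightarrow> b \<in> Obj C \<Longrightarrow> c \<in> Obj C \<Longrightarrow>
       assoc C a b c \<in> hom C ((a \<odot> b) \<odot> c) (a \<odot> (b \<odot> c))"
    and assoc_iso:
      "a \<in> Obj C \<Longrightarrow> b \<in> Obj C \<Longrightarrow> c \<in> Obj C \<Longrightarrow> iso C (assoc C a b c)"
    and assoc_natural:
      "f \<in> hom C a a' \<Longrightarrow> g \<in> hom C b b' \<Longrightarrow> h \<in> hom C c c' \<Longrightarrow>
       assoc C a' b' c' \<cdot> ((f \<otimes> g) \<otimes> h) = (f \<otimes> (g \<otimes> h)) \<cdot> assoc C a b c"
    and lunit_hom: "a \<in> Obj C \<Longrightarrow> lunit C a \<in> hom C (\<I> \<odot> a) a"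
    and lunit_iso: "a \<in> Obj C \<Longrightarrow> iso C (lunit C a)"
    and lunit_natural:
      "f \<in> hom C a b \<Longrightarrow> lunit C b \<cdot> (ident C \<I> \<otimes> f) = f \<cdot> lunit C a"
    and runit_hom: "a \<in> Obj C \<Longrightarrow> runit C a \<in> hom C (a \<odot> \<I>) a"
    and runit_iso: "a \<in> Obj C \<Longrightarrow> iso C (runit C a)"
    and runit_natural:
      "f \<in> hom C a b \<Longrightarrow> runit C b \<cdot> (f \<otimes> ident C \<I>) = f \<cdot> runit C a"
    and pentagon:
      "a \<in> Obj C \<Longrightarrow> b \<in> Obj C \<Longrightarrow> c \<in> Obj C \<Longrightarrow> d \<in> Obj C \<Longrightarrow>
       assoc C a b (c \<odot> d) \<cdot> assoc C (a \<odot> b) c d =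
       (ident C a \<otimes> assoc C b c d) \<cdot> assoc C a (b \<odot> c) d \<cdot> (assoc C a b c \<otimes> ident C d)"
    and triangle:
      "a \<in> Obj C \<Longrightarrow> b \<in> Obj C \<Longrightarrow>
       (ident C a \<otimes> lunit C b) \<cdot> assoc C a \<I> b = runit C a \<otimes> ident C b"
    and symm_hom: "a \<in> Obj C \<Longrightarrow> b \<in> Obj C \<Longrightarrow> symm C a b \<in> hom C (a \<odot> b) (b \<odot> a)"
    and symm_natural:
      "f \<in> hom C a a' \<Longrightarrow> g \<in> hom C b b' \<Longrightarrow>
       symm C a' b' \<cdot> (f \<otimes> g) = (g \<otimes> f) \<cdot> symm C a b"
    and symm_inverse:
      "a \<in> Obj C \<Longrightarrow> b \<in> Obj C \<Longrightarrow> symm C b a \<cdot> symm C a b = ident C (a \<odot> b)"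
    and hexagon:
      "a \<in> Obj C \<Longrightarrow> b \<in> Obj C \<Longrightarrow> c \<in> Obj C \<Longrightarrow>
       assoc C b c a \<cdot> symm C a (b \<odot> c) \<cdot> assoc C a b c =
       (ident C b \<otimes> symm C a c) \<cdot> assoc C b a c \<cdot> (symm C a b \<otimes> ident C c)"


section \<open>Models and the interpretation\<close>

record ('q, 'g, 'o, 'm) plain_model = "('o, 'm) smcat" +
  qobj :: "'q \<Rightarrow> 'o"
  garr :: "'g \<Rightarrow> 'm"

text \<open>\<open>n\<close>-fold tensors are bracketed as in \<open>qubits_ty\<close>.\<close>

fun tens_objs :: "('o, 'm, 'z) smcat_scheme \<Rightarrow> 'o list \<Rightarrow> 'o" where
  "tens_objs C [] = tunit C"
| "tens_objs C [a] = a"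
| "tens_objs C (a # b # as) = tobj C a (tens_objs C (b # as))"

fun tens_arrs :: "('o, 'm, 'z) smcat_scheme \<Rightarrow> 'm list \<Rightarrow> 'm" where
  "tens_arrs C [] = ident C (tunit C)"
| "tens_arrs C [f] = f"
| "tens_arrs C (f # g # fs) = tarr C f (tens_arrs C (g # fs))"

locale categorical_model = symmetric_monoidal_category M
  for acts :: "'g \<Rightarrow> 'q list"
    and M :: "('q, 'g, 'o, 'm) plain_model" (structure) +
  assumes qobj_obj: "qobj M q \<in> Obj M"
    and garr_hom:
      "garr M G \<in> hom M (tens_objs M (map (qobj M) (acts G))) (tens_objs M (map (qobj M) (acts G)))"

context
  fixes M :: "('q, 'g, 'o, 'm) plain_model" (structure)
begin

fun ty_obj :: "'q ty \<Rightarrow> 'o" where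
  "ty_obj TUnit = \<I>"
| "ty_obj (TQubit q) = qobj M q"
| "ty_obj (TTensor A B) = ty_obj A \<odot> ty_obj B"

fun ctx_obj :: "'q ctx \<Rightarrow> 'o" where
  "ctx_obj [] = \<I>"
| "ctx_obj ((x, A) # \<Gamma>) = ty_obj A \<odot> ctx_obj \<Gamma>"

text \<open>The coherence isomorphism \<open>\<lbrakk>\<Gamma>, \<Delta>\<rbrakk> \<rightarrow> \<lbrakk>\<Gamma>\<rbrakk> \<otimes> \<lbrakk>\<Delta>\<rbrakk>\<close>.\<close>

fun split_ctx :: "'q ctx \<Rightarrow> 'q ctx \<Rightarrow> 'm" where
  "split_ctx [] \<Delta> = inv_arr M (lunit M (ctx_obj \<Delta>))"
| "split_ctx ((x, A) # \<Gamma>) \<Delta> =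
     inv_arr M (assoc M (ty_obj A) (ctx_obj \<Gamma>) (ctx_obj \<Delta>)) \<cdot>
     (ident M (ty_obj A) \<otimes> split_ctx \<Gamma> \<Delta>)"

text \<open>The coherence isomorphism \<open>\<lbrakk>\<Gamma>\<^sub>1, \<dots>, \<Gamma>\<^sub>n\<rbrakk> \<rightarrow> \<lbrakk>\<Gamma>\<^sub>1\<rbrakk> \<otimes> \<dots> \<otimes> \<lbrakk>\<Gamma>\<^sub>n\<rbrakk>\<close>.\<close>

fun split_ctxs :: "'q ctx list \<Rightarrow> 'm" where
  "split_ctxs [] = ident M \<I>"
| "split_ctxs [\<Gamma>] = ident M (ctx_obj \<Gamma>)"
| "split_ctxs (\<Gamma> # \<Delta> # \<Gamma>s) =
     (ident M (ctx_obj \<Gamma>) \<otimes> split_ctxs (\<Delta> # \<Gamma>s)) \<cdot> split_ctx \<Gamma> (concat (\<Delta> # \<Gamma>s))"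

text \<open>The symmetry \<open>\<lbrakk>\<Gamma>, y : B, x : A, \<Delta>\<rbrakk> \<rightarrow> \<lbrakk>\<Gamma>, x : A, y : B, \<Delta>\<rbrakk>\<close>.\<close>

fun swap_ctx :: "'q ctx \<Rightarrow> 'q ty \<Rightarrow> 'q ty \<Rightarrow> 'q ctx \<Rightarrow> 'm" where
  "swap_ctx [] A B \<Delta> =
     assoc M (ty_obj A) (ty_obj B) (ctx_obj \<Delta>) \<cdot>
     (symm M (ty_obj B) (ty_obj A) \<otimes> ident M (ctx_obj \<Delta>)) \<cdot>
     inv_arr M (assoc M (ty_obj B) (ty_obj A) (ctx_obj \<Delta>))"
| "swap_ctx ((z, E) # \<Gamma>) A B \<Delta> = ident M (ty_obj E) \<otimes> swap_ctx \<Gamma> A B \<Delta>"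

fun interp :: "('q, 'g) derivation \<Rightarrow> 'm" where
  "interp (DSwap \<Gamma> x A y B \<Delta> D) = interp D \<cdot> swap_ctx \<Gamma> A B \<Delta>"
| "interp (DVar x A) = runit M (ty_obj A)"
| "interp DUnitI = ident M \<I>"
| "interp (DUnitE \<Gamma> \<Delta> A D E) =
     lunit M (ty_obj A) \<cdot> (interp D \<otimes> interp E) \<cdot> split_ctx \<Gamma> \<Delta>"
| "interp (DGate G \<Gamma>s Ds) = garr M G \<cdot> tens_arrs M (map interp Ds) \<cdot> split_ctxs \<Gamma>s"
| "interp (DTensI \<Gamma> \<Delta> D E) = (interp D \<otimes> interp E) \<cdot> split_ctx \<Gamma> \<Delta>"
| "interp (DTensE \<Gamma> x A y B \<Delta> D E) =
     interp E \<cdot> assoc M (ty_obj A) (ty_obj B) (ctx_obj \<Delta>) \<cdot>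
     (interp D \<otimes> ident M (ctx_obj \<Delta>)) \<cdot> split_ctx \<Gamma> \<Delta>"
| "interp (DLet \<Gamma> x A \<Delta> D E) =
     interp E \<cdot> (interp D \<otimes> ident M (ctx_obj \<Delta>)) \<cdot> split_ctx \<Gamma> \<Delta>"

end

end

theory Submission
  imports Defs "HOL-Library.Multiset"
begin

text \<open>
  Coherence is dealt with once and for all by passing to a permutative category, whose objects are
  lists of types and whose tensor is concatenation, hence strictly associative and unital.
  There, a bijection between two contexts with the same distinct declarations induces exactly one
  composite of symmetries, so a term in context has a meaning independent of the order in which
  its derivation exchanges variables: any two derivations of the same judgement agree.
  Each basic equation can then be checked on contexts bracketed to suit it. The \<open>\<beta>\<close>- and
  \<open>\<alpha>\<close>-rules are instances of a semantic substitution lemma, and the commuting conversions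
  follow from interchange and naturality of the symmetry. Strictification transports the result
  back to an arbitrary model.
\<close>

section \<open>Permutative categories\<close>

text \<open>The obstacle is that judgemental equality relates terms, whereas the interpretation is a
  function of derivations; transitivity and congruence pass through terms whose derivations bear no
  relation to the given ones. Equality is therefore proved for a relation \<open>sem\<close> between
  terms and arrows, and what survives the induction is that both terms possess a common arrow.
  Uniqueness of \<open>sem\<close> rests on linearity: the free variables of a term are exactly
  those of its context, so the term itself decides how the context is divided among its subterms and
  only the order is left open. Types of bound variables are not written in terms; they are recovered
  from the types of the bound terms. In the strict setting a type is a one-entry list, so the lists
  [A, B] and [A \<otimes> B] differ. Inverse pairs of arrows pass between such lists, and their
  inverse laws are what \<beta> and \<eta> for the unit and for pairs come down to. Both
  associativity axioms are free of side conditions, so that rewriting brings every composite and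
  every tensor into right-nested form.\<close>

locale permutative =
  fixes arr :: "'a \<Rightarrow> bool" and src tgt :: "'a \<Rightarrow> 'x list"
    and cmp :: "'a \<Rightarrow> 'a \<Rightarrow> 'a"  (infixr \<open>\<bullet>\<close> 60)
    and ten :: "'a \<Rightarrow> 'a \<Rightarrow> 'a"  (infixr \<open>\<parallel>\<close> 65)
    and idn :: "'x list \<Rightarrow> 'a"
    and sym :: "'x list \<Rightarrow> 'x list \<Rightarrow> 'a"
  assumes arr_cmp [simp]: "arr (g \<bullet> f) \<longleftrightarrow> arr g \<and> arr f \<and> src g = tgt f"
    and src_cmp [simp]: "arr g \<Longrightarrow> arr f \<Longrightarrow> src g = tgt f \<Longrightarrow> src (g \<bullet> f) = src f"
    and tgt_cmp [simp]: "arr g \<Longrightarrow> arr f \<Longrightarrow> src g = tgt f \<Longrightarrow> tgt (g \<bullet> f) = tgt g"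
    and cmp_assoc [simp]: "(h \<bullet> g) \<bullet> f = h \<bullet> g \<bullet> f"
    and arr_ten [simp]: "arr (f \<parallel> g) \<longleftrightarrow> arr f \<and> arr g"
    and src_ten [simp]: "arr f \<Longrightarrow> arr g \<Longrightarrow> src (f \<parallel> g) = src f @ src g"
    and tgt_ten [simp]: "arr f \<Longrightarrow> arr g \<Longrightarrow> tgt (f \<parallel> g) = tgt f @ tgt g"
    and ten_assoc [simp]: "(f \<parallel> g) \<parallel> h = f \<parallel> g \<parallel> h"
    and arr_idn [simp]: "arr (idn a)"
    and src_idn [simp]: "src (idn a) = a"
    and tgt_idn [simp]: "tgt (idn a) = a"
    and cmp_idn [simp]: "arr f \<Longrightarrow> src f = a \<Longrightarrow> f \<bullet> idn a = f"
    and idn_cmp [simp]: "arr f \<Longrightarrow> tgt f = a \<Longrightarrow> idn a \<bullet> f = f"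
    and idn_ten: "idn a \<parallel> idn b = idn (a @ b)"
    and ten_nil [simp]: "arr f \<Longrightarrow> f \<parallel> idn [] = f"
    and nil_ten [simp]: "arr f \<Longrightarrow> idn [] \<parallel> f = f"
    and interchange:
      "arr g \<Longrightarrow> arr f \<Longrightarrow> src g = tgt f \<Longrightarrow> arr g' \<Longrightarrow> arr f' \<Longrightarrow> src g' = tgt f' \<Longrightarrow>
       (g \<parallel> g') \<bullet> (f \<parallel> f') = (g \<bullet> f) \<parallel> (g' \<bullet> f')"
    and arr_sym [simp]: "arr (sym a b)"
    and src_sym [simp]: "src (sym a b) = a @ b"
    and tgt_sym [simp]: "tgt (sym a b) = b @ a"
    and sym_natural:
      "arr f \<Longrightarrow> arr g \<Longrightarrow> sym (tgt f) (tgt g) \<bullet> (f \<parallel> g) = (g \<parallel> f) \<bullet> sym (src f) (src g)"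
    and sym_inverse: "sym b a \<bullet> sym a b = idn (a @ b)"
    and sym_append: "sym a (b @ c) = (idn b \<parallel> sym a c) \<bullet> (sym a b \<parallel> idn c)"
begin

lemma interchange':
  assumes "arr g" "arr f" "src g = tgt f" "arr g'" "arr f'" "src g' = tgt f'"
  shows "(g \<parallel> g') \<bullet> (f \<parallel> f') \<bullet> h = ((g \<bullet> f) \<parallel> (g' \<bullet> f')) \<bullet> h"
  using interchange[OF assms] by (metis cmp_assoc)

lemma sym_inverse':
  assumes "arr f" "tgt f = a @ b"
  shows "sym b a \<bullet> sym a b \<bullet> f = f"
  using assms by (metis cmp_assoc idn_cmp sym_inverse)

text \<open>\<open>sym_append\<close> at empty lists makes this arrow idempotent, and an invertible
  idempotent is an identity.\<close>

lemma sym_nil [simp]: "sym a [] = idn a"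
proof -
  have "sym a [] = sym a [] \<bullet> sym a []"
    using sym_append[of a "[]" "[]"] by simp
  then have "sym [] a \<bullet> sym a [] = (sym [] a \<bullet> sym a []) \<bullet> sym a []"
    by simp
  then show ?thesis by (simp only: sym_inverse) simp
qed

lemma nil_sym [simp]: "sym [] a = idn a"
  using sym_inverse[of "[]" a] by simp

text \<open>Both arrows are inverse to \<open>sym c (a @ b)\<close>: the left one by
  \<open>sym_inverse\<close>, the right one after cutting that arrow with \<open>sym_append\<close>.
  So the second hexagon follows from the first.\<close>

lemma sym_append_left: "sym (a @ b) c = (sym a c \<parallel> idn b) \<bullet> (idn a \<parallel> sym b c)"
proof -
  let ?g = "(sym a c \<parallel> idn b) \<bullet> (idn a \<parallel> sym b c)"
  have "sym c (a @ b) \<bullet> ?g = (idn a \<parallel> sym c b) \<bullet> (sym c a \<parallel> idn b) \<bullet> ?g"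
    by (simp add: sym_append)
  also have "\<dots> = idn (a @ b @ c)"
    by (simp add: interchange' interchange sym_inverse idn_ten)
  finally have "sym (a @ b) c \<bullet> sym c (a @ b) \<bullet> ?g = sym (a @ b) c"
    by simp
  then show ?thesis by (simp add: sym_inverse')
qed

section \<open>Canonical permutation arrows between lists\<close>

abbreviation tys :: "('v \<times> 'x) list \<Rightarrow> 'x list" where
  "tys \<equiv> map snd"

abbreviation swap :: "('v \<times> 'x) list \<Rightarrow> 'v \<times> 'x \<Rightarrow> 'v \<times> 'x \<Rightarrow> ('v \<times> 'x) list \<Rightarrow> 'a" where
  "swap \<Gamma> x y \<Delta> \<equiv> idn (tys \<Gamma>) \<parallel> sym [snd x] [snd y] \<parallel> idn (tys \<Delta>)"

text \<open>Carries the first occurrence of \<open>z\<close> to the head, across everything before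
  it.\<close>

definition front :: "'v \<times> 'x \<Rightarrow> ('v \<times> 'x) list \<Rightarrow> 'a" where
  "front z \<Gamma> = sym (tys (takeWhile (\<lambda>y. y \<noteq> z) \<Gamma>)) [snd z] \<parallel> idn (tys (tl (dropWhile (\<lambda>y. y \<noteq> z) \<Gamma>)))"

text \<open>Selection sort towards the target list: its entries are extracted from the source one
  after another. This singles out a normal form among all composites of symmetries; it is used for
  lists with equal multisets.\<close>

primrec perm :: "('v \<times> 'x) list \<Rightarrow> ('v \<times> 'x) list \<Rightarrow> 'a" where
  "perm \<Gamma> [] = idn []"
| "perm \<Gamma> (z # \<Delta>) = (idn [snd z] \<parallel> perm (remove1 z \<Gamma>) \<Delta>) \<bullet> front z \<Gamma>"

lemma front_split: "z \<notin> set \<Gamma> \<Longrightarrow> front z (\<Gamma> @ z # \<Delta>) = sym (tys \<Gamma>) [snd z] \<parallel> idn (tys \<Delta>)"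
proof -
  assume "z \<notin> set \<Gamma>"
  then have "takeWhile (\<lambda>y. y \<noteq> z) (\<Gamma> @ z # \<Delta>) = \<Gamma>" "dropWhile (\<lambda>y. y \<noteq> z) (\<Gamma> @ z # \<Delta>) = z # \<Delta>"
    by (auto simp: takeWhile_tail dropWhile_append3)
  then show ?thesis by (simp add: front_def)
qed

lemma remove1_split: "z \<notin> set \<Gamma> \<Longrightarrow> remove1 z (\<Gamma> @ z # \<Delta>) = \<Gamma> @ \<Delta>"
  by (simp add: remove1_append)

lemma perm_Cons:
  "z \<notin> set \<Gamma> \<Longrightarrow>
   perm (\<Gamma> @ z # \<Delta>) (z # \<Theta>) = (idn [snd z] \<parallel> perm (\<Gamma> @ \<Delta>) \<Theta>) \<bullet> (sym (tys \<Gamma>) [snd z] \<parallel> idn (tys \<Delta>))"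
  by (simp add: front_split remove1_split)

lemma perm_arr:
  "mset \<Gamma> = mset \<Delta> \<Longrightarrow> arr (perm \<Gamma> \<Delta>) \<and> src (perm \<Gamma> \<Delta>) = tys \<Gamma> \<and> tgt (perm \<Gamma> \<Delta>) = tys \<Delta>"
proof (induction \<Delta> arbitrary: \<Gamma>)
  case (Cons z \<Delta>)
  then have "z \<in> set \<Gamma>"
    by (metis list.set_intros(1) set_mset_mset)
  then obtain \<Gamma>1 \<Gamma>2 where \<Gamma>: "\<Gamma> = \<Gamma>1 @ z # \<Gamma>2" "z \<notin> set \<Gamma>1"
    by (metis split_list_first)
  with Cons.prems have "mset (\<Gamma>1 @ \<Gamma>2) = mset \<Delta>" by simp
  with Cons.IH[of "\<Gamma>1 @ \<Gamma>2"] \<Gamma> show ?case by (simp add: perm_Cons del: perm.simps)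
qed simp

lemma arr_perm [simp]: "mset \<Gamma> = mset \<Delta> \<Longrightarrow> arr (perm \<Gamma> \<Delta>)"
  and src_perm [simp]: "mset \<Gamma> = mset \<Delta> \<Longrightarrow> src (perm \<Gamma> \<Delta>) = tys \<Gamma>"
  and tgt_perm [simp]: "mset \<Gamma> = mset \<Delta> \<Longrightarrow> tgt (perm \<Gamma> \<Delta>) = tys \<Delta>"
  by (simp_all add: perm_arr)

lemma perm_refl [simp]: "perm \<Gamma> \<Gamma> = idn (tys \<Gamma>)"
proof (induction \<Gamma>)
  case (Cons z \<Gamma>)
  then show ?case using perm_Cons[of z "[]" \<Gamma> \<Gamma>] by (simp add: idn_ten del: perm.simps)
qed simp

text \<open>The heart of coherence: the normal form absorbs an adjacent swap. The head
  \<open>z\<close> of the target is the entry extracted first, and its position relative to the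
  swapped pair decides which axiom applies: hexagon, symmetry, interchange or naturality.\<close>

lemma perm_swap:
  assumes "distinct (\<Gamma> @ x # y # \<Delta>)" "mset \<Theta> = mset (\<Gamma> @ x # y # \<Delta>)"
  shows "perm (\<Gamma> @ x # y # \<Delta>) \<Theta> \<bullet> swap \<Gamma> y x \<Delta> = perm (\<Gamma> @ y # x # \<Delta>) \<Theta>"
  using assms
proof (induction \<Theta> arbitrary: \<Gamma> \<Delta>)
  case (Cons z \<Theta>)
  have "z \<in> set (\<Gamma> @ x # y # \<Delta>)"
    using Cons.prems(2) by (metis list.set_intros(1) set_mset_mset)
  then consider "z = x" | "z = y" | "z \<in> set \<Gamma>" | "z \<in> set \<Delta>" by auto
  then show ?case
  proof cases
    case 1
    with Cons.prems have [simp]: "mset (\<Gamma> @ y # \<Delta>) = mset \<Theta>" by simp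
    have p: "perm (\<Gamma> @ x # y # \<Delta>) (x # \<Theta>)
      = (idn [snd x] \<parallel> perm (\<Gamma> @ y # \<Delta>) \<Theta>) \<bullet> (sym (tys \<Gamma>) [snd x] \<parallel> idn (tys (y # \<Delta>)))"
      using Cons.prems by (intro perm_Cons) auto
    have q: "perm ((\<Gamma> @ [y]) @ x # \<Delta>) (x # \<Theta>)
      = (idn [snd x] \<parallel> perm ((\<Gamma> @ [y]) @ \<Delta>) \<Theta>) \<bullet> (sym (tys (\<Gamma> @ [y])) [snd x] \<parallel> idn (tys \<Delta>))"
      using Cons.prems by (intro perm_Cons) auto
    have i: "idn (tys (y # \<Delta>)) = idn [snd y] \<parallel> idn (tys \<Delta>)" by (simp add: idn_ten)
    \<comment> \<open>Extracting \<open>x\<close> from behind \<open>y\<close> amounts to swapping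
      the two and then extracting \<open>x\<close> from behind \<open>\<Gamma>\<close>; this is the
      left hexagon.\<close>
    have "(sym (tys \<Gamma>) [snd x] \<parallel> idn (tys (y # \<Delta>))) \<bullet> swap \<Gamma> y x \<Delta>
      = ((sym (tys \<Gamma>) [snd x] \<parallel> idn [snd y]) \<parallel> idn (tys \<Delta>)) \<bullet>
        ((idn (tys \<Gamma>) \<parallel> sym [snd y] [snd x]) \<parallel> idn (tys \<Delta>))"
      unfolding i by simp
    also have "\<dots> = sym (tys (\<Gamma> @ [y])) [snd x] \<parallel> idn (tys \<Delta>)"
      by (subst interchange) (simp_all add: sym_append_left)
    finally show ?thesis using 1 p q by (simp del: perm.simps)
  next
    case 2
    with Cons.prems have [simp]: "mset (\<Gamma> @ x # \<Delta>) = mset \<Theta>" by simp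
    have p: "perm (\<Gamma> @ y # x # \<Delta>) (y # \<Theta>)
      = (idn [snd y] \<parallel> perm (\<Gamma> @ x # \<Delta>) \<Theta>) \<bullet> (sym (tys \<Gamma>) [snd y] \<parallel> idn (tys (x # \<Delta>)))"
      using Cons.prems by (intro perm_Cons) auto
    have q: "perm ((\<Gamma> @ [x]) @ y # \<Delta>) (y # \<Theta>)
      = (idn [snd y] \<parallel> perm ((\<Gamma> @ [x]) @ \<Delta>) \<Theta>) \<bullet> (sym (tys (\<Gamma> @ [x])) [snd y] \<parallel> idn (tys \<Delta>))"
      using Cons.prems by (intro perm_Cons) auto
    have i: "idn (tys (x # \<Delta>)) = idn [snd x] \<parallel> idn (tys \<Delta>)" by (simp add: idn_ten)
    \<comment> \<open>The swap puts \<open>x\<close> in front of \<open>y\<close>, and extracting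
      \<open>y\<close> takes it back across \<open>x\<close>; the two crossings cancel by
      \<open>sym_inverse\<close>.\<close>
    have "(sym (tys (\<Gamma> @ [x])) [snd y] \<parallel> idn (tys \<Delta>)) \<bullet> swap \<Gamma> y x \<Delta>
      = (sym (tys (\<Gamma> @ [x])) [snd y] \<parallel> idn (tys \<Delta>)) \<bullet>
        ((idn (tys \<Gamma>) \<parallel> sym [snd y] [snd x]) \<parallel> idn (tys \<Delta>))"
      by simp
    also have "\<dots> = (sym (tys (\<Gamma> @ [x])) [snd y] \<bullet> (idn (tys \<Gamma>) \<parallel> sym [snd y] [snd x])) \<parallel> idn (tys \<Delta>)"
      by (subst interchange) simp_all
    also have "sym (tys (\<Gamma> @ [x])) [snd y] \<bullet> (idn (tys \<Gamma>) \<parallel> sym [snd y] [snd x])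
      = sym (tys \<Gamma>) [snd y] \<parallel> idn [snd x]"
      by (simp add: sym_append_left interchange sym_inverse idn_ten)
    finally show ?thesis using 2 p q i by (simp del: perm.simps)
  next
    case 3
    then obtain \<Gamma>1 \<Gamma>2 where \<Gamma>: "\<Gamma> = \<Gamma>1 @ z # \<Gamma>2" by (metis split_list)
    with Cons.prems have m [simp]: "mset ((\<Gamma>1 @ \<Gamma>2) @ x # y # \<Delta>) = mset \<Theta>" by simp
    have IH: "perm ((\<Gamma>1 @ \<Gamma>2) @ x # y # \<Delta>) \<Theta> \<bullet> swap (\<Gamma>1 @ \<Gamma>2) y x \<Delta> = perm ((\<Gamma>1 @ \<Gamma>2) @ y # x # \<Delta>) \<Theta>"
      using Cons.prems \<Gamma> by (intro Cons.IH) auto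
    let ?s = "idn (tys \<Gamma>2) \<parallel> sym [snd y] [snd x] \<parallel> idn (tys \<Delta>)"
    have p: "perm (\<Gamma>1 @ z # \<Gamma>2 @ x # y # \<Delta>) (z # \<Theta>)
      = (idn [snd z] \<parallel> perm (\<Gamma>1 @ \<Gamma>2 @ x # y # \<Delta>) \<Theta>) \<bullet> (sym (tys \<Gamma>1) [snd z] \<parallel> idn (tys (\<Gamma>2 @ x # y # \<Delta>)))"
      using Cons.prems \<Gamma> by (intro perm_Cons) auto
    have q: "perm (\<Gamma>1 @ z # \<Gamma>2 @ y # x # \<Delta>) (z # \<Theta>)
      = (idn [snd z] \<parallel> perm (\<Gamma>1 @ \<Gamma>2 @ y # x # \<Delta>) \<Theta>) \<bullet> (sym (tys \<Gamma>1) [snd z] \<parallel> idn (tys (\<Gamma>2 @ y # x # \<Delta>)))"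
      using Cons.prems \<Gamma> by (intro perm_Cons) auto
    \<comment> \<open>The swapped pair lies to the right of \<open>z\<close>, outside the block that
      the extraction permutes, so the two arrows act on disjoint factors.\<close>
    have "(sym (tys \<Gamma>1) [snd z] \<parallel> idn (tys (\<Gamma>2 @ x # y # \<Delta>))) \<bullet> swap \<Gamma> y x \<Delta>
      = (sym (tys \<Gamma>1) [snd z] \<parallel> idn (tys (\<Gamma>2 @ x # y # \<Delta>))) \<bullet> (idn (tys (\<Gamma>1 @ [z])) \<parallel> ?s)"
      using idn_ten[of "tys (\<Gamma>1 @ [z])" "tys \<Gamma>2"] by (simp add: \<Gamma> flip: ten_assoc)
    also have "\<dots> = sym (tys \<Gamma>1) [snd z] \<parallel> ?s"
      by (subst interchange) simp_all
    also have "\<dots> = (idn (tys (z # \<Gamma>1)) \<parallel> ?s) \<bullet> (sym (tys \<Gamma>1) [snd z] \<parallel> idn (tys (\<Gamma>2 @ y # x # \<Delta>)))"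
      by (subst interchange) simp_all
    also have "idn (tys (z # \<Gamma>1)) \<parallel> ?s = idn [snd z] \<parallel> swap (\<Gamma>1 @ \<Gamma>2) y x \<Delta>"
    proof -
      have "idn (tys (z # \<Gamma>1)) = idn [snd z] \<parallel> idn (tys \<Gamma>1)"
        "idn (tys (\<Gamma>1 @ \<Gamma>2)) = idn (tys \<Gamma>1) \<parallel> idn (tys \<Gamma>2)"
        by (simp_all add: idn_ten)
      then show ?thesis by (simp only: ten_assoc)
    qed
    finally have "perm (\<Gamma>1 @ z # \<Gamma>2 @ x # y # \<Delta>) (z # \<Theta>) \<bullet> swap \<Gamma> y x \<Delta>
      = (idn [snd z] \<parallel> perm (\<Gamma>1 @ \<Gamma>2 @ x # y # \<Delta>) \<Theta>) \<bullet> (idn [snd z] \<parallel> swap (\<Gamma>1 @ \<Gamma>2) y x \<Delta>) \<bullet>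
        (sym (tys \<Gamma>1) [snd z] \<parallel> idn (tys (\<Gamma>2 @ y # x # \<Delta>)))"
      by (simp only: p cmp_assoc)
    also have "\<dots> = (idn [snd z] \<parallel> (perm (\<Gamma>1 @ \<Gamma>2 @ x # y # \<Delta>) \<Theta> \<bullet> swap (\<Gamma>1 @ \<Gamma>2) y x \<Delta>)) \<bullet>
        (sym (tys \<Gamma>1) [snd z] \<parallel> idn (tys (\<Gamma>2 @ y # x # \<Delta>)))"
      using m by (subst interchange') simp_all
    also have "\<dots> = perm (\<Gamma>1 @ z # \<Gamma>2 @ y # x # \<Delta>) (z # \<Theta>)"
      using IH q by (simp del: perm.simps)
    finally show ?thesis using \<Gamma> by simp
  next
    case 4
    then obtain \<Delta>1 \<Delta>2 where \<Delta>: "\<Delta> = \<Delta>1 @ z # \<Delta>2" by (metis split_list)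
    with Cons.prems have m [simp]: "mset (\<Gamma> @ x # y # \<Delta>1 @ \<Delta>2) = mset \<Theta>" by simp
    have IH: "perm (\<Gamma> @ x # y # \<Delta>1 @ \<Delta>2) \<Theta> \<bullet> swap \<Gamma> y x (\<Delta>1 @ \<Delta>2) = perm (\<Gamma> @ y # x # \<Delta>1 @ \<Delta>2) \<Theta>"
      using Cons.prems \<Delta> by (intro Cons.IH) auto
    let ?s = "idn (tys \<Gamma>) \<parallel> sym [snd y] [snd x] \<parallel> idn (tys \<Delta>1)"
    have p: "perm ((\<Gamma> @ x # y # \<Delta>1) @ z # \<Delta>2) (z # \<Theta>)
      = (idn [snd z] \<parallel> perm ((\<Gamma> @ x # y # \<Delta>1) @ \<Delta>2) \<Theta>) \<bullet> (sym (tys (\<Gamma> @ x # y # \<Delta>1)) [snd z] \<parallel> idn (tys \<Delta>2))"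
      using Cons.prems \<Delta> by (intro perm_Cons) auto
    have q: "perm ((\<Gamma> @ y # x # \<Delta>1) @ z # \<Delta>2) (z # \<Theta>)
      = (idn [snd z] \<parallel> perm ((\<Gamma> @ y # x # \<Delta>1) @ \<Delta>2) \<Theta>) \<bullet> (sym (tys (\<Gamma> @ y # x # \<Delta>1)) [snd z] \<parallel> idn (tys \<Delta>2))"
      using Cons.prems \<Delta> by (intro perm_Cons) auto
    have "(sym (tys (\<Gamma> @ x # y # \<Delta>1)) [snd z] \<parallel> idn (tys \<Delta>2)) \<bullet> swap \<Gamma> y x \<Delta>
      = (sym (tys (\<Gamma> @ x # y # \<Delta>1)) [snd z] \<parallel> idn (tys \<Delta>2)) \<bullet> ((?s \<parallel> idn [snd z]) \<parallel> idn (tys \<Delta>2))"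
      by (simp add: \<Delta> idn_ten)
    also have "\<dots> = (sym (tys (\<Gamma> @ x # y # \<Delta>1)) [snd z] \<bullet> (?s \<parallel> idn [snd z])) \<parallel> idn (tys \<Delta>2)"
      by (subst interchange) simp_all
    \<comment> \<open>The swap lies inside the block that \<open>z\<close> crosses and slides
      through the crossing by naturality.\<close>
    also have "sym (tys (\<Gamma> @ x # y # \<Delta>1)) [snd z] \<bullet> (?s \<parallel> idn [snd z])
      = (idn [snd z] \<parallel> ?s) \<bullet> sym (tys (\<Gamma> @ y # x # \<Delta>1)) [snd z]"
      using sym_natural[of ?s "idn [snd z]"] by simp
    also have "\<dots> \<parallel> idn (tys \<Delta>2)
      = ((idn [snd z] \<parallel> ?s) \<parallel> idn (tys \<Delta>2)) \<bullet> (sym (tys (\<Gamma> @ y # x # \<Delta>1)) [snd z] \<parallel> idn (tys \<Delta>2))"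
      by (subst interchange) simp_all
    also have "(idn [snd z] \<parallel> ?s) \<parallel> idn (tys \<Delta>2) = idn [snd z] \<parallel> swap \<Gamma> y x (\<Delta>1 @ \<Delta>2)"
      by (simp add: idn_ten)
    finally have "perm ((\<Gamma> @ x # y # \<Delta>1) @ z # \<Delta>2) (z # \<Theta>) \<bullet> swap \<Gamma> y x \<Delta>
      = (idn [snd z] \<parallel> perm ((\<Gamma> @ x # y # \<Delta>1) @ \<Delta>2) \<Theta>) \<bullet> (idn [snd z] \<parallel> swap \<Gamma> y x (\<Delta>1 @ \<Delta>2)) \<bullet>
        (sym (tys (\<Gamma> @ y # x # \<Delta>1)) [snd z] \<parallel> idn (tys \<Delta>2))"
      by (simp only: p cmp_assoc)
    also have "\<dots> = (idn [snd z] \<parallel> (perm ((\<Gamma> @ x # y # \<Delta>1) @ \<Delta>2) \<Theta> \<bullet> swap \<Gamma> y x (\<Delta>1 @ \<Delta>2))) \<bullet>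
        (sym (tys (\<Gamma> @ y # x # \<Delta>1)) [snd z] \<parallel> idn (tys \<Delta>2))"
      using m by (subst interchange') simp_all
    also have "\<dots> = perm ((\<Gamma> @ y # x # \<Delta>1) @ z # \<Delta>2) (z # \<Theta>)"
      using IH q by (simp del: perm.simps)
    finally show ?thesis using \<Delta> by simp
  qed
qed simp

section \<open>Composites of adjacent swaps and the laws of \<open>perm\<close>\<close>

text \<open>
  \<open>rearr \<Gamma> \<Delta> r\<close> holds for every composite \<open>r\<close> of adjacent swaps; \<open>rearr_perm\<close> below says that the
  composite is determined by its endpoints. Distinctness is essential there: the swap of two equal
  entries is not the identity.
\<close>

inductive rearr :: "('v \<times> 'x) list \<Rightarrow> ('v \<times> 'x) list \<Rightarrow> 'a \<Rightarrow> bool" where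
  refl: "rearr \<Gamma> \<Gamma> (idn (tys \<Gamma>))"
| step: "rearr (\<Gamma> @ x # y # \<Delta>) \<Theta> r \<Longrightarrow> rearr (\<Gamma> @ y # x # \<Delta>) \<Theta> (r \<bullet> swap \<Gamma> y x \<Delta>)"

lemma rearr_mset: "rearr \<Gamma> \<Delta> r \<Longrightarrow> mset \<Gamma> = mset \<Delta>"
  by (induction rule: rearr.induct) (simp_all add: add_mset_commute)

text \<open>The swaps are absorbed one at a time by \<open>perm_swap\<close>, so no trace of the
  chosen route survives.\<close>

lemma rearr_perm: "rearr \<Gamma> \<Delta> r \<Longrightarrow> distinct \<Gamma> \<Longrightarrow> r = perm \<Gamma> \<Delta>"
proof (induction rule: rearr.induct)
  case (step \<Gamma> x y \<Delta> \<Theta> r)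
  then have "distinct (\<Gamma> @ x # y # \<Delta>)" by auto
  then have "r = perm (\<Gamma> @ x # y # \<Delta>) \<Theta>" "mset \<Theta> = mset (\<Gamma> @ x # y # \<Delta>)"
    using step rearr_mset by (blast, metis)
  then show ?case using perm_swap \<open>distinct (\<Gamma> @ x # y # \<Delta>)\<close> by metis
qed simp

lemma rearr_arr: "rearr \<Gamma> \<Delta> r \<Longrightarrow> arr r \<and> src r = tys \<Gamma> \<and> tgt r = tys \<Delta>"
  by (induction rule: rearr.induct) auto

lemma rearr_trans: "rearr \<Gamma> \<Delta> r \<Longrightarrow> rearr \<Delta> \<Theta> s \<Longrightarrow> rearr \<Gamma> \<Theta> (s \<bullet> r)"
proof (induction rule: rearr.induct)
  case (refl \<Gamma>)
  then show ?case using rearr_arr by force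
next
  case (step \<Gamma> x y \<Delta> \<Theta>' r)
  then show ?case using rearr.step[of \<Gamma> x y \<Delta> \<Theta> "s \<bullet> r"] by simp
qed

lemma rearr_append_right: "rearr \<Gamma> \<Delta> r \<Longrightarrow> rearr (\<Gamma> @ \<Theta>) (\<Delta> @ \<Theta>) (r \<parallel> idn (tys \<Theta>))"
proof (induction rule: rearr.induct)
  case (refl \<Gamma>)
  then show ?case using rearr.refl[of "\<Gamma> @ \<Theta>"] by (simp add: idn_ten)
next
  case (step \<Gamma> x y \<Delta> \<Theta>' r)
  then have "rearr (\<Gamma> @ y # x # \<Delta> @ \<Theta>) (\<Theta>' @ \<Theta>) ((r \<parallel> idn (tys \<Theta>)) \<bullet> swap \<Gamma> y x (\<Delta> @ \<Theta>))"
    by (intro rearr.step) simp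
  moreover have "swap \<Gamma> y x (\<Delta> @ \<Theta>) = swap \<Gamma> y x \<Delta> \<parallel> idn (tys \<Theta>)"
    by (simp add: idn_ten)
  moreover have "(r \<parallel> idn (tys \<Theta>)) \<bullet> (swap \<Gamma> y x \<Delta> \<parallel> idn (tys \<Theta>)) = (r \<bullet> swap \<Gamma> y x \<Delta>) \<parallel> idn (tys \<Theta>)"
    using rearr_arr[OF step.hyps] by (subst interchange) simp_all
  ultimately show ?case by simp
qed

lemma rearr_append_left: "rearr \<Gamma> \<Delta> r \<Longrightarrow> rearr (\<Theta> @ \<Gamma>) (\<Theta> @ \<Delta>) (idn (tys \<Theta>) \<parallel> r)"
proof (induction rule: rearr.induct)
  case (refl \<Gamma>)
  then show ?case using rearr.refl[of "\<Theta> @ \<Gamma>"] by (simp add: idn_ten)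
next
  case (step \<Gamma> x y \<Delta> \<Theta>' r)
  then have "rearr ((\<Theta> @ \<Gamma>) @ y # x # \<Delta>) (\<Theta> @ \<Theta>') ((idn (tys \<Theta>) \<parallel> r) \<bullet> swap (\<Theta> @ \<Gamma>) y x \<Delta>)"
    by (intro rearr.step) simp
  moreover have "swap (\<Theta> @ \<Gamma>) y x \<Delta> = idn (tys \<Theta>) \<parallel> swap \<Gamma> y x \<Delta>"
    by (simp flip: idn_ten)
  moreover have "(idn (tys \<Theta>) \<parallel> r) \<bullet> (idn (tys \<Theta>) \<parallel> swap \<Gamma> y x \<Delta>) = idn (tys \<Theta>) \<parallel> (r \<bullet> swap \<Gamma> y x \<Delta>)"
    using rearr_arr[OF step.hyps] by (subst interchange) simp_all
  ultimately show ?case by simp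
qed

lemma rearr_sym_single: "rearr (x # \<Delta>) (\<Delta> @ [x]) (sym [snd x] (tys \<Delta>))"
proof (induction \<Delta>)
  case Nil
  then show ?case using rearr.refl[of "[x]"] by simp
next
  case (Cons y \<Delta>)
  have "rearr ([y] @ x # \<Delta>) ([y] @ \<Delta> @ [x]) (idn (tys [y]) \<parallel> sym [snd x] (tys \<Delta>))"
    by (intro rearr_append_left Cons.IH)
  then have "rearr ([] @ x # y # \<Delta>) ([y] @ \<Delta> @ [x]) ((idn (tys [y]) \<parallel> sym [snd x] (tys \<Delta>)) \<bullet> swap [] x y \<Delta>)"
    by (intro rearr.step) simp
  then show ?case using sym_append[of "[snd x]" "[snd y]" "tys \<Delta>"] by simp
qed

text \<open>The hexagons cut a block symmetry into crossings of single entries, and these into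
  adjacent swaps; thus block symmetries also fall under \<open>rearr_perm\<close>.\<close>

lemma rearr_sym: "rearr (\<Gamma> @ \<Delta>) (\<Delta> @ \<Gamma>) (sym (tys \<Gamma>) (tys \<Delta>))"
proof (induction \<Gamma>)
  case Nil
  then show ?case using rearr.refl[of \<Delta>] by simp
next
  case (Cons x \<Gamma>)
  have "rearr ([x] @ \<Gamma> @ \<Delta>) ([x] @ \<Delta> @ \<Gamma>) (idn (tys [x]) \<parallel> sym (tys \<Gamma>) (tys \<Delta>))"
    by (intro rearr_append_left Cons.IH)
  moreover have "rearr ((x # \<Delta>) @ \<Gamma>) ((\<Delta> @ [x]) @ \<Gamma>) (sym [snd x] (tys \<Delta>) \<parallel> idn (tys \<Gamma>))"
    by (intro rearr_append_right rearr_sym_single)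
  ultimately show ?case
    using rearr_trans sym_append_left[of "[snd x]" "tys \<Gamma>" "tys \<Delta>"] by fastforce
qed

lemma rearr_exists: "mset \<Gamma> = mset \<Delta> \<Longrightarrow> \<exists>r. rearr \<Gamma> \<Delta> r"
proof (induction \<Delta> arbitrary: \<Gamma>)
  case Nil
  then show ?case by (auto intro: rearr.refl)
next
  case (Cons z \<Delta>)
  then have "z \<in> set \<Gamma>"
    by (metis list.set_intros(1) set_mset_mset)
  then obtain \<Gamma>1 \<Gamma>2 where \<Gamma>: "\<Gamma> = \<Gamma>1 @ z # \<Gamma>2"
    by (metis split_list)
  with Cons.prems have "mset (\<Gamma>1 @ \<Gamma>2) = mset \<Delta>" by simp
  then obtain r where "rearr (\<Gamma>1 @ \<Gamma>2) \<Delta> r" using Cons.IH by blast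
  then have "rearr ([z] @ \<Gamma>1 @ \<Gamma>2) ([z] @ \<Delta>) (idn (tys [z]) \<parallel> r)"
    by (rule rearr_append_left)
  moreover have "rearr ((\<Gamma>1 @ [z]) @ \<Gamma>2) (([z] @ \<Gamma>1) @ \<Gamma>2) (sym (tys \<Gamma>1) (tys [z]) \<parallel> idn (tys \<Gamma>2))"
    by (intro rearr_append_right rearr_sym)
  ultimately show ?case using \<Gamma> rearr_trans by fastforce
qed

lemma rearr_perm_exists: "mset \<Gamma> = mset \<Delta> \<Longrightarrow> distinct \<Gamma> \<Longrightarrow> rearr \<Gamma> \<Delta> (perm \<Gamma> \<Delta>)"
  using rearr_exists rearr_perm by blast

text \<open>Laws of \<open>perm\<close> are not computed from its recursion: it suffices to exhibit
  the other side as a composite of swaps with the same endpoints. \<open>perm_append\<close> and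
  \<open>perm_sym\<close> follow the same pattern.\<close>

lemma perm_trans:
  assumes "distinct \<Gamma>" "mset \<Gamma> = mset \<Delta>" "mset \<Delta> = mset \<Theta>"
  shows "perm \<Delta> \<Theta> \<bullet> perm \<Gamma> \<Delta> = perm \<Gamma> \<Theta>"
proof -
  have "distinct \<Delta>" using assms mset_eq_imp_distinct_iff by blast
  then have "rearr \<Gamma> \<Theta> (perm \<Delta> \<Theta> \<bullet> perm \<Gamma> \<Delta>)"
    using assms rearr_perm_exists rearr_trans by blast
  with assms show ?thesis using rearr_perm by blast
qed

lemma perm_trans':
  assumes "distinct \<Gamma>" "mset \<Gamma> = mset \<Delta>" "mset \<Delta> = mset \<Theta>"
  shows "perm \<Delta> \<Theta> \<bullet> perm \<Gamma> \<Delta> \<bullet> f = perm \<Gamma> \<Theta> \<bullet> f"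
  using perm_trans[OF assms] by (metis cmp_assoc)

lemma perm_append:
  assumes "distinct (\<Gamma> @ \<Delta>)" "mset \<Gamma> = mset \<Gamma>'" "mset \<Delta> = mset \<Delta>'"
  shows "perm (\<Gamma> @ \<Delta>) (\<Gamma>' @ \<Delta>') = perm \<Gamma> \<Gamma>' \<parallel> perm \<Delta> \<Delta>'"
proof -
  have "rearr (\<Gamma> @ \<Delta>) (\<Gamma>' @ \<Delta>) (perm \<Gamma> \<Gamma>' \<parallel> idn (tys \<Delta>))"
    using assms by (intro rearr_append_right rearr_perm_exists) auto
  moreover have "rearr (\<Gamma>' @ \<Delta>) (\<Gamma>' @ \<Delta>') (idn (tys \<Gamma>') \<parallel> perm \<Delta> \<Delta>')"
    using assms by (intro rearr_append_left rearr_perm_exists) auto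
  ultimately have "rearr (\<Gamma> @ \<Delta>) (\<Gamma>' @ \<Delta>') ((idn (tys \<Gamma>') \<parallel> perm \<Delta> \<Delta>') \<bullet> (perm \<Gamma> \<Gamma>' \<parallel> idn (tys \<Delta>)))"
    by (rule rearr_trans)
  moreover have "(idn (tys \<Gamma>') \<parallel> perm \<Delta> \<Delta>') \<bullet> (perm \<Gamma> \<Gamma>' \<parallel> idn (tys \<Delta>)) = perm \<Gamma> \<Gamma>' \<parallel> perm \<Delta> \<Delta>'"
    using assms by (subst interchange) simp_all
  ultimately show ?thesis using rearr_perm[OF _ assms(1)] by simp
qed

lemma perm_sym:
  assumes "distinct (\<Gamma> @ \<Delta>)"
  shows "perm (\<Gamma> @ \<Delta>) (\<Delta> @ \<Gamma>) = sym (tys \<Gamma>) (tys \<Delta>)"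
  using rearr_perm[OF rearr_sym assms] by simp

end

section \<open>Semantics of terms up to reordering of contexts\<close>

lemma wf_ctx_distinct: "wf_ctx \<Gamma> \<Longrightarrow> distinct \<Gamma>"
  by (simp add: wf_ctx_def distinct_map)

lemma wf_ctx_append:
  "wf_ctx (\<Gamma> @ \<Delta>) \<longleftrightarrow> wf_ctx \<Gamma> \<and> wf_ctx \<Delta> \<and> fst ` set \<Gamma> \<inter> fst ` set \<Delta> = {}"
  by (auto simp: wf_ctx_def)

lemma wf_ctx_mset: "mset \<Gamma> = mset \<Delta> \<Longrightarrow> wf_ctx \<Gamma> \<longleftrightarrow> wf_ctx \<Delta>"
  unfolding wf_ctx_def by (metis mset_eq_imp_distinct_iff mset_map)

lemma wf_ctx_set_eq: "wf_ctx \<Gamma> \<Longrightarrow> wf_ctx \<Delta> \<Longrightarrow> set \<Gamma> = set \<Delta> \<Longrightarrow> mset \<Gamma> = mset \<Delta>"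
  by (simp add: wf_ctx_distinct flip: set_eq_iff_mset_eq_distinct)

text \<open>Each block is recovered from the set of all declarations and the variables of the first
  block. With \<open>sem_fv\<close> this forces the way in which a context is shared between
  subterms.\<close>

lemma wf_ctx_parts:
  assumes "wf_ctx (\<Gamma> @ \<Delta>)"
  shows "set \<Gamma> = {z \<in> set (\<Gamma> @ \<Delta>). fst z \<in> fst ` set \<Gamma>}"
    and "set \<Delta> = {z \<in> set (\<Gamma> @ \<Delta>). fst z \<notin> fst ` set \<Gamma>}"
  using assms by (auto simp: wf_ctx_append)

lemma ctx_split:
  assumes "distinct \<Pi>" "set \<Pi> \<subseteq> set \<Gamma>"
  obtains \<Delta> where "mset \<Gamma> = mset (\<Pi> @ \<Delta>)"
proof -
  have "mset \<Pi> \<subseteq># mset \<Gamma>"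
    using assms by (metis list.set_finite mset_set_set mset_set_set_mset_msubset
        msubset_mset_set_iff set_mset_mset subset_mset.order_trans)
  then obtain M where "mset \<Gamma> = mset \<Pi> + M" by (metis subset_mset.add_diff_inverse)
  moreover obtain \<Delta> where "M = mset \<Delta>" by (metis ex_mset)
  ultimately show ?thesis using that by simp
qed

text \<open>\<open>ununit_unit\<close> and \<open>unpair_pair\<close> serve the \<beta>-rules, the
  other two inverse laws the \<eta>-rules. \<open>gate\<close> takes its qubits as separate entries
  but returns a single entry of tensor type, as the typing rule does.\<close>

locale plain_semantics = permutative arr src tgt cmp ten idn sym
  for arr :: "'a \<Rightarrow> bool" and src tgt :: "'a \<Rightarrow> 'q ty list"
    and cmp :: "'a \<Rightarrow> 'a \<Rightarrow> 'a"  (infixr \<open>\<bullet>\<close> 60)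
    and ten :: "'a \<Rightarrow> 'a \<Rightarrow> 'a"  (infixr \<open>\<parallel>\<close> 65)
    and idn :: "'q ty list \<Rightarrow> 'a"
    and sym :: "'q ty list \<Rightarrow> 'q ty list \<Rightarrow> 'a" +
  fixes acts :: "'g \<Rightarrow> 'q list"
    and unit ununit :: 'a
    and pair unpair :: "'q ty \<Rightarrow> 'q ty \<Rightarrow> 'a"
    and gate :: "'g \<Rightarrow> 'a"
  assumes unit [simp]: "arr unit" "src unit = []" "tgt unit = [TUnit]"
    and ununit [simp]: "arr ununit" "src ununit = [TUnit]" "tgt ununit = []"
    and pair [simp]: "arr (pair A B)" "src (pair A B) = [A, B]" "tgt (pair A B) = [TTensor A B]"
    and unpair [simp]: "arr (unpair A B)" "src (unpair A B) = [TTensor A B]" "tgt (unpair A B) = [A, B]"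
    and gate [simp]: "arr (gate G)" "src (gate G) = map TQubit (acts G)"
      "tgt (gate G) = [qubits_ty (acts G)]"
    and ununit_unit: "ununit \<bullet> unit = idn []"
    and unit_ununit: "unit \<bullet> ununit = idn [TUnit]"
    and unpair_pair: "unpair A B \<bullet> pair A B = idn [A, B]"
    and pair_unpair: "pair A B \<bullet> unpair A B = idn [TTensor A B]"
begin

text \<open>
  \<open>ops\<close> and \<open>binds\<close> treat the constructors uniformly: \<open>\<phi>\<close> is the arrow of an operation applied to
  the subterms \<open>ts\<close>, and \<open>p\<close> takes the value of type \<open>A\<close> of the bound term \<open>s\<close> apart into the
  context \<open>\<Pi>\<close> that the let-term adds for its body \<open>u\<close>.
\<close>

inductive ops :: "'g trm \<Rightarrow> 'g trm list \<Rightarrow> 'q ty list \<Rightarrow> 'q ty \<Rightarrow> 'a \<Rightarrow> bool" where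
  Star: "ops Star [] [] TUnit unit"
| App: "ops (App G ts) ts (map TQubit (acts G)) (qubits_ty (acts G)) (gate G)"
| Tup: "ops (Tup s t) [s, t] [A, B] (TTensor A B) (pair A B)"

inductive binds :: "'g trm \<Rightarrow> 'g trm \<Rightarrow> 'g trm \<Rightarrow> 'q ty \<Rightarrow> 'q ctx \<Rightarrow> 'a \<Rightarrow> bool" where
  Unit: "binds (LetP PStar s u) s u TUnit [] ununit"
| Pair: "binds (LetP (PPair x y) s u) s u (TTensor A B) [(x, A), (y, B)] (unpair A B)"
| Name: "binds (LetV x s u) s u A [(x, A)] (idn [A])"

lemma ops_arr [simp]: "ops t ts As A \<phi> \<Longrightarrow> arr \<phi>" "ops t ts As A \<phi> \<Longrightarrow> src \<phi> = As"
  "ops t ts As A \<phi> \<Longrightarrow> tgt \<phi> = [A]"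
  by (auto elim: ops.cases)

lemma binds_arr [simp]: "binds t s u A \<Pi> p \<Longrightarrow> arr p" "binds t s u A \<Pi> p \<Longrightarrow> src p = [A]"
  "binds t s u A \<Pi> p \<Longrightarrow> tgt p = tys \<Pi>"
  by (auto elim: binds.cases)

lemma ops_subst:
  "ops t ts As A \<phi> \<Longrightarrow>
   fv t = \<Union> (fv ` set ts) \<and> ops (subst \<sigma> t) (map (subst \<sigma>) ts) As A \<phi> \<and>
   (no_capture \<sigma> t \<longleftrightarrow> (\<forall>t \<in> set ts. no_capture \<sigma> t))"
  by (auto elim!: ops.cases intro: ops.intros)

lemma binds_subst:
  "binds t s u A \<Pi> p \<Longrightarrow>
   fv t = fv s \<union> (fv u - fst ` set \<Pi>) \<and>
   binds (subst \<sigma> t) (subst \<sigma> s) (subst (shadow (fst ` set \<Pi>) \<sigma>) u) A \<Pi> p \<and>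
   (no_capture \<sigma> t \<longleftrightarrow> no_capture \<sigma> s \<and> no_capture (shadow (fst ` set \<Pi>) \<sigma>) u \<and>
     (\<forall>z \<in> fv u - fst ` set \<Pi>. fv (\<sigma> z) \<inter> fst ` set \<Pi> = {}))"
  by (auto elim!: binds.cases intro: binds.intros)

text \<open>\<open>Tup\<close> leaves its two component types open, so the result type and the arrow
  are determined only relative to the argument types; \<open>sem_unique_set\<close> obtains those
  from the subterms. \<open>binds_det\<close> depends on the type of the bound term in the same
  way.\<close>

lemma ops_det:
  "ops t ts As A \<phi> \<Longrightarrow> ops t ts' As' A' \<phi>' \<Longrightarrow> ts' = ts \<and> (As' = As \<longrightarrow> A' = A \<and> \<phi>' = \<phi>)"
  by (auto elim!: ops.cases)

lemma binds_det:
  "binds t s u A \<Pi> p \<Longrightarrow> binds t s' u' A' \<Pi>' p' \<Longrightarrow> s' = s \<and> u' = u \<and> (A' = A \<longrightarrow> \<Pi>' = \<Pi> \<and> p' = p)"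
  by (auto elim!: binds.cases)

lemma ops_not_binds: "ops t ts As A \<phi> \<Longrightarrow> binds t s u B \<Pi> p \<Longrightarrow> False"
  by (auto elim!: ops.cases binds.cases)

lemma Var_simps [simp]: "\<not> ops (Var x) ts As A \<phi>" "\<not> binds (Var x) s u A \<Pi> p"
  by (auto elim: ops.cases binds.cases)

text \<open>The quantified conclusion says that a pattern keeps its type, context and arrow when it
  is moved to another bound term or body, as the commuting conversions do.\<close>

lemma binds_LetP:
  "binds (LetP P s u) s' u' A \<Pi> p \<Longrightarrow>
   s' = s \<and> u' = u \<and> pvars P = fst ` set \<Pi> \<and> (\<forall>s u. binds (LetP P s u) s u A \<Pi> p)"
  by (auto elim!: binds.cases intro: binds.intros)

text \<open>
  There is no exchange rule: a permutation in front of each compound term absorbs it, so that the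
  rules are syntax-directed.
\<close>

inductive sem :: "'q ctx \<Rightarrow> 'g trm \<Rightarrow> 'q ty \<Rightarrow> 'a \<Rightarrow> bool"
  and sems :: "'q ctx \<Rightarrow> 'g trm list \<Rightarrow> 'q ty list \<Rightarrow> 'a \<Rightarrow> bool" where
  Var: "sem [(x, A)] (Var x) A (idn [A])"
| Op: "ops t ts As A \<phi> \<Longrightarrow> sems \<Gamma> ts As f \<Longrightarrow> wf_ctx \<Theta> \<Longrightarrow> mset \<Theta> = mset \<Gamma> \<Longrightarrow>
    sem \<Theta> t A (\<phi> \<bullet> f \<bullet> perm \<Theta> \<Gamma>)"
| Let: "binds t s u A \<Pi> p \<Longrightarrow> sem \<Gamma> s A f \<Longrightarrow> sem (\<Pi> @ \<Delta>) u C g \<Longrightarrow> wf_ctx \<Theta> \<Longrightarrow>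
    mset \<Theta> = mset (\<Gamma> @ \<Delta>) \<Longrightarrow> sem \<Theta> t C (g \<bullet> ((p \<bullet> f) \<parallel> idn (tys \<Delta>)) \<bullet> perm \<Theta> (\<Gamma> @ \<Delta>))"
| Nil: "sems [] [] [] (idn [])"
| Cons: "sem \<Gamma> t A f \<Longrightarrow> sems \<Delta> ts As g \<Longrightarrow> sems (\<Gamma> @ \<Delta>) (t # ts) (A # As) (f \<parallel> g)"

lemma sem_sems_arr:
  shows "sem \<Gamma> t A f \<Longrightarrow> arr f \<and> src f = tys \<Gamma> \<and> tgt f = [A]"
    and "sems \<Gamma> ts As f \<Longrightarrow> arr f \<and> src f = tys \<Gamma> \<and> tgt f = As"
  by (induction rule: sem_sems.inducts) auto

lemma sem_arr [simp]: "sem \<Gamma> t A f \<Longrightarrow> arr f" "sem \<Gamma> t A f \<Longrightarrow> src f = tys \<Gamma>" "sem \<Gamma> t A f \<Longrightarrow> tgt f = [A]"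
  by (simp_all add: sem_sems_arr)

lemma sems_arr [simp]: "sems \<Gamma> ts As f \<Longrightarrow> arr f" "sems \<Gamma> ts As f \<Longrightarrow> src f = tys \<Gamma>" "sems \<Gamma> ts As f \<Longrightarrow> tgt f = As"
  by (simp_all add: sem_sems_arr)

lemma sem_wf: "sem \<Gamma> t A f \<Longrightarrow> wf_ctx \<Gamma>"
  by (induction rule: sem_sems.inducts(1)[where ?P2.0 = "\<lambda>_ _ _ _. True"]) (auto simp: wf_ctx_def)

text \<open>Linearity: no rule weakens or contracts. In the \<open>Let\<close> case
  \<open>sem_wf\<close> keeps the variables of \<open>\<Pi>\<close> apart from the rest of the
  body's context.\<close>

lemma sem_fv: "sem \<Gamma> t A f \<Longrightarrow> fv t = fst ` set \<Gamma>"
  and sems_fv: "sems \<Gamma> ts As f \<Longrightarrow> \<Union> (fv ` set ts) = fst ` set \<Gamma>"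
proof (induction rule: sem_sems.inducts)
  case (Op t ts As A \<phi> \<Gamma> f \<Theta>)
  then show ?case using ops_subst[OF Op(1)] mset_eq_setD[OF Op(5)] by simp
next
  case (Let t s u A \<Pi> p \<Gamma> f \<Delta> C g \<Theta>)
  have "wf_ctx (\<Pi> @ \<Delta>)" using Let(4) by (rule sem_wf)
  then have "fst ` set \<Pi> \<inter> fst ` set \<Delta> = {}" by (simp add: wf_ctx_append)
  then show ?case using Let binds_subst[OF Let(1)] mset_eq_setD[OF Let(7)] by (simp add: image_Un) blast
qed (simp_all add: image_Un)

lemma perm_trans_ctx:
  assumes "wf_ctx \<Gamma>" "mset \<Gamma> = mset \<Delta>" "mset \<Delta> = mset \<Theta>"
  shows "perm \<Delta> \<Theta> \<bullet> perm \<Gamma> \<Delta> = perm \<Gamma> \<Theta>" "perm \<Delta> \<Theta> \<bullet> perm \<Gamma> \<Delta> \<bullet> f = perm \<Gamma> \<Theta> \<bullet> f"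
  using assms by (simp_all add: perm_trans perm_trans' wf_ctx_distinct)

text \<open>Exchange is admissible because the permutation already in front of a compound term
  composes with the new one to a single \<open>perm\<close>, and the one-entry context of a variable
  has only the trivial reordering.\<close>

lemma sem_perm:
  assumes "sem \<Gamma> t A f" "mset \<Theta> = mset \<Gamma>"
  shows "sem \<Theta> t A (f \<bullet> perm \<Theta> \<Gamma>)"
  using assms(1)
proof cases
  case (Var x)
  then have "\<Theta> = \<Gamma>" using assms by simp
  then show ?thesis using assms(1) by (simp add: sem_arr)
next
  case (Op ts As \<phi> \<Gamma>' f')
  then have wf: "wf_ctx \<Theta>" using assms(2) wf_ctx_mset by blast
  with Op assms(2) have "sem \<Theta> t A (\<phi> \<bullet> f' \<bullet> perm \<Theta> \<Gamma>')" by (auto intro: sem_sems.Op)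
  with Op assms(2) wf show ?thesis by (simp add: perm_trans_ctx)
next
  case (Let s u A' \<Pi> p \<Gamma>' f' \<Delta> g)
  then have wf: "wf_ctx \<Theta>" using assms(2) wf_ctx_mset by blast
  with Let assms(2) have "sem \<Theta> t A (g \<bullet> ((p \<bullet> f') \<parallel> idn (tys \<Delta>)) \<bullet> perm \<Theta> (\<Gamma>' @ \<Delta>))"
    by (auto intro: sem_sems.Let)
  with Let assms(2) wf show ?thesis by (simp add: perm_trans_ctx)
qed

lemma sem_Op: "ops t ts As A \<phi> \<Longrightarrow> sems \<Gamma> ts As f \<Longrightarrow> wf_ctx \<Gamma> \<Longrightarrow> sem \<Gamma> t A (\<phi> \<bullet> f)"
  using sem_sems.Op[of t ts As A \<phi> \<Gamma> f \<Gamma>] by simp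

lemma sem_Let:
  "binds t s u A \<Pi> p \<Longrightarrow> sem \<Gamma> s A f \<Longrightarrow> sem (\<Pi> @ \<Delta>) u C g \<Longrightarrow> wf_ctx (\<Gamma> @ \<Delta>) \<Longrightarrow>
   sem (\<Gamma> @ \<Delta>) t C (g \<bullet> ((p \<bullet> f) \<parallel> idn (tys \<Delta>)))"
  using sem_sems.Let[of t s u A \<Pi> p \<Gamma> f \<Delta> C g "\<Gamma> @ \<Delta>"] by simp

text \<open>The premise on \<open>ops\<close> discloses the shape of \<open>t\<close>. Its types
  \<open>As'\<close> and \<open>A'\<close> may differ from those used in the meaning
  \<open>k\<close>, which are therefore returned anew; \<open>sem_LetE\<close> is to be read
  likewise.\<close>

lemma sem_OpE:
  assumes "sem \<Theta> t A k" "ops t ts As' A' \<phi>'"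
  obtains As \<phi> \<Gamma> f where "ops t ts As A \<phi>" "sems \<Gamma> ts As f" "mset \<Theta> = mset \<Gamma>" "wf_ctx \<Gamma>"
    "k = \<phi> \<bullet> f \<bullet> perm \<Theta> \<Gamma>"
  using assms(1)
proof cases
  case (Op ts' As \<phi> \<Gamma> f)
  then show ?thesis using that assms(2) ops_det wf_ctx_mset by metis
next
  case Let
  then show ?thesis using assms(2) ops_not_binds by blast
qed (use assms in auto)

lemma sem_LetE:
  assumes "sem \<Theta> t C k" "binds t s u A' \<Pi>' p'"
  obtains A \<Pi> p \<Gamma> \<Delta> f g where "binds t s u A \<Pi> p" "sem \<Gamma> s A f" "sem (\<Pi> @ \<Delta>) u C g"
    "mset \<Theta> = mset (\<Gamma> @ \<Delta>)" "wf_ctx (\<Gamma> @ \<Delta>)" "k = g \<bullet> ((p \<bullet> f) \<parallel> idn (tys \<Delta>)) \<bullet> perm \<Theta> (\<Gamma> @ \<Delta>)"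
  using assms(1)
proof cases
  case (Let s' u' A \<Pi> p \<Gamma> f \<Delta> g)
  then show ?thesis using that assms(2) binds_det wf_ctx_mset by metis
next
  case Op
  then show ?thesis using assms(2) ops_not_binds by blast
qed (use assms in auto)

text \<open>Contexts are compared as sets because that is what subterms inherit: equal variables cut
  equal parts from equal sets. Well-formedness turns these into equal multisets, and
  \<open>perm\<close> accounts for the order. For \<open>sems\<close> well-formedness is a premise,
  since its rules concatenate contexts unchecked.\<close>

lemma sem_unique_set:
  shows "sem \<Gamma> t A f \<Longrightarrow> sem \<Gamma>' t A' f' \<Longrightarrow> set \<Gamma>' = set \<Gamma> \<Longrightarrow> A' = A \<and> f' = f \<bullet> perm \<Gamma>' \<Gamma>"
    and "sems \<Gamma> ts As f \<Longrightarrow> sems \<Gamma>' ts As' f' \<Longrightarrow> wf_ctx \<Gamma> \<Longrightarrow> wf_ctx \<Gamma>' \<Longrightarrow> set \<Gamma>' = set \<Gamma> \<Longrightarrow>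
      As' = As \<and> f' = f \<bullet> perm \<Gamma>' \<Gamma>"
proof (induction arbitrary: \<Gamma>' A' f' and \<Gamma>' As' f' rule: sem_sems.inducts)
  case (Var x A)
  then have "wf_ctx \<Gamma>'" by (blast intro: sem_wf)
  then have "mset \<Gamma>' = mset [(x, A)]" using Var(2) by (intro wf_ctx_set_eq) (auto simp: wf_ctx_def)
  then have "\<Gamma>' = [(x, A)]" by simp
  moreover from Var(1) have "A' = snd (hd \<Gamma>')" "f' = idn [A']" by (cases, auto)+
  ultimately show ?case by simp
next
  case (Op t ts As A \<phi> \<Gamma> f \<Theta>)
  obtain As' \<phi>' \<Delta> f1 where D: "ops t ts As' A' \<phi>'" "sems \<Delta> ts As' f1" "mset \<Gamma>' = mset \<Delta>"
    "wf_ctx \<Delta>" "f' = \<phi>' \<bullet> f1 \<bullet> perm \<Gamma>' \<Delta>"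
    using sem_OpE[OF Op(6) Op(1)] by metis
  have wf: "wf_ctx \<Gamma>'" "wf_ctx \<Gamma>" using Op sem_wf wf_ctx_mset by blast+
  have s: "set \<Delta> = set \<Gamma>" using Op(5) Op.prems(2) D(3) by (metis mset_eq_setD)
  then have e: "As' = As" "f1 = f \<bullet> perm \<Delta> \<Gamma>" using Op(3)[OF D(2)] D wf by auto
  then have "A' = A" "\<phi>' = \<phi>" using ops_det[OF Op(1) D(1)] by auto
  moreover have "mset \<Gamma>' = mset \<Theta>" "mset \<Delta> = mset \<Gamma>"
    using wf_ctx_set_eq[of \<Gamma>' \<Theta>] wf_ctx_set_eq[of \<Delta> \<Gamma>] Op(4,7) D(4) wf s by simp_all
  ultimately show ?case using D e wf Op(5) by (simp add: perm_trans_ctx)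
next
  case (Let t s u A \<Pi> p \<Gamma> f \<Delta> C g \<Theta>)
  obtain B \<Pi>' p' \<Gamma>1 \<Delta>1 f1 g1 where D: "binds t s u B \<Pi>' p'" "sem \<Gamma>1 s B f1" "sem (\<Pi>' @ \<Delta>1) u A' g1"
    "mset \<Gamma>' = mset (\<Gamma>1 @ \<Delta>1)" "wf_ctx (\<Gamma>1 @ \<Delta>1)" "f' = g1 \<bullet> ((p' \<bullet> f1) \<parallel> idn (tys \<Delta>1)) \<bullet> perm \<Gamma>' (\<Gamma>1 @ \<Delta>1)"
    using sem_LetE[OF Let.prems(1) Let(1)] by metis
  have wf: "wf_ctx \<Gamma>'" "wf_ctx (\<Gamma> @ \<Delta>)" using Let sem_wf wf_ctx_mset by blast+
  have s: "set (\<Gamma>1 @ \<Delta>1) = set (\<Gamma> @ \<Delta>)" using Let(7) Let.prems(2) D(4) by (metis mset_eq_setD)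
  \<comment> \<open>Both parts are contexts of the same term \<open>s\<close>, so by linearity they
    declare the same variables, and the two splittings agree.\<close>
  have v: "fst ` set \<Gamma>1 = fst ` set \<Gamma>" using sem_fv[OF Let(2)] sem_fv[OF D(2)] by simp
  have s1: "set \<Gamma>1 = set \<Gamma>" using wf_ctx_parts(1)[OF wf(2)] wf_ctx_parts(1)[OF D(5)] s v by metis
  have s2: "set \<Delta>1 = set \<Delta>" using wf_ctx_parts(2)[OF wf(2)] wf_ctx_parts(2)[OF D(5)] s v by metis
  \<comment> \<open>The induction hypothesis fixes the type of the bound term and with it the types
    of the bound variables, which makes the two bodies comparable.\<close>
  have e: "B = A" "f1 = f \<bullet> perm \<Gamma>1 \<Gamma>" using Let(3)[OF D(2) s1] by auto
  then have p: "\<Pi>' = \<Pi>" "p' = p" using binds_det[OF Let(1) D(1)] by auto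
  then have e2: "A' = C" "g1 = g \<bullet> perm (\<Pi> @ \<Delta>1) (\<Pi> @ \<Delta>)" using Let(5)[OF D(3)] s2 by auto
  have m: "mset \<Gamma>1 = mset \<Gamma>" "mset \<Delta>1 = mset \<Delta>" "mset \<Gamma>' = mset \<Theta>"
    using s1 s2 D(5) wf Let(6,9) wf_ctx_set_eq[of \<Gamma>1 \<Gamma>] wf_ctx_set_eq[of \<Delta>1 \<Delta>] wf_ctx_set_eq[of \<Gamma>' \<Theta>]
    by (simp_all add: wf_ctx_append)
  \<comment> \<open>The bound variables come first and in the same order on both sides, so only
    \<open>\<Delta>1\<close> is reordered.\<close>
  have "perm (\<Pi> @ \<Delta>1) (\<Pi> @ \<Delta>) = idn (tys \<Pi>) \<parallel> perm \<Delta>1 \<Delta>"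
    using perm_append[of \<Pi> \<Delta>1 \<Pi> \<Delta>] m wf_ctx_distinct[OF sem_wf[OF D(3)]] p by simp
  then have "g1 \<bullet> ((p' \<bullet> f1) \<parallel> idn (tys \<Delta>1)) = g \<bullet> (idn (tys \<Pi>) \<parallel> perm \<Delta>1 \<Delta>) \<bullet> ((p \<bullet> f \<bullet> perm \<Gamma>1 \<Gamma>) \<parallel> idn (tys \<Delta>1))"
    using e e2 p by simp
  also have "\<dots> = g \<bullet> ((p \<bullet> f) \<parallel> idn (tys \<Delta>)) \<bullet> (perm \<Gamma>1 \<Gamma> \<parallel> perm \<Delta>1 \<Delta>)"
    using Let(1,2,4) m by (simp add: interchange)
  also have "perm \<Gamma>1 \<Gamma> \<parallel> perm \<Delta>1 \<Delta> = perm (\<Gamma>1 @ \<Delta>1) (\<Gamma> @ \<Delta>)"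
    using m wf_ctx_distinct[OF D(5)] by (simp only: perm_append)
  finally have "f' = (g \<bullet> ((p \<bullet> f) \<parallel> idn (tys \<Delta>)) \<bullet> perm (\<Gamma>1 @ \<Delta>1) (\<Gamma> @ \<Delta>)) \<bullet> perm \<Gamma>' (\<Gamma>1 @ \<Delta>1)"
    using D(6) by (metis cmp_assoc)
  then show ?case using e2 m D(4) Let(7) wf by (simp add: perm_trans_ctx)
next
  case Nil
  from Nil(1) show ?case by cases auto
next
  case (Cons \<Gamma> t A f \<Delta> ts As g)
  from Cons.prems(1) obtain \<Gamma>1 \<Delta>1 f1 g1 B Bs where D: "\<Gamma>' = \<Gamma>1 @ \<Delta>1" "As' = B # Bs" "f' = f1 \<parallel> g1"
    "sem \<Gamma>1 t B f1" "sems \<Delta>1 ts Bs g1"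
    by cases auto
  have v: "fst ` set \<Gamma>1 = fst ` set \<Gamma>" using sem_fv[OF Cons(1)] sem_fv[OF D(4)] by simp
  have wf: "wf_ctx (\<Gamma> @ \<Delta>)" "wf_ctx (\<Gamma>1 @ \<Delta>1)" using Cons.prems D by auto
  have s1: "set \<Gamma>1 = set \<Gamma>" using wf_ctx_parts(1)[OF wf(1)] wf_ctx_parts(1)[OF wf(2)] Cons.prems(4) v D(1) by metis
  have s2: "set \<Delta>1 = set \<Delta>" using wf_ctx_parts(2)[OF wf(1)] wf_ctx_parts(2)[OF wf(2)] Cons.prems(4) v D(1) by metis
  have m: "mset \<Gamma>1 = mset \<Gamma>" "mset \<Delta>1 = mset \<Delta>"
    using s1 s2 wf wf_ctx_set_eq[of \<Gamma>1 \<Gamma>] wf_ctx_set_eq[of \<Delta>1 \<Delta>] by (simp_all add: wf_ctx_append)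
  have "B = A" "f1 = f \<bullet> perm \<Gamma>1 \<Gamma>" "Bs = As" "g1 = g \<bullet> perm \<Delta>1 \<Delta>"
    using Cons(2)[OF D(4) s1] Cons(4)[OF D(5)] s2 wf by (auto simp: wf_ctx_append)
  moreover have "perm (\<Gamma>1 @ \<Delta>1) (\<Gamma> @ \<Delta>) = perm \<Gamma>1 \<Gamma> \<parallel> perm \<Delta>1 \<Delta>"
    using m wf_ctx_distinct[OF wf(2)] by (simp only: perm_append)
  ultimately show ?case using D m Cons(1,3) by (simp add: interchange)
qed

lemma sem_unique: "sem \<Gamma> t A f \<Longrightarrow> sem \<Gamma> t A' f' \<Longrightarrow> A' = A \<and> f' = f"
  using sem_unique_set(1)[of \<Gamma> t A f \<Gamma> A' f'] by simp

text \<open>The method for the basic equations: it is enough to find one ordering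
  \<open>\<Gamma>\<close> of the context over which both terms have literally the same arrow
  \<open>h\<close>.\<close>

lemma sem_eqI:
  assumes "sem \<Theta> s A f" "sem \<Theta> t A g" "mset \<Theta> = mset \<Gamma>" "sem \<Gamma> s B h" "sem \<Gamma> t B' h"
  shows "f = g"
  using sem_unique sem_perm[OF assms(4,3)] sem_perm[OF assms(5,3)] assms(1,2) by metis

section \<open>Argument lists and semantic substitution\<close>

lemma sems_append_iff:
  assumes "length ts = length As"
  shows "sems \<Gamma> (ts @ us) (As @ Bs) f \<longleftrightarrow>
    (\<exists>\<Gamma>1 \<Gamma>2 f1 f2. \<Gamma> = \<Gamma>1 @ \<Gamma>2 \<and> f = f1 \<parallel> f2 \<and> sems \<Gamma>1 ts As f1 \<and> sems \<Gamma>2 us Bs f2)"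
  using assms
proof (induction ts As arbitrary: \<Gamma> f rule: list_induct2)
  case Nil
  have Nil: "sems \<Gamma>1 [] [] f1 \<longleftrightarrow> \<Gamma>1 = [] \<and> f1 = idn []" for \<Gamma>1 f1
    by (auto elim: sems.cases intro: sem_sems.intros)
  have e: "idn [] \<parallel> g = g" if "sems \<Delta> us Bs g" for \<Delta> g
    using that by simp
  show ?case
  proof
    assume "sems \<Gamma> ([] @ us) ([] @ Bs) f"
    then show "\<exists>\<Gamma>1 \<Gamma>2 f1 f2. \<Gamma> = \<Gamma>1 @ \<Gamma>2 \<and> f = f1 \<parallel> f2 \<and> sems \<Gamma>1 [] [] f1 \<and> sems \<Gamma>2 us Bs f2"
      using e[of \<Gamma> f] by (intro exI[of _ "[]"] exI[of _ \<Gamma>] exI[of _ "idn []"] exI[of _ f]) (simp add: Nil)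
  next
    assume "\<exists>\<Gamma>1 \<Gamma>2 f1 f2. \<Gamma> = \<Gamma>1 @ \<Gamma>2 \<and> f = f1 \<parallel> f2 \<and> sems \<Gamma>1 [] [] f1 \<and> sems \<Gamma>2 us Bs f2"
    then show "sems \<Gamma> ([] @ us) ([] @ Bs) f"
      using e by (elim exE conjE) (simp add: Nil)
  qed
next
  case (Cons t ts A As)
  have C: "sems \<Gamma> (t # ts) (A # As) f \<longleftrightarrow>
    (\<exists>\<Gamma>1 \<Gamma>2 f1 f2. \<Gamma> = \<Gamma>1 @ \<Gamma>2 \<and> f = f1 \<parallel> f2 \<and> sem \<Gamma>1 t A f1 \<and> sems \<Gamma>2 ts As f2)" for \<Gamma> ts As f
  proof
    assume "sems \<Gamma> (t # ts) (A # As) f"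
    then show "\<exists>\<Gamma>1 \<Gamma>2 f1 f2. \<Gamma> = \<Gamma>1 @ \<Gamma>2 \<and> f = f1 \<parallel> f2 \<and> sem \<Gamma>1 t A f1 \<and> sems \<Gamma>2 ts As f2"
      by cases metis
  qed (use sem_sems.Cons in blast)
  show ?case
  proof
    assume "sems \<Gamma> ((t # ts) @ us) ((A # As) @ Bs) f"
    then obtain \<Gamma>1 \<Gamma>2 \<Gamma>3 f1 f2 f3 where
      D: "\<Gamma> = \<Gamma>1 @ \<Gamma>2 @ \<Gamma>3" "f = f1 \<parallel> f2 \<parallel> f3" "sem \<Gamma>1 t A f1" "sems \<Gamma>2 ts As f2" "sems \<Gamma>3 us Bs f3"
      unfolding append_Cons C Cons.IH by blast
    show "\<exists>\<Gamma>1 \<Gamma>2 f1 f2. \<Gamma> = \<Gamma>1 @ \<Gamma>2 \<and> f = f1 \<parallel> f2 \<and> sems \<Gamma>1 (t # ts) (A # As) f1 \<and> sems \<Gamma>2 us Bs f2"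
      by (intro exI[of _ "\<Gamma>1 @ \<Gamma>2"] exI[of _ \<Gamma>3] exI[of _ "f1 \<parallel> f2"] exI[of _ f3])
        (simp add: D sem_sems.Cons)
  next
    assume "\<exists>\<Gamma>1 \<Gamma>2 f1 f2. \<Gamma> = \<Gamma>1 @ \<Gamma>2 \<and> f = f1 \<parallel> f2 \<and> sems \<Gamma>1 (t # ts) (A # As) f1 \<and> sems \<Gamma>2 us Bs f2"
    then obtain \<Gamma>1 \<Gamma>2 \<Gamma>3 f1 f2 f3 where
      D: "\<Gamma> = (\<Gamma>1 @ \<Gamma>2) @ \<Gamma>3" "f = (f1 \<parallel> f2) \<parallel> f3" "sem \<Gamma>1 t A f1" "sems \<Gamma>2 ts As f2" "sems \<Gamma>3 us Bs f3"
      unfolding C by blast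
    have "sems (\<Gamma>2 @ \<Gamma>3) (ts @ us) (As @ Bs) (f2 \<parallel> f3)"
      unfolding Cons.IH using D(4,5) by blast
    from sem_sems.Cons[OF D(3) this] show "sems \<Gamma> ((t # ts) @ us) ((A # As) @ Bs) f"
      by (simp add: D)
  qed
qed

lemma sems_length: "sems \<Gamma> ts As f \<Longrightarrow> length ts = length As"
  by (induction rule: sem_sems.inducts(2)[where ?P1.0 = "\<lambda>_ _ _ _. True"]) auto

lemma sems_single: "sems \<Gamma> [t] [A] f \<longleftrightarrow> sem \<Gamma> t A f"
proof
  show "sem \<Gamma> t A f \<Longrightarrow> sems \<Gamma> [t] [A] f"
    using sem_sems.Cons[OF _ sem_sems.Nil] by fastforce
next
  assume "sems \<Gamma> [t] [A] f"
  then obtain \<Gamma>1 \<Delta> f1 g where D: "\<Gamma> = \<Gamma>1 @ \<Delta>" "f = f1 \<parallel> g" "sem \<Gamma>1 t A f1" "sems \<Delta> [] [] g"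
    by cases blast
  from D(4) have "\<Delta> = []" "g = idn []" by (cases, simp)+
  with D show "sem \<Gamma> t A f" by simp
qed

lemma sems_append:
  assumes "sems \<Gamma> ts As f" "sems \<Delta> us Bs g"
  shows "sems (\<Gamma> @ \<Delta>) (ts @ us) (As @ Bs) (f \<parallel> g)"
  unfolding sems_append_iff[OF sems_length[OF assms(1)]] using assms by blast

text \<open>The identity substitution, needed for the variables that a substitution leaves
  alone.\<close>

lemma sems_vars: "sems \<Gamma> (map (\<lambda>z. Var (fst z)) \<Gamma>) (tys \<Gamma>) (idn (tys \<Gamma>))"
proof (induction \<Gamma>)
  case (Cons z \<Gamma>)
  have "sem [z] (Var (fst z)) (snd z) (idn [snd z])"
    using sem_sems.Var[of "fst z" "snd z"] by simp
  from sem_sems.Cons[OF this Cons.IH] show ?case by (simp add: idn_ten)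
qed (simp add: sem_sems.Nil)

text \<open>
  In \<open>substs \<Gamma> \<sigma> \<Delta> f\<close>, the arrow \<open>f\<close> is the tensor of the meanings of the terms substituted for the
  variables of \<open>\<Delta>\<close>, and \<open>\<Gamma>\<close> is the concatenation of their contexts.
\<close>

abbreviation substs :: "'q ctx \<Rightarrow> (var \<Rightarrow> 'g trm) \<Rightarrow> 'q ctx \<Rightarrow> 'a \<Rightarrow> bool" where
  "substs \<Gamma> \<sigma> \<Delta> f \<equiv> sems \<Gamma> (map (\<lambda>z. \<sigma> (fst z)) \<Delta>) (tys \<Delta>) f"

lemma substs_append_iff:
  "substs \<Gamma> \<sigma> (\<Delta> @ \<Theta>) f \<longleftrightarrow>
    (\<exists>\<Gamma>1 \<Gamma>2 f1 f2. \<Gamma> = \<Gamma>1 @ \<Gamma>2 \<and> f = f1 \<parallel> f2 \<and> substs \<Gamma>1 \<sigma> \<Delta> f1 \<and> substs \<Gamma>2 \<sigma> \<Theta> f2)"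
  by (simp add: sems_append_iff)

lemma substs_Cons_iff:
  "substs \<Gamma> \<sigma> (z # \<Delta>) f \<longleftrightarrow>
    (\<exists>\<Gamma>1 \<Gamma>2 f1 f2. \<Gamma> = \<Gamma>1 @ \<Gamma>2 \<and> f = f1 \<parallel> f2 \<and> sem \<Gamma>1 (\<sigma> (fst z)) (snd z) f1 \<and> substs \<Gamma>2 \<sigma> \<Delta> f2)"
  using substs_append_iff[of \<Gamma> \<sigma> "[z]" \<Delta> f] by (simp add: sems_single)

lemma substs_cong:
  "substs \<Gamma> \<sigma> \<Delta> f \<Longrightarrow> (\<And>z. z \<in> fst ` set \<Delta> \<Longrightarrow> \<sigma> z = \<tau> z) \<Longrightarrow> substs \<Gamma> \<tau> \<Delta> f"
  by (metis (mono_tags, lifting) image_eqI map_eq_conv)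

text \<open>Naturality of the symmetry, one swap at a time: when two variables trade places, the
  contexts of the terms substituted for them trade places as blocks. Induction over
  \<open>rearr\<close> exposes the single swaps that \<open>perm\<close> hides.\<close>

lemma substs_rearr:
  assumes "rearr \<Delta> \<Delta>' r" "substs \<Gamma> \<sigma> \<Delta> f"
  shows "\<exists>\<Gamma>' r' f'. substs \<Gamma>' \<sigma> \<Delta>' f' \<and> rearr \<Gamma> \<Gamma>' r' \<and> r \<bullet> f = f' \<bullet> r'"
  using assms
proof (induction arbitrary: \<Gamma> f rule: rearr.induct)
  case (refl \<Delta>)
  then have "idn (tys \<Delta>) \<bullet> f = f \<bullet> idn (tys \<Gamma>)" by simp
  then show ?case using refl rearr.refl by blast
next
  case (step \<Delta>1 x y \<Delta>2 \<Theta> r)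
  from step.prems obtain \<Gamma>1 \<Gamma>y \<Gamma>x \<Gamma>2 f1 fy fx f2 where D: "\<Gamma> = \<Gamma>1 @ \<Gamma>y @ \<Gamma>x @ \<Gamma>2" "f = f1 \<parallel> fy \<parallel> fx \<parallel> f2"
    "substs \<Gamma>1 \<sigma> \<Delta>1 f1" "sem \<Gamma>y (\<sigma> (fst y)) (snd y) fy" "sem \<Gamma>x (\<sigma> (fst x)) (snd x) fx" "substs \<Gamma>2 \<sigma> \<Delta>2 f2"
    unfolding substs_append_iff substs_Cons_iff by blast
  let ?f = "f1 \<parallel> fx \<parallel> fy \<parallel> f2"
  let ?s = "idn (tys \<Gamma>1) \<parallel> sym (tys \<Gamma>y) (tys \<Gamma>x) \<parallel> idn (tys \<Gamma>2)"
  have "substs (\<Gamma>1 @ \<Gamma>x @ \<Gamma>y @ \<Gamma>2) \<sigma> (\<Delta>1 @ x # y # \<Delta>2) ?f"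
    using sems_append[OF D(3) sem_sems.Cons[OF D(5) sem_sems.Cons[OF D(4) D(6)]]] by simp
  then obtain \<Gamma>' r' f' where E: "substs \<Gamma>' \<sigma> \<Theta> f'" "rearr (\<Gamma>1 @ \<Gamma>x @ \<Gamma>y @ \<Gamma>2) \<Gamma>' r'" "r \<bullet> ?f = f' \<bullet> r'"
    using step.IH by blast
  have "rearr (\<Gamma>1 @ (\<Gamma>y @ \<Gamma>x) @ \<Gamma>2) (\<Gamma>1 @ (\<Gamma>x @ \<Gamma>y) @ \<Gamma>2) ?s"
    by (intro rearr_append_left rearr_append_right rearr_sym)
  then have "rearr \<Gamma> (\<Gamma>1 @ \<Gamma>x @ \<Gamma>y @ \<Gamma>2) ?s" using D(1) by simp
  then have q: "rearr \<Gamma> \<Gamma>' (r' \<bullet> ?s)" using E(2) by (rule rearr_trans)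
  have sw: "swap \<Delta>1 y x \<Delta>2 \<bullet> f = ?f \<bullet> ?s"
  proof -
    have "swap \<Delta>1 y x \<Delta>2 \<bullet> f = f1 \<parallel> (sym [snd y] [snd x] \<bullet> (fy \<parallel> fx)) \<parallel> f2"
      using D interchange[of "sym [snd y] [snd x]" "fy \<parallel> fx" "idn (tys \<Delta>2)" f2] by (simp add: interchange)
    also have "sym [snd y] [snd x] \<bullet> (fy \<parallel> fx) = (fx \<parallel> fy) \<bullet> sym (tys \<Gamma>y) (tys \<Gamma>x)"
      using D sym_natural[of fy fx] by simp
    also have "f1 \<parallel> \<dots> \<parallel> f2 = ?f \<bullet> ?s"
      using D interchange[of "fx \<parallel> fy" "sym (tys \<Gamma>y) (tys \<Gamma>x)" f2 "idn (tys \<Gamma>2)"] by (simp add: interchange)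
    finally show ?thesis .
  qed
  have "(r \<bullet> swap \<Delta>1 y x \<Delta>2) \<bullet> f = (r \<bullet> ?f) \<bullet> ?s"
    by (simp only: cmp_assoc sw)
  also have "\<dots> = f' \<bullet> r' \<bullet> ?s" by (simp only: cmp_assoc E(3))
  finally show ?case using E(1) q by blast
qed

lemma substs_perm:
  assumes "substs \<Gamma> \<sigma> \<Delta> f" "mset \<Delta> = mset \<Delta>'" "wf_ctx \<Delta>" "wf_ctx \<Gamma>"
  obtains \<Gamma>' f' where "substs \<Gamma>' \<sigma> \<Delta>' f'" "mset \<Gamma> = mset \<Gamma>'" "perm \<Delta> \<Delta>' \<bullet> f = f' \<bullet> perm \<Gamma> \<Gamma>'"
proof -
  have "rearr \<Delta> \<Delta>' (perm \<Delta> \<Delta>')"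
    using assms by (simp add: rearr_perm_exists wf_ctx_distinct)
  from substs_rearr[OF this assms(1)] obtain \<Gamma>' r' f'
    where *: "substs \<Gamma>' \<sigma> \<Delta>' f'" "rearr \<Gamma> \<Gamma>' r'" "perm \<Delta> \<Delta>' \<bullet> f = f' \<bullet> r'"
    by blast
  have "r' = perm \<Gamma> \<Gamma>'" using *(2) wf_ctx_distinct[OF assms(4)] by (rule rearr_perm)
  with * rearr_mset[OF *(2)] show ?thesis using that by simp
qed

lemma substs_fv:
  assumes "substs \<Gamma> \<sigma> \<Delta> f"
  shows "fst ` set \<Gamma> = (\<Union>z \<in> fst ` set \<Delta>. fv (\<sigma> z))"
  using sems_fv[OF assms] by (simp add: image_image)

text \<open>What separates a substitution from the subterms is the permutation stored in front of a
  compound term. \<open>substs_perm\<close> pushes it through, turning it into a reordering of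
  \<open>\<Gamma>\<close>; the substituted tensor then divides along the subterms.\<close>

lemma sem_subst:
  shows "sem \<Delta> t C g \<Longrightarrow> substs \<Gamma> \<sigma> \<Delta> f \<Longrightarrow> wf_ctx \<Gamma> \<Longrightarrow> no_capture \<sigma> t \<Longrightarrow> sem \<Gamma> (subst \<sigma> t) C (g \<bullet> f)"
    and "sems \<Delta> ts Cs g \<Longrightarrow> substs \<Gamma> \<sigma> \<Delta> f \<Longrightarrow> wf_ctx \<Gamma> \<Longrightarrow> \<forall>t \<in> set ts. no_capture \<sigma> t \<Longrightarrow>
      sems \<Gamma> (map (subst \<sigma>) ts) Cs (g \<bullet> f)"
proof (induction arbitrary: \<sigma> \<Gamma> f and \<sigma> \<Gamma> f rule: sem_sems.inducts)
  case (Var x A)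
  then have "sem \<Gamma> (\<sigma> x) A f" by (simp add: sems_single)
  then show ?case by simp
next
  case (Op t ts As A \<phi> \<Delta> g \<Theta>)
  obtain \<Gamma>' f' where D: "substs \<Gamma>' \<sigma> \<Delta> f'" "mset \<Gamma> = mset \<Gamma>'" "perm \<Theta> \<Delta> \<bullet> f = f' \<bullet> perm \<Gamma> \<Gamma>'"
    using substs_perm[OF Op(6,5,4,7)] by blast
  have nc: "\<forall>t \<in> set ts. no_capture \<sigma> t" and o: "ops (subst \<sigma> t) (map (subst \<sigma>) ts) As A \<phi>"
    using ops_subst[OF Op(1)] Op(8) by auto
  have wf': "wf_ctx \<Gamma>'" using D(2) Op(7) wf_ctx_mset by blast
  have "sems \<Gamma>' (map (subst \<sigma>) ts) As (g \<bullet> f')"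
    using Op(3)[OF D(1) wf' nc] .
  from sem_sems.Op[OF o this Op(7) D(2)] show ?case
    using D by simp
next
  case (Let t s u A \<Pi> p \<Delta>1 g1 \<Delta>2 C g2 \<Theta>)
  obtain \<Gamma>' f' where D: "substs \<Gamma>' \<sigma> (\<Delta>1 @ \<Delta>2) f'" "mset \<Gamma> = mset \<Gamma>'"
    "perm \<Theta> (\<Delta>1 @ \<Delta>2) \<bullet> f = f' \<bullet> perm \<Gamma> \<Gamma>'"
    using substs_perm[OF Let(8,7,6,9)] by blast
  then obtain \<Gamma>1 \<Gamma>2 f1 f2 where E: "\<Gamma>' = \<Gamma>1 @ \<Gamma>2" "f' = f1 \<parallel> f2" "substs \<Gamma>1 \<sigma> \<Delta>1 f1" "substs \<Gamma>2 \<sigma> \<Delta>2 f2"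
    unfolding substs_append_iff by blast
  have wf: "wf_ctx (\<Gamma>1 @ \<Gamma>2)" "wf_ctx (\<Pi> @ \<Delta>2)"
    using D(2) Let(9) E(1) wf_ctx_mset sem_wf[OF Let(4)] by blast+
  let ?X = "fst ` set \<Pi>"
  let ?\<sigma> = "shadow ?X \<sigma>"
  note b = binds_subst[OF Let(1), of \<sigma>]
  have nc: "no_capture \<sigma> s" "no_capture ?\<sigma> u" "\<forall>z \<in> fv u - ?X. fv (\<sigma> z) \<inter> ?X = {}"
    using b Let(10) by simp_all
  \<comment> \<open>By linearity the free variables of \<open>u\<close> outside the pattern are
    those of \<open>\<Delta>2\<close>. Hence \<open>no_capture\<close> says that no bound variable
    occurs in the terms put in for them, and this is why \<open>\<Pi> @ \<Gamma>2\<close> is well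
    formed.\<close>
  have "fv u - ?X = fst ` set \<Delta>2" using sem_fv[OF Let(4)] wf(2) by (auto simp: wf_ctx_append)
  with nc(3) have "\<forall>z \<in> fst ` set \<Delta>2. fv (\<sigma> z) \<inter> ?X = {}" by simp
  then have "?X \<inter> fst ` set \<Gamma>2 = {}" unfolding substs_fv[OF E(4)] by blast
  then have wf': "wf_ctx (\<Pi> @ \<Gamma>2)" using wf by (auto simp: wf_ctx_append)
  have s: "sem \<Gamma>1 (subst \<sigma> s) A (g1 \<bullet> f1)"
    using Let(3)[OF E(3) _ nc(1)] wf by (auto simp: wf_ctx_append)
  \<comment> \<open>Under the binder the shadowed substitution is the identity on
    \<open>\<Pi>\<close> and still \<open>\<sigma>\<close> on \<open>\<Delta>2\<close>.\<close>
  have "substs \<Pi> ?\<sigma> \<Pi> (idn (tys \<Pi>))"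
    by (rule substs_cong[OF sems_vars]) (auto simp: shadow_def)
  moreover have "substs \<Gamma>2 ?\<sigma> \<Delta>2 f2"
    by (rule substs_cong[OF E(4)]) (use wf in \<open>auto simp: shadow_def wf_ctx_append\<close>)
  ultimately have "substs (\<Pi> @ \<Gamma>2) ?\<sigma> (\<Pi> @ \<Delta>2) (idn (tys \<Pi>) \<parallel> f2)"
    unfolding substs_append_iff by blast
  then have u: "sem (\<Pi> @ \<Gamma>2) (subst ?\<sigma> u) C (g2 \<bullet> (idn (tys \<Pi>) \<parallel> f2))"
    using Let(5) wf' nc by blast
  have "sem \<Gamma> (subst \<sigma> t) C ((g2 \<bullet> (idn (tys \<Pi>) \<parallel> f2)) \<bullet> ((p \<bullet> g1 \<bullet> f1) \<parallel> idn (tys \<Gamma>2)) \<bullet> perm \<Gamma> (\<Gamma>1 @ \<Gamma>2))"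
    using sem_sems.Let[OF _ s u Let(9)] b D(2) E(1) by blast
  also have "(g2 \<bullet> (idn (tys \<Pi>) \<parallel> f2)) \<bullet> ((p \<bullet> g1 \<bullet> f1) \<parallel> idn (tys \<Gamma>2)) \<bullet> perm \<Gamma> (\<Gamma>1 @ \<Gamma>2)
    = g2 \<bullet> ((p \<bullet> g1) \<parallel> idn (tys \<Delta>2)) \<bullet> f' \<bullet> perm \<Gamma> \<Gamma>'"
    using Let(1,2,4) E by (simp add: interchange')
  also have "\<dots> = (g2 \<bullet> ((p \<bullet> g1) \<parallel> idn (tys \<Delta>2)) \<bullet> perm \<Theta> (\<Delta>1 @ \<Delta>2)) \<bullet> f"
    using D(3) by (simp add: cmp_assoc)
  finally show ?case .
next
  case Nil
  then have "\<Gamma> = []" "f = idn []" by (auto elim: sems.cases)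
  then show ?case by (simp add: sem_sems.Nil)
next
  case (Cons \<Delta>1 t A g1 \<Delta>2 ts As g2)
  then obtain \<Gamma>1 \<Gamma>2 f1 f2 where E: "\<Gamma> = \<Gamma>1 @ \<Gamma>2" "f = f1 \<parallel> f2" "substs \<Gamma>1 \<sigma> \<Delta>1 f1" "substs \<Gamma>2 \<sigma> \<Delta>2 f2"
    unfolding substs_append_iff by blast
  then have "sem \<Gamma>1 (subst \<sigma> t) A (g1 \<bullet> f1)" "sems \<Gamma>2 (map (subst \<sigma>) ts) As (g2 \<bullet> f2)"
    using Cons by (auto simp: wf_ctx_append)
  from sem_sems.Cons[OF this] show ?case using E Cons(1,3) by (simp add: interchange)
qed

section \<open>Commuting conversions\<close>

lemma sem_LetPE:
  assumes "sem \<Theta> (LetP P s u) C k"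
  obtains A \<Pi> p \<Gamma> \<Delta> f g where "\<And>s u. binds (LetP P s u) s u A \<Pi> p" "pvars P = fst ` set \<Pi>"
    "sem \<Gamma> s A f" "sem (\<Pi> @ \<Delta>) u C g" "mset \<Theta> = mset (\<Gamma> @ \<Delta>)" "wf_ctx (\<Gamma> @ \<Delta>)"
proof -
  have "\<exists>A \<Pi> p. binds (LetP P s u) s u A \<Pi> p" by (cases P) (auto intro: binds.intros)
  then show ?thesis using that sem_LetE[OF assms] binds_LetP by metis
qed

lemma perm_sym_append:
  assumes "distinct (\<Gamma> @ \<Delta> @ \<Theta>)"
  shows "perm (\<Gamma> @ \<Delta> @ \<Theta>) (\<Delta> @ \<Gamma> @ \<Theta>) = sym (tys \<Gamma>) (tys \<Delta>) \<parallel> idn (tys \<Theta>)"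
proof -
  have "perm ((\<Gamma> @ \<Delta>) @ \<Theta>) ((\<Delta> @ \<Gamma>) @ \<Theta>) = perm (\<Gamma> @ \<Delta>) (\<Delta> @ \<Gamma>) \<parallel> perm \<Theta> \<Theta>"
    using assms by (intro perm_append) auto
  also have "perm (\<Gamma> @ \<Delta>) (\<Delta> @ \<Gamma>) = sym (tys \<Gamma>) (tys \<Delta>)"
    using assms by (intro perm_sym) auto
  finally show ?thesis by simp
qed

lemma sem_swap:
  assumes "sem (\<Delta> @ \<Gamma> @ \<Theta>) t A f"
  shows "sem (\<Gamma> @ \<Delta> @ \<Theta>) t A (f \<bullet> (sym (tys \<Gamma>) (tys \<Delta>) \<parallel> idn (tys \<Theta>)))"
proof -
  have "distinct (\<Gamma> @ \<Delta> @ \<Theta>)" using wf_ctx_distinct[OF sem_wf[OF assms]] by auto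
  from perm_sym_append[OF this] sem_perm[OF assms, of "\<Gamma> @ \<Delta> @ \<Theta>"] show ?thesis by simp
qed

text \<open>A let puts its variables first in the body's context, while the subterm using them may
  stand behind others with context \<open>c\<close>. By naturality the crossing before
  \<open>q\<close> and the one after it cancel, so \<open>q\<close> acts in place.\<close>

lemma sym_conj:
  assumes "arr q" "src q = a" "tgt q = b"
  shows "(sym b c \<parallel> idn d) \<bullet> (q \<parallel> idn (c @ d)) \<bullet> (sym c a \<parallel> idn d) = idn c \<parallel> q \<parallel> idn d"
proof -
  have "(sym b c \<parallel> idn d) \<bullet> ((q \<parallel> idn c) \<parallel> idn d) = (sym b c \<bullet> (q \<parallel> idn c)) \<parallel> idn d"
    using assms by (subst interchange) simp_all
  also have "sym b c \<bullet> (q \<parallel> idn c) = (idn c \<parallel> q) \<bullet> sym a c"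
    using sym_natural[of q "idn c"] assms by simp
  finally have "((sym b c \<parallel> idn d) \<bullet> ((q \<parallel> idn c) \<parallel> idn d)) \<bullet> (sym c a \<parallel> idn d)
      = (((idn c \<parallel> q) \<bullet> sym a c) \<parallel> idn d) \<bullet> (sym c a \<parallel> idn d)"
    by simp
  also have "\<dots> = ((idn c \<parallel> q) \<bullet> sym a c \<bullet> sym c a) \<parallel> idn d"
    using assms by (subst interchange) simp_all
  finally show ?thesis using assms by (simp add: sym_inverse idn_ten)
qed

text \<open>The form in which freshness conditions are used: pattern variables absent from
  \<open>\<Theta>\<close> must all be declared in \<open>\<Gamma>\<close>, so the let can be pushed
  into the part with context \<open>\<Gamma>\<close>.\<close>

lemma disjoint_ctx_split:
  assumes "wf_ctx (\<Pi> @ \<Delta>)" "mset (\<Pi> @ \<Delta>) = mset (\<Gamma> @ \<Theta>)" "fst ` set \<Pi> \<inter> fst ` set \<Theta> = {}"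
  obtains \<Gamma>' where "mset \<Gamma> = mset (\<Pi> @ \<Gamma>')" "mset \<Delta> = mset (\<Gamma>' @ \<Theta>)"
proof -
  have "set \<Pi> \<subseteq> set \<Gamma>" using assms(3) mset_eq_setD[OF assms(2)] by auto
  then obtain \<Gamma>' where "mset \<Gamma> = mset (\<Pi> @ \<Gamma>')"
    using ctx_split wf_ctx_distinct assms(1) by (metis wf_ctx_append)
  then show ?thesis using that assms(2) by simp
qed

text \<open>Treats gates and tuples at once. \<open>o\<close> fixes the shape of \<open>t\<close>,
  and \<open>o'\<close> says that wrapping the argument \<open>u\<close> in the let keeps the
  operation at whatever types it has. Over
  \<open>\<Gamma>1 @ \<Gamma> @ \<Delta>u @ \<Gamma>2\<close> both sides have the arrow
  \<open>?k\<close>.\<close>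

lemma comm_op:
  assumes "sem \<Theta> (LetP P s t) A k" "sem \<Theta> t' A k'"
    and o: "ops t (ts1 @ u # ts2) As' A' \<phi>'"
    and o': "\<And>As A \<phi>. ops t (ts1 @ u # ts2) As A \<phi> \<Longrightarrow> ops t' (ts1 @ LetP P s u # ts2) As A \<phi>"
    and disj: "\<And>v. v \<in> set ts1 \<union> set ts2 \<Longrightarrow> pvars P \<inter> fv v = {}"
  shows "k = k'"
proof -
  obtain B \<Pi> p \<Gamma> \<Delta> f g where 1: "\<And>s u. binds (LetP P s u) s u B \<Pi> p" "pvars P = fst ` set \<Pi>"
    "sem \<Gamma> s B f" "sem (\<Pi> @ \<Delta>) t A g" "mset \<Theta> = mset (\<Gamma> @ \<Delta>)" "wf_ctx (\<Gamma> @ \<Delta>)"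
    using sem_LetPE[OF assms(1)] by metis
  obtain As \<phi> \<Gamma>0 h where 2: "ops t (ts1 @ u # ts2) As A \<phi>" "sems \<Gamma>0 (ts1 @ u # ts2) As h"
    "mset (\<Pi> @ \<Delta>) = mset \<Gamma>0" "wf_ctx \<Gamma>0"
    using sem_OpE[OF 1(4) o] by metis
  obtain As1 C As2 where As: "As = As1 @ [C] @ As2" "length ts1 = length As1"
  proof
    let ?n = "length ts1"
    have "length As = ?n + Suc (length ts2)" using sems_length[OF 2(2)] by simp
    then show "As = take ?n As @ [As ! ?n] @ drop (Suc ?n) As" "?n = length (take ?n As)"
      by (simp_all add: id_take_nth_drop[symmetric])
  qed
  have "sems \<Gamma>0 (ts1 @ [u] @ ts2) (As1 @ [C] @ As2) h" using 2(2) As by simp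
  then obtain \<Gamma>1 \<Gamma>u \<Gamma>2 h1 hu h2 where 3: "\<Gamma>0 = \<Gamma>1 @ \<Gamma>u @ \<Gamma>2" "sems \<Gamma>1 ts1 As1 h1" "sem \<Gamma>u u C hu"
    "sems \<Gamma>2 ts2 As2 h2"
    using As(2) by (auto simp: sems_append_iff[of ts1 As1] sems_append_iff[of "[u]" "[C]", simplified] sems_single)
  have "fst ` set \<Pi> \<inter> fst ` set (\<Gamma>1 @ \<Gamma>2) = {}"
  proof -
    have "fst ` set \<Pi> \<inter> (\<Union> (fv ` set ts1) \<union> \<Union> (fv ` set ts2)) = {}"
      using disj unfolding 1(2) by blast
    then show ?thesis by (simp add: sems_fv[OF 3(2)] sems_fv[OF 3(4)] image_Un)
  qed
  moreover have "mset (\<Pi> @ \<Delta>) = mset (\<Gamma>u @ \<Gamma>1 @ \<Gamma>2)" using 2(3) 3(1) by simp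
  ultimately obtain \<Delta>u where 4: "mset \<Gamma>u = mset (\<Pi> @ \<Delta>u)" "mset \<Delta> = mset (\<Delta>u @ \<Gamma>1 @ \<Gamma>2)"
    using disjoint_ctx_split[OF sem_wf[OF 1(4)]] by metis
  \<comment> \<open>The meaning of \<open>u\<close> with the pattern variables at the front, where a
    let around \<open>u\<close> expects them.\<close>
  define r where "r = hu \<bullet> perm (\<Pi> @ \<Delta>u) \<Gamma>u"
  have u: "sem (\<Pi> @ \<Delta>u) u C r" unfolding r_def using sem_perm[OF 3(3)] 4(1) by simp
  have wf: "wf_ctx (\<Gamma>1 @ \<Gamma> @ \<Delta>u @ \<Gamma>2)" using 1(6) 4(2) wf_ctx_mset[of "\<Gamma> @ \<Delta>"] by simp
  then have wf': "wf_ctx (\<Gamma> @ \<Delta>u)" "wf_ctx (\<Gamma> @ \<Gamma>1 @ \<Delta>u @ \<Gamma>2)" by (auto simp: wf_ctx_append)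
  have "mset \<Gamma>0 = mset (\<Gamma>1 @ \<Pi> @ \<Delta>u @ \<Gamma>2)" using 3(1) 4(1) by simp
  then have wf'': "wf_ctx (\<Gamma>1 @ \<Pi> @ \<Delta>u @ \<Gamma>2)" using 2(4) wf_ctx_mset by blast
  let ?k = "\<phi> \<bullet> (h1 \<parallel> (r \<bullet> ((p \<bullet> f) \<parallel> idn (tys \<Delta>u))) \<parallel> h2)"
  have "sem (\<Gamma> @ \<Delta>u) (LetP P s u) C (r \<bullet> ((p \<bullet> f) \<parallel> idn (tys \<Delta>u)))"
    using 1(1,3) u wf'(1) by (rule sem_Let)
  from sems_append[OF 3(2) sem_sems.Cons[OF this 3(4)]]
  have "sems (\<Gamma>1 @ \<Gamma> @ \<Delta>u @ \<Gamma>2) (ts1 @ LetP P s u # ts2) As (h1 \<parallel> (r \<bullet> ((p \<bullet> f) \<parallel> idn (tys \<Delta>u))) \<parallel> h2)"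
    by (simp add: As)
  then have R: "sem (\<Gamma>1 @ \<Gamma> @ \<Delta>u @ \<Gamma>2) t' A ?k"
    using sem_Op[OF o'[OF 2(1)]] wf by blast
  from sems_append[OF 3(2) sem_sems.Cons[OF u 3(4)]]
  have "sems (\<Gamma>1 @ \<Pi> @ \<Delta>u @ \<Gamma>2) (ts1 @ u # ts2) As (h1 \<parallel> r \<parallel> h2)"
    by (simp add: As)
  then have "sem (\<Gamma>1 @ \<Pi> @ \<Delta>u @ \<Gamma>2) t A (\<phi> \<bullet> (h1 \<parallel> r \<parallel> h2))"
    using sem_Op[OF 2(1)] wf'' by blast
  \<comment> \<open>For the outer let the pattern variables have to precede \<open>\<Gamma>1\<close>
    as well; this detour and the later swap of \<open>\<Gamma>\<close> collapse by
    \<open>sym_conj\<close>.\<close>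
  from sem_swap[OF this]
  have "sem (\<Pi> @ \<Gamma>1 @ \<Delta>u @ \<Gamma>2) t A (\<phi> \<bullet> (h1 \<parallel> r \<parallel> h2) \<bullet> (sym (tys \<Pi>) (tys \<Gamma>1) \<parallel> idn (tys (\<Delta>u @ \<Gamma>2))))"
    by simp
  from sem_swap[OF sem_Let[OF 1(1) 1(3) this wf'(2)]]
  have "sem (\<Gamma>1 @ \<Gamma> @ \<Delta>u @ \<Gamma>2) (LetP P s t) A (\<phi> \<bullet> (h1 \<parallel> r \<parallel> h2) \<bullet>
      (sym (tys \<Pi>) (tys \<Gamma>1) \<parallel> idn (tys (\<Delta>u @ \<Gamma>2))) \<bullet> ((p \<bullet> f) \<parallel> idn (tys \<Gamma>1 @ tys (\<Delta>u @ \<Gamma>2))) \<bullet>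
      (sym (tys \<Gamma>1) (tys \<Gamma>) \<parallel> idn (tys (\<Delta>u @ \<Gamma>2))))"
    by simp
  also have "(sym (tys \<Pi>) (tys \<Gamma>1) \<parallel> idn (tys (\<Delta>u @ \<Gamma>2))) \<bullet> ((p \<bullet> f) \<parallel> idn (tys \<Gamma>1 @ tys (\<Delta>u @ \<Gamma>2))) \<bullet>
      (sym (tys \<Gamma>1) (tys \<Gamma>) \<parallel> idn (tys (\<Delta>u @ \<Gamma>2)))
    = idn (tys \<Gamma>1) \<parallel> ((p \<bullet> f) \<parallel> idn (tys \<Delta>u)) \<parallel> idn (tys \<Gamma>2)"
    using 1(1)[of s u] 1(3) by (subst sym_conj) (simp_all add: idn_ten)
  also have "(h1 \<parallel> r \<parallel> h2) \<bullet> \<dots> = h1 \<parallel> (r \<bullet> ((p \<bullet> f) \<parallel> idn (tys \<Delta>u))) \<parallel> h2"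
  proof -
    have "arr h1" "src h1 = tys \<Gamma>1" "arr h2" "src h2 = tys \<Gamma>2" "arr r" "src r = tys \<Pi> @ tys \<Delta>u"
      "arr p" "arr f" "src p = [B]" "tgt p = tys \<Pi>" "tgt f = [B]"
      using 1(1)[of s u] 1(3) 3 u by simp_all
    then show ?thesis
      by (simp only: interchange arr_ten arr_cmp src_ten tgt_ten src_cmp tgt_cmp arr_idn src_idn tgt_idn cmp_idn simp_thms)
  qed
  finally have L: "sem (\<Gamma>1 @ \<Gamma> @ \<Delta>u @ \<Gamma>2) (LetP P s t) A ?k" .
  have "mset \<Theta> = mset (\<Gamma>1 @ \<Gamma> @ \<Delta>u @ \<Gamma>2)" using 1(5) 4(2) by simp
  from sem_eqI[OF assms(1,2) this L R] show ?thesis .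
qed

text \<open>Freshness forces the variables of \<open>P\<close> into \<open>t\<close>. Over
  \<open>\<Gamma> @ \<Delta>t @ \<Delta>u\<close> both sides feed \<open>s\<close> into
  \<open>t\<close> and the result into \<open>u\<close>, so only associativity and interchange
  separate them.\<close>

lemma comm_nest:
  assumes "sem \<Theta> (LetP P s (LetP R t u)) A k" "sem \<Theta> (LetP R (LetP P s t) u) A k'"
    and "pvars P \<inter> (fv u - pvars R) = {}"
  shows "k = k'"
proof -
  obtain B \<Pi> p \<Gamma> \<Delta> f g where 1: "\<And>s u. binds (LetP P s u) s u B \<Pi> p" "pvars P = fst ` set \<Pi>"
    "sem \<Gamma> s B f" "sem (\<Pi> @ \<Delta>) (LetP R t u) A g" "mset \<Theta> = mset (\<Gamma> @ \<Delta>)" "wf_ctx (\<Gamma> @ \<Delta>)"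
    using sem_LetPE[OF assms(1)] by metis
  obtain C \<Pi>' q \<Gamma>t \<Delta>u ft h where 2: "\<And>s u. binds (LetP R s u) s u C \<Pi>' q" "pvars R = fst ` set \<Pi>'"
    "sem \<Gamma>t t C ft" "sem (\<Pi>' @ \<Delta>u) u A h" "mset (\<Pi> @ \<Delta>) = mset (\<Gamma>t @ \<Delta>u)" "wf_ctx (\<Gamma>t @ \<Delta>u)"
    using sem_LetPE[OF 1(4)] by metis
  have "fst ` set \<Pi> \<inter> fst ` set \<Delta>u = {}"
  proof -
    have "fv u = fst ` set \<Pi>' \<union> fst ` set \<Delta>u" using sem_fv[OF 2(4)] by (simp add: image_Un)
    moreover have "fst ` set \<Pi>' \<inter> fst ` set \<Delta>u = {}" using sem_wf[OF 2(4)] by (simp add: wf_ctx_append)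
    ultimately show ?thesis using assms(3) unfolding 1(2) 2(2) by blast
  qed
  then obtain \<Delta>t where 3: "mset \<Gamma>t = mset (\<Pi> @ \<Delta>t)" "mset \<Delta> = mset (\<Delta>t @ \<Delta>u)"
    using disjoint_ctx_split[OF sem_wf[OF 1(4)] 2(5)] by metis
  define r where "r = ft \<bullet> perm (\<Pi> @ \<Delta>t) \<Gamma>t"
  have t: "sem (\<Pi> @ \<Delta>t) t C r" unfolding r_def using sem_perm[OF 2(3)] 3(1) by simp
  have wf: "wf_ctx (\<Gamma> @ \<Delta>t @ \<Delta>u)" using 1(6) 3(2) wf_ctx_mset[of "\<Gamma> @ \<Delta>"] by simp
  then have wf': "wf_ctx (\<Gamma> @ \<Delta>t)" by (auto simp: wf_ctx_append)
  have wf'': "wf_ctx ((\<Pi> @ \<Delta>t) @ \<Delta>u)" using 2(6) 3(1) wf_ctx_mset[of "\<Gamma>t @ \<Delta>u"] by simp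
  have "sem (\<Pi> @ \<Delta>t @ \<Delta>u) (LetP R t u) A (h \<bullet> ((q \<bullet> r) \<parallel> idn (tys \<Delta>u)))"
    using sem_Let[OF 2(1) t 2(4) wf''] by simp
  from sem_Let[OF 1(1) 1(3) this wf]
  have L: "sem (\<Gamma> @ \<Delta>t @ \<Delta>u) (LetP P s (LetP R t u)) A
      ((h \<bullet> ((q \<bullet> r) \<parallel> idn (tys \<Delta>u))) \<bullet> ((p \<bullet> f) \<parallel> idn (tys (\<Delta>t @ \<Delta>u))))"
    by simp
  from sem_Let[OF 2(1) sem_Let[OF 1(1) 1(3) t wf'] 2(4)] wf
  have "sem (\<Gamma> @ \<Delta>t @ \<Delta>u) (LetP R (LetP P s t) u) A
      (h \<bullet> ((q \<bullet> r \<bullet> ((p \<bullet> f) \<parallel> idn (tys \<Delta>t))) \<parallel> idn (tys \<Delta>u)))"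
    by simp
  also have "(q \<bullet> r \<bullet> ((p \<bullet> f) \<parallel> idn (tys \<Delta>t))) \<parallel> idn (tys \<Delta>u)
      = ((q \<bullet> r) \<parallel> idn (tys \<Delta>u)) \<bullet> (((p \<bullet> f) \<parallel> idn (tys \<Delta>t)) \<parallel> idn (tys \<Delta>u))"
    using 1(1)[of s u] 1(3) 2(1)[of s u] t by (subst interchange) simp_all
  also have "((p \<bullet> f) \<parallel> idn (tys \<Delta>t)) \<parallel> idn (tys \<Delta>u) = (p \<bullet> f) \<parallel> idn (tys (\<Delta>t @ \<Delta>u))"
    by (simp add: idn_ten)
  finally have R: "sem (\<Gamma> @ \<Delta>t @ \<Delta>u) (LetP R (LetP P s t) u) A
      ((h \<bullet> ((q \<bullet> r) \<parallel> idn (tys \<Delta>u))) \<bullet> ((p \<bullet> f) \<parallel> idn (tys (\<Delta>t @ \<Delta>u))))"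
    by simp
  have "mset \<Theta> = mset (\<Gamma> @ \<Delta>t @ \<Delta>u)" using 1(5) 3(2) by simp
  from sem_eqI[OF assms(1,2) this L R] show ?thesis .
qed

text \<open>A normal form for two independent lets: both bound terms act in parallel, and a symmetry
  then puts the pattern variables into the order that \<open>u\<close> expects.
  \<open>comm_swap\<close> applies it to both nestings.\<close>

lemma sem_Let_Let:
  assumes b: "\<And>s u. binds (LetP P s u) s u B \<Pi> p" "\<And>s u. binds (LetP R s u) s u C \<Pi>' q"
    and s: "sem \<Gamma> s B f" and t: "sem \<Delta> t C h" and u: "sem (\<Pi>' @ \<Pi> @ \<Theta>) u A g"
    and wf: "wf_ctx (\<Gamma> @ \<Delta> @ \<Theta>)" "wf_ctx (\<Pi> @ \<Delta> @ \<Theta>)"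
  shows "sem (\<Gamma> @ \<Delta> @ \<Theta>) (LetP P s (LetP R t u)) A
    (g \<bullet> (sym (tys \<Pi>) (tys \<Pi>') \<parallel> idn (tys \<Theta>)) \<bullet> ((p \<bullet> f) \<parallel> (q \<bullet> h) \<parallel> idn (tys \<Theta>)))"
proof -
  have "wf_ctx (\<Delta> @ \<Pi> @ \<Theta>)" using wf(2) by (auto simp: wf_ctx_append)
  from sem_Let[OF b(1) s sem_swap[OF sem_Let[OF b(2) t u this]] wf(1)]
  have "sem (\<Gamma> @ \<Delta> @ \<Theta>) (LetP P s (LetP R t u)) A
    (g \<bullet> ((q \<bullet> h) \<parallel> idn (tys \<Pi> @ tys \<Theta>)) \<bullet> (sym (tys \<Pi>) (tys \<Delta>) \<parallel> idn (tys \<Theta>)) \<bullet>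
      ((p \<bullet> f) \<parallel> idn (tys \<Delta> @ tys \<Theta>)))"
    by simp
  also have "((q \<bullet> h) \<parallel> idn (tys \<Pi> @ tys \<Theta>)) \<bullet> (sym (tys \<Pi>) (tys \<Delta>) \<parallel> idn (tys \<Theta>)) \<bullet>
      ((p \<bullet> f) \<parallel> idn (tys \<Delta> @ tys \<Theta>))
    = (((q \<bullet> h) \<parallel> idn (tys \<Pi>)) \<bullet> sym (tys \<Pi>) (tys \<Delta>) \<bullet> ((p \<bullet> f) \<parallel> idn (tys \<Delta>))) \<parallel> idn (tys \<Theta>)"
  proof -
    have "(x \<parallel> idn (a @ tys \<Theta>)) = (x \<parallel> idn a) \<parallel> idn (tys \<Theta>)" for x a by (simp add: idn_ten)
    then show ?thesis
      using b[of s u] b[of t u] s t by (simp add: interchange del: ten_assoc)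
  qed
  also have "sym (tys \<Pi>) (tys \<Delta>) \<bullet> ((p \<bullet> f) \<parallel> idn (tys \<Delta>)) = (idn (tys \<Delta>) \<parallel> (p \<bullet> f)) \<bullet> sym (tys \<Gamma>) (tys \<Delta>)"
    using sym_natural[of "p \<bullet> f" "idn (tys \<Delta>)"] b(1)[of s u] s by simp
  also have "((q \<bullet> h) \<parallel> idn (tys \<Pi>)) \<bullet> (idn (tys \<Delta>) \<parallel> (p \<bullet> f)) \<bullet> sym (tys \<Gamma>) (tys \<Delta>)
    = sym (tys \<Pi>) (tys \<Pi>') \<bullet> ((p \<bullet> f) \<parallel> (q \<bullet> h))"
    using sym_natural[of "p \<bullet> f" "q \<bullet> h"] b(1)[of s u] b(2)[of t u] s t by (simp add: interchange')
  also have "\<dots> \<parallel> idn (tys \<Theta>)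
    = (sym (tys \<Pi>) (tys \<Pi>') \<parallel> idn (tys \<Theta>)) \<bullet> (((p \<bullet> f) \<parallel> (q \<bullet> h)) \<parallel> idn (tys \<Theta>))"
    using b(1)[of s u] b(2)[of t u] s t by (subst interchange) simp_all
  finally show ?thesis by simp
qed

text \<open>The normal forms of the two nestings differ by symmetries before and after the parallel
  arrows; naturality followed by \<open>sym_inverse\<close> reconciles them.\<close>

lemma comm_swap:
  assumes "sem \<Theta> (LetP P s (LetP R t u)) A k" "sem \<Theta> (LetP R t (LetP P s u)) A k'"
    and disj: "pvars P \<inter> fv t = {}" "pvars R \<inter> fv s = {}" "pvars P \<inter> pvars R = {}"
  shows "k = k'"
proof -
  obtain B \<Pi> p \<Gamma> \<Delta> f g where 1: "\<And>s u. binds (LetP P s u) s u B \<Pi> p" "pvars P = fst ` set \<Pi>"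
    "sem \<Gamma> s B f" "sem (\<Pi> @ \<Delta>) (LetP R t u) A g" "mset \<Theta> = mset (\<Gamma> @ \<Delta>)" "wf_ctx (\<Gamma> @ \<Delta>)"
    using sem_LetPE[OF assms(1)] by metis
  obtain C \<Pi>' q \<Gamma>t \<Delta>u ft h where 2: "\<And>s u. binds (LetP R s u) s u C \<Pi>' q" "pvars R = fst ` set \<Pi>'"
    "sem \<Gamma>t t C ft" "sem (\<Pi>' @ \<Delta>u) u A h" "mset (\<Pi> @ \<Delta>) = mset (\<Gamma>t @ \<Delta>u)" "wf_ctx (\<Gamma>t @ \<Delta>u)"
    using sem_LetPE[OF 1(4)] by metis
  \<comment> \<open>Here the variables of \<open>P\<close> are used by \<open>u\<close> and not by
    \<open>t\<close>, so the two parts trade roles before the split.\<close>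
  have "mset (\<Pi> @ \<Delta>) = mset (\<Delta>u @ \<Gamma>t)" "fst ` set \<Pi> \<inter> fst ` set \<Gamma>t = {}"
    using 2(5) disj(1) 1(2) sem_fv[OF 2(3)] by simp_all
  then obtain \<Delta>' where 3: "mset \<Delta>u = mset (\<Pi> @ \<Delta>')" "mset \<Delta> = mset (\<Delta>' @ \<Gamma>t)"
    using disjoint_ctx_split[OF sem_wf[OF 1(4)]] by metis
  define r where "r = h \<bullet> perm (\<Pi>' @ \<Pi> @ \<Delta>') (\<Pi>' @ \<Delta>u)"
  have u: "sem (\<Pi>' @ \<Pi> @ \<Delta>') u A r" unfolding r_def using sem_perm[OF 2(4)] 3(1) by simp
  have wf: "wf_ctx (\<Gamma> @ \<Gamma>t @ \<Delta>')" using 1(6) 3(2) wf_ctx_mset[of "\<Gamma> @ \<Delta>"] by simp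
  have wf1: "wf_ctx (\<Pi> @ \<Gamma>t @ \<Delta>')" using 2(6) 3(1) wf_ctx_mset[of "\<Gamma>t @ \<Delta>u"] by simp
  have wf2: "wf_ctx (\<Gamma>t @ \<Gamma> @ \<Delta>')" using wf by (auto simp: wf_ctx_append)
  \<comment> \<open>With \<open>R\<close> outermost its variables share a context with those of
    \<open>s\<close>, which freshness of \<open>R\<close> for \<open>s\<close> permits.\<close>
  have "fst ` set \<Pi>' \<inter> fst ` set \<Gamma> = {}" using disj(2) 2(2) sem_fv[OF 1(3)] by simp
  then have wf3: "wf_ctx (\<Pi>' @ \<Gamma> @ \<Delta>')" using wf sem_wf[OF u] by (auto simp: wf_ctx_append)
  let ?k = "r \<bullet> (sym (tys \<Pi>) (tys \<Pi>') \<parallel> idn (tys \<Delta>')) \<bullet> ((p \<bullet> f) \<parallel> (q \<bullet> ft) \<parallel> idn (tys \<Delta>'))"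
  have L: "sem (\<Gamma> @ \<Gamma>t @ \<Delta>') (LetP P s (LetP R t u)) A ?k"
    using 1(1) 2(1) 1(3) 2(3) u wf wf1 by (rule sem_Let_Let)
  from sem_swap[OF sem_Let_Let[OF 2(1) 1(1) 2(3) 1(3) sem_swap[OF u] wf2 wf3]]
  have "sem (\<Gamma> @ \<Gamma>t @ \<Delta>') (LetP R t (LetP P s u)) A
    (r \<bullet> (sym (tys \<Pi>) (tys \<Pi>') \<parallel> idn (tys \<Delta>')) \<bullet> (sym (tys \<Pi>') (tys \<Pi>) \<parallel> idn (tys \<Delta>')) \<bullet>
      (((q \<bullet> ft) \<parallel> (p \<bullet> f)) \<parallel> idn (tys \<Delta>')) \<bullet> (sym (tys \<Gamma>) (tys \<Gamma>t) \<parallel> idn (tys \<Delta>')))"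
    by simp
  also have "(((q \<bullet> ft) \<parallel> (p \<bullet> f)) \<parallel> idn (tys \<Delta>')) \<bullet> (sym (tys \<Gamma>) (tys \<Gamma>t) \<parallel> idn (tys \<Delta>'))
    = (((q \<bullet> ft) \<parallel> (p \<bullet> f)) \<bullet> sym (tys \<Gamma>) (tys \<Gamma>t)) \<parallel> idn (tys \<Delta>')"
    using 1(1)[of s u] 2(1)[of t u] 1(3) 2(3) by (subst interchange) simp_all
  also have "((q \<bullet> ft) \<parallel> (p \<bullet> f)) \<bullet> sym (tys \<Gamma>) (tys \<Gamma>t) = sym (tys \<Pi>) (tys \<Pi>') \<bullet> ((p \<bullet> f) \<parallel> (q \<bullet> ft))"
    using sym_natural[of "p \<bullet> f" "q \<bullet> ft"] 1(1)[of s u] 2(1)[of t u] 1(3) 2(3) by simp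
  also have "\<dots> \<parallel> idn (tys \<Delta>') =
      (sym (tys \<Pi>) (tys \<Pi>') \<parallel> idn (tys \<Delta>')) \<bullet> (((p \<bullet> f) \<parallel> (q \<bullet> ft)) \<parallel> idn (tys \<Delta>'))"
    using 1(1)[of s u] 2(1)[of t u] 1(3) 2(3) by (subst interchange) simp_all
  also have "(sym (tys \<Pi>') (tys \<Pi>) \<parallel> idn (tys \<Delta>')) \<bullet> \<dots> = ((p \<bullet> f) \<parallel> (q \<bullet> ft)) \<parallel> idn (tys \<Delta>')"
    using 1(1)[of s u] 2(1)[of t u] 1(3) 2(3) by (subst interchange') (simp_all add: sym_inverse idn_ten)
  finally have R: "sem (\<Gamma> @ \<Gamma>t @ \<Delta>') (LetP R t (LetP P s u)) A ?k" by simp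
  have "mset \<Theta> = mset (\<Gamma> @ \<Gamma>t @ \<Delta>')" using 1(5) 3(2) by simp
  from sem_eqI[OF assms(1,2) this L R] show ?thesis .
qed

section \<open>Individual term formers and the basic equations\<close>

lemma sem_Unit_let:
  "sem \<Gamma> s TUnit f \<Longrightarrow> sem \<Delta> u C g \<Longrightarrow> wf_ctx (\<Gamma> @ \<Delta>) \<Longrightarrow>
   sem (\<Gamma> @ \<Delta>) (LetP PStar s u) C (g \<bullet> ((ununit \<bullet> f) \<parallel> idn (tys \<Delta>)))"
  using sem_Let[OF binds.Unit, of \<Gamma> s f \<Delta> u C g] by simp

lemma sem_Unit_letE:
  assumes "sem \<Theta> (LetP PStar s u) C k"
  obtains \<Gamma> \<Delta> f g where "sem \<Gamma> s TUnit f" "sem \<Delta> u C g" "mset \<Theta> = mset (\<Gamma> @ \<Delta>)" "wf_ctx (\<Gamma> @ \<Delta>)"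
proof -
  obtain A \<Pi> p \<Gamma> \<Delta> f g where 1: "binds (LetP PStar s u) s u A \<Pi> p" "sem \<Gamma> s A f" "sem (\<Pi> @ \<Delta>) u C g"
    "mset \<Theta> = mset (\<Gamma> @ \<Delta>)" "wf_ctx (\<Gamma> @ \<Delta>)"
    using sem_LetE[OF assms binds.Unit] by metis
  from 1(1) have "A = TUnit" "\<Pi> = []" by (cases, simp)+
  with 1 that show ?thesis by simp
qed

lemma sem_Pair_let:
  "sem \<Gamma> s (TTensor A B) f \<Longrightarrow> sem ((x, A) # (y, B) # \<Delta>) u C g \<Longrightarrow> wf_ctx (\<Gamma> @ \<Delta>) \<Longrightarrow>
   sem (\<Gamma> @ \<Delta>) (LetP (PPair x y) s u) C (g \<bullet> ((unpair A B \<bullet> f) \<parallel> idn (tys \<Delta>)))"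
  using sem_Let[OF binds.Pair, of \<Gamma> s A B f x y \<Delta> u C g] by simp

lemma sem_Pair_letE:
  assumes "sem \<Theta> (LetP (PPair x y) s u) C k"
  obtains A B \<Gamma> \<Delta> f g where "sem \<Gamma> s (TTensor A B) f" "sem ((x, A) # (y, B) # \<Delta>) u C g"
    "mset \<Theta> = mset (\<Gamma> @ \<Delta>)" "wf_ctx (\<Gamma> @ \<Delta>)"
proof -
  obtain A \<Pi> p \<Gamma> \<Delta> f g where 1: "binds (LetP (PPair x y) s u) s u A \<Pi> p" "sem \<Gamma> s A f"
    "sem (\<Pi> @ \<Delta>) u C g" "mset \<Theta> = mset (\<Gamma> @ \<Delta>)" "wf_ctx (\<Gamma> @ \<Delta>)"
    using sem_LetE[OF assms binds.Pair] by metis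
  from 1(1) obtain A' B' where "A = TTensor A' B'" "\<Pi> = [(x, A'), (y, B')]" by cases blast
  with 1 that show ?thesis by simp
qed

lemma sem_Name_let:
  "sem \<Gamma> s A f \<Longrightarrow> sem ((x, A) # \<Delta>) u C g \<Longrightarrow> wf_ctx (\<Gamma> @ \<Delta>) \<Longrightarrow>
   sem (\<Gamma> @ \<Delta>) (LetV x s u) C (g \<bullet> (f \<parallel> idn (tys \<Delta>)))"
  using sem_Let[OF binds.Name, of \<Gamma> s A f x \<Delta> u C g] by simp

lemma sem_Name_letE:
  assumes "sem \<Theta> (LetV x s u) C k"
  obtains A \<Gamma> \<Delta> f g where "sem \<Gamma> s A f" "sem ((x, A) # \<Delta>) u C g"
    "mset \<Theta> = mset (\<Gamma> @ \<Delta>)" "wf_ctx (\<Gamma> @ \<Delta>)"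
proof -
  obtain A \<Pi> p \<Gamma> \<Delta> f g where 1: "binds (LetV x s u) s u A \<Pi> p" "sem \<Gamma> s A f"
    "sem (\<Pi> @ \<Delta>) u C g" "mset \<Theta> = mset (\<Gamma> @ \<Delta>)" "wf_ctx (\<Gamma> @ \<Delta>)"
    using sem_LetE[OF assms binds.Name] by metis
  from 1(1) have "\<Pi> = [(x, A)]" by cases blast
  with 1 that show ?thesis by simp
qed

lemma sem_Star: "sem [] Star TUnit unit"
  using sem_Op[OF ops.Star sem_sems.Nil] by (simp add: wf_ctx_def)

lemma sem_StarE:
  assumes "sem \<Theta> Star C k"
  shows "\<Theta> = [] \<and> C = TUnit"
proof -
  have "set \<Theta> = {}" using sem_fv[OF assms] by simp
  then have "\<Theta> = []" by simp
  with assms sem_unique[OF sem_Star] show ?thesis by simp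
qed

lemma sem_Tup:
  assumes "sem \<Gamma> s A f" "sem \<Delta> t B g" "wf_ctx (\<Gamma> @ \<Delta>)"
  shows "sem (\<Gamma> @ \<Delta>) (Tup s t) (TTensor A B) (pair A B \<bullet> (f \<parallel> g))"
proof -
  have "sems (\<Gamma> @ \<Delta>) [s, t] [A, B] (f \<parallel> g)"
    using sem_sems.Cons[OF assms(1)] assms(2) by (simp flip: sems_single)
  then show ?thesis using sem_Op[OF ops.Tup] assms(3) by blast
qed

lemma sem_TupE:
  assumes "sem \<Theta> (Tup s t) C k"
  obtains A B \<Gamma> \<Delta> f g where "C = TTensor A B" "sem \<Gamma> s A f" "sem \<Delta> t B g"
    "mset \<Theta> = mset (\<Gamma> @ \<Delta>)" "wf_ctx (\<Gamma> @ \<Delta>)"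
proof -
  obtain As \<phi> \<Gamma>0 f where 1: "ops (Tup s t) [s, t] As C \<phi>" "sems \<Gamma>0 [s, t] As f" "mset \<Theta> = mset \<Gamma>0" "wf_ctx \<Gamma>0"
    using sem_OpE[OF assms ops.Tup] by metis
  from 1(1) obtain A B where AB: "As = [A] @ [B]" "C = TTensor A B" by cases auto
  from 1(2) have "sems \<Gamma>0 ([s] @ [t]) ([A] @ [B]) f" by (simp add: AB)
  then obtain \<Gamma> \<Delta> f1 f2 where "\<Gamma>0 = \<Gamma> @ \<Delta>" "sem \<Gamma> s A f1" "sem \<Delta> t B f2"
    by (subst (asm) sems_append_iff) (simp_all add: sems_single, blast)
  with 1 AB that show ?thesis by simp
qed

lemma sem_VarE:
  assumes "sem \<Theta> (Var x) A k"
  shows "\<Theta> = [(x, A)]"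
  using assms by cases simp_all

text \<open>Renaming substitutes variables for variables, whose meanings are identities; the arrow
  is unchanged because it sees only the types in a context.\<close>

lemma sem_rename:
  assumes "sem (\<Pi> @ \<Delta>) u C g" "wf_ctx (\<Pi>' @ \<Delta>)" "tys \<Pi>' = tys \<Pi>"
    and "map (\<lambda>z. \<sigma> (fst z)) (\<Pi> @ \<Delta>) = map (\<lambda>z. Var (fst z)) (\<Pi>' @ \<Delta>)" "no_capture \<sigma> u"
  shows "sem (\<Pi>' @ \<Delta>) (subst \<sigma> u) C g"
proof -
  have "substs (\<Pi>' @ \<Delta>) \<sigma> (\<Pi> @ \<Delta>) (idn (tys (\<Pi>' @ \<Delta>)))"
    unfolding assms(4) using sems_vars[of "\<Pi>' @ \<Delta>"] assms(3) by simp
  from sem_subst(1)[OF assms(1) this assms(2,5)] show ?thesis using assms(1,3) by simp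
qed

text \<open>A meaning of both sides in one context is assumed, and inverting it supplies the types
  and the splitting of the context. Each equation is then checked over an ordering of the context
  that suits it and transported by \<open>sem_eqI\<close>.\<close>

lemma basic_eq_sem: "basic_eq s t \<Longrightarrow> sem \<Theta> s A f \<Longrightarrow> sem \<Theta> t A g \<Longrightarrow> f = g"
proof (induction rule: basic_eq.induct)
  case (AlphaPair x' y' t x y s)
  obtain B C \<Gamma> \<Delta> h k where 1: "sem \<Gamma> s (TTensor B C) h" "sem ((x, B) # (y, C) # \<Delta>) t A k"
    "mset \<Theta> = mset (\<Gamma> @ \<Delta>)" "wf_ctx (\<Gamma> @ \<Delta>)"
    using sem_Pair_letE[OF AlphaPair(3)] by metis
  \<comment> \<open>The right side is inverted to learn that its two binders are distinct.\<close>
  obtain B' C' \<Delta>' t' k' where "sem ((x', B') # (y', C') # \<Delta>') t' A k'"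
    using sem_Pair_letE[OF AlphaPair(4)] by metis
  from sem_wf[OF this] have "x' \<noteq> y'" by (simp add: wf_ctx_def)
  moreover have w: "x \<noteq> y" "x \<notin> fst ` set \<Delta>" "y \<notin> fst ` set \<Delta>" "wf_ctx \<Delta>"
    using sem_wf[OF 1(2)] by (simp_all add: wf_ctx_def)
  moreover have "x' \<notin> fst ` set \<Delta>" "y' \<notin> fst ` set \<Delta>"
    using AlphaPair(1) sem_fv[OF 1(2)] w by auto
  ultimately have wf: "wf_ctx ([(x', B), (y', C)] @ \<Delta>)" by (simp add: wf_ctx_def)
  let ?t = "subst (Var(x := Var x', y := Var y')) t"
  have "sem ([(x', B), (y', C)] @ \<Delta>) ?t A k"
    by (rule sem_rename[of "[(x, B), (y, C)]", OF _ wf _ _ AlphaPair(2)]) (use 1(2) w in auto)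
  with 1 have R: "sem (\<Gamma> @ \<Delta>) (LetP (PPair x' y') s ?t) A (k \<bullet> ((unpair B C \<bullet> h) \<parallel> idn (tys \<Delta>)))"
    by (simp add: sem_Pair_let)
  from sem_eqI[OF AlphaPair(3,4) 1(3) sem_Pair_let[OF 1(1,2,4)] R] show ?case .
next
  case (AlphaLet x' t x s)
  obtain B \<Gamma> \<Delta> h k where 1: "sem \<Gamma> s B h" "sem ((x, B) # \<Delta>) t A k"
    "mset \<Theta> = mset (\<Gamma> @ \<Delta>)" "wf_ctx (\<Gamma> @ \<Delta>)"
    using sem_Name_letE[OF AlphaLet(3)] by metis
  have w: "x \<notin> fst ` set \<Delta>" "wf_ctx \<Delta>"
    using sem_wf[OF 1(2)] by (simp_all add: wf_ctx_def)
  moreover have "x' \<notin> fst ` set \<Delta>"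
    using AlphaLet(1) sem_fv[OF 1(2)] w by auto
  ultimately have wf: "wf_ctx ([(x', B)] @ \<Delta>)" by (simp add: wf_ctx_def)
  let ?t = "subst (Var(x := Var x')) t"
  have "sem ([(x', B)] @ \<Delta>) ?t A k"
    by (rule sem_rename[of "[(x, B)]", OF _ wf _ _ AlphaLet(2)]) (use 1(2) w in auto)
  with 1 have R: "sem (\<Gamma> @ \<Delta>) (LetV x' s ?t) A (k \<bullet> (h \<parallel> idn (tys \<Delta>)))"
    by (simp add: sem_Name_let)
  from sem_eqI[OF AlphaLet(3,4) 1(3) sem_Name_let[OF 1(1,2,4)] R] show ?case .
next
  case (BetaUnit t)
  obtain \<Gamma> \<Delta> h k where 1: "sem \<Gamma> Star TUnit h" "sem \<Delta> t A k" "mset \<Theta> = mset (\<Gamma> @ \<Delta>)" "wf_ctx (\<Gamma> @ \<Delta>)"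
    using sem_Unit_letE[OF BetaUnit(1)] by metis
  have [simp]: "\<Gamma> = []" using sem_StarE[OF 1(1)] by simp
  have "sem (\<Gamma> @ \<Delta>) (LetP PStar Star t) A k"
    using sem_Unit_let[OF sem_Star 1(2)] 1(2) sem_wf[OF 1(2)] by (simp add: ununit_unit)
  moreover have "sem (\<Gamma> @ \<Delta>) t A k" using 1(2) by simp
  ultimately show ?case by (rule sem_eqI[OF BetaUnit(1,2) 1(3)])
next
  case (BetaPair x s y t u)
  obtain B C \<Gamma> \<Delta> h k where 1: "sem \<Gamma> (Tup s t) (TTensor B C) h" "sem ((x, B) # (y, C) # \<Delta>) u A k"
    "mset \<Theta> = mset (\<Gamma> @ \<Delta>)" "wf_ctx (\<Gamma> @ \<Delta>)"
    using sem_Pair_letE[OF BetaPair(2)] by metis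
  obtain \<Gamma>1 \<Gamma>2 hs ht where 2: "sem \<Gamma>1 s B hs" "sem \<Gamma>2 t C ht" "mset \<Gamma> = mset (\<Gamma>1 @ \<Gamma>2)" "wf_ctx (\<Gamma>1 @ \<Gamma>2)"
    using sem_TupE[OF 1(1)] by (metis ty.inject(2))
  have wf: "wf_ctx ((\<Gamma>1 @ \<Gamma>2) @ \<Delta>)" using 1(4) 2(3) wf_ctx_mset[of "\<Gamma> @ \<Delta>" "(\<Gamma>1 @ \<Gamma>2) @ \<Delta>"] by simp
  let ?\<sigma> = "Var(x := s, y := t)"
  have w: "x \<noteq> y" "x \<notin> fst ` set \<Delta>" "y \<notin> fst ` set \<Delta>"
    using sem_wf[OF 1(2)] by (simp_all add: wf_ctx_def)
  have "substs \<Delta> ?\<sigma> \<Delta> (idn (tys \<Delta>))"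
    by (rule substs_cong[OF sems_vars]) (use w in auto)
  then have "substs ((\<Gamma>1 @ \<Gamma>2) @ \<Delta>) ?\<sigma> ((x, B) # (y, C) # \<Delta>) ((hs \<parallel> ht) \<parallel> idn (tys \<Delta>))"
    using sem_sems.Cons[OF 2(1) sem_sems.Cons[OF 2(2)]] w(1) by simp
  from sem_subst(1)[OF 1(2) this wf BetaPair(1)]
  have R: "sem ((\<Gamma>1 @ \<Gamma>2) @ \<Delta>) (subst ?\<sigma> u) A (k \<bullet> ((hs \<parallel> ht) \<parallel> idn (tys \<Delta>)))" .
  have "unpair B C \<bullet> pair B C \<bullet> (hs \<parallel> ht) = (unpair B C \<bullet> pair B C) \<bullet> (hs \<parallel> ht)" by simp
  also have "\<dots> = hs \<parallel> ht" using 2(1,2) by (simp add: unpair_pair del: cmp_assoc)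
  finally have L: "sem ((\<Gamma>1 @ \<Gamma>2) @ \<Delta>) (LetP (PPair x y) (Tup s t) u) A (k \<bullet> ((hs \<parallel> ht) \<parallel> idn (tys \<Delta>)))"
    using sem_Pair_let[OF sem_Tup[OF 2(1,2,4)] 1(2) wf] by simp
  have "mset \<Theta> = mset ((\<Gamma>1 @ \<Gamma>2) @ \<Delta>)" using 1(3) 2(3) by simp
  from sem_eqI[OF BetaPair(2,3) this L R] show ?case .
next
  case (BetaLet x s t)
  obtain B \<Gamma> \<Delta> h k where 1: "sem \<Gamma> s B h" "sem ((x, B) # \<Delta>) t A k"
    "mset \<Theta> = mset (\<Gamma> @ \<Delta>)" "wf_ctx (\<Gamma> @ \<Delta>)"
    using sem_Name_letE[OF BetaLet(2)] by metis
  let ?\<sigma> = "Var(x := s)"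
  have w: "x \<notin> fst ` set \<Delta>" using sem_wf[OF 1(2)] by (simp add: wf_ctx_def)
  have "substs \<Delta> ?\<sigma> \<Delta> (idn (tys \<Delta>))"
    by (rule substs_cong[OF sems_vars]) (use w in auto)
  then have "substs (\<Gamma> @ \<Delta>) ?\<sigma> ((x, B) # \<Delta>) (h \<parallel> idn (tys \<Delta>))"
    using sem_sems.Cons[OF 1(1)] by simp
  from sem_subst(1)[OF 1(2) this 1(4) BetaLet(1)]
  have R: "sem (\<Gamma> @ \<Delta>) (subst ?\<sigma> t) A (k \<bullet> (h \<parallel> idn (tys \<Delta>)))" .
  from sem_eqI[OF BetaLet(2,3) 1(3) sem_Name_let[OF 1(1,2,4)] R] show ?case .
next
  case (EtaUnit t)
  obtain \<Gamma> \<Delta> h k where 1: "sem \<Gamma> t TUnit h" "sem \<Delta> Star A k" "mset \<Theta> = mset (\<Gamma> @ \<Delta>)" "wf_ctx (\<Gamma> @ \<Delta>)"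
    using sem_Unit_letE[OF EtaUnit(1)] by metis
  have [simp]: "\<Delta> = []" using sem_StarE[OF 1(2)] by simp
  have "unit \<bullet> ununit \<bullet> h = (unit \<bullet> ununit) \<bullet> h" by simp
  also have "\<dots> = h" using 1(1) by (simp add: unit_ununit del: cmp_assoc)
  finally have L: "sem \<Gamma> (LetP PStar t Star) TUnit h"
    using sem_Unit_let[OF 1(1) sem_Star] sem_wf[OF 1(1)] 1(1) by simp
  from 1(3) have "mset \<Theta> = mset \<Gamma>" by simp
  from sem_eqI[OF EtaUnit(1,2) this L 1(1)] show ?case .
next
  case (EtaPair x y t)
  obtain B C \<Gamma> \<Delta> h k where 1: "sem \<Gamma> t (TTensor B C) h" "sem ((x, B) # (y, C) # \<Delta>) (Tup (Var x) (Var y)) A k"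
    "mset \<Theta> = mset (\<Gamma> @ \<Delta>)" "wf_ctx (\<Gamma> @ \<Delta>)"
    using sem_Pair_letE[OF EtaPair(1)] by metis
  obtain B' C' \<Gamma>1 \<Gamma>2 h1 h2 where 2: "sem \<Gamma>1 (Var x) B' h1" "sem \<Gamma>2 (Var y) C' h2"
    "mset ((x, B) # (y, C) # \<Delta>) = mset (\<Gamma>1 @ \<Gamma>2)"
    using sem_TupE[OF 1(2)] by metis
  \<comment> \<open>By linearity a body that uses just \<open>x\<close> and \<open>y\<close> leaves
    no room for further declarations.\<close>
  have "mset ((x, B) # (y, C) # \<Delta>) = mset [(x, B'), (y, C')]"
    using 2(3) sem_VarE[OF 2(1)] sem_VarE[OF 2(2)] by simp
  from mset_eq_length[OF this] have [simp]: "\<Delta> = []" by simp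
  have xy: "wf_ctx ([(x, B)] @ [(y, C)])" using sem_wf[OF 1(2)] by simp
  have "pair B C \<bullet> unpair B C \<bullet> h = (pair B C \<bullet> unpair B C) \<bullet> h" by simp
  also have "\<dots> = h" using 1(1) by (simp add: pair_unpair del: cmp_assoc)
  finally have L: "sem \<Gamma> (LetP (PPair x y) t (Tup (Var x) (Var y))) (TTensor B C) h"
    using sem_Pair_let[OF 1(1), of x y "[]"] sem_Tup[OF sem_sems.Var sem_sems.Var xy] sem_wf[OF 1(1)] 1(1)
    by (fastforce simp: idn_ten)
  from 1(3) have "mset \<Theta> = mset \<Gamma>" by simp
  from sem_eqI[OF EtaPair(1,2) this L 1(1)] show ?case .
next
  case (CommNest P u R s t)
  then show ?case by (blast intro: comm_nest)
next
  case (CommSwap P t R s u)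
  then show ?case by (blast intro: comm_swap)
next
  case (CommGate i ts P s G)
  have ts: "ts = take i ts @ ts ! i # drop (Suc i) ts" using CommGate(1) by (rule id_take_nth_drop)
  have "ts[i := LetP P s (ts ! i)] = take i ts @ LetP P s (ts ! i) # drop (Suc i) ts"
    using CommGate(1) by (rule upd_conv_take_nth_drop)
  moreover have "ops (App G ts) (take i ts @ ts ! i # drop (Suc i) ts)
      (map TQubit (acts G)) (qubits_ty (acts G)) (gate G)"
    unfolding ts[symmetric] by (rule ops.App)
  moreover have "pvars P \<inter> fv v = {}" if v: "v \<in> set (take i ts) \<union> set (drop (Suc i) ts)" for v
  proof -
    from v obtain j where "j < length ts" "j \<noteq> i" "v = ts ! j"
    proof
      assume "v \<in> set (take i ts)"
      then show ?thesis using that by (fastforce simp: in_set_conv_nth)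
    next
      assume "v \<in> set (drop (Suc i) ts)"
      then obtain j where "j < length ts - Suc i" "v = ts ! (Suc i + j)"
        by (auto simp: in_set_conv_nth)
      then show ?thesis using that[of "Suc i + j"] by simp
    qed
    with CommGate(2) show ?thesis by blast
  qed
  moreover have "ops (App G us) us As B \<phi>" if "ops (App G ts) vs As B \<phi>" for us vs As B \<phi>
    using that by cases (auto intro: ops.App)
  ultimately show ?case
    by (intro comm_op[OF CommGate(3,4)]) auto
next
  case (CommTensL P u s t)
  show ?case
  proof (rule comm_op[OF CommTensL(2,3), of "[]" t "[u]"])
    \<comment> \<open>The types are placeholders: this premise of \<open>comm_op\<close> fixes the
      shape of the tuple, and the true types come from inversion.\<close>
    show "ops (Tup t u) ([] @ t # [u]) [A, A] (TTensor A A) (pair A A)"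
      using ops.Tup[of t u] by simp
    show "ops (Tup (LetP P s t) u) ([] @ LetP P s t # [u]) As B \<phi>"
      if "ops (Tup t u) ([] @ t # [u]) As B \<phi>" for As B \<phi>
      using that by cases (auto intro: ops.Tup)
  qed (use CommTensL in auto)
next
  case (CommTensR P t s u)
  show ?case
  proof (rule comm_op[OF CommTensR(2,3), of "[t]" u "[]"])
    show "ops (Tup t u) ([t] @ u # []) [A, A] (TTensor A A) (pair A A)"
      using ops.Tup[of t u] by simp
    show "ops (Tup t (LetP P s u)) ([t] @ LetP P s u # []) As B \<phi>"
      if "ops (Tup t u) ([t] @ u # []) As B \<phi>" for As B \<phi>
      using that by cases (auto intro: ops.Tup)
  qed (use CommTensR in auto)
qed

section \<open>Soundness of judgemental equality\<close>

lemma perm_swap_ctx: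
  assumes "wf_ctx (\<Gamma> @ y # x # \<Delta>)"
  shows "perm (\<Gamma> @ y # x # \<Delta>) (\<Gamma> @ x # y # \<Delta>) = swap \<Gamma> y x \<Delta>"
  using rearr_perm[OF rearr.step[OF rearr.refl] wf_ctx_distinct[OF assms]] by (simp add: idn_ten)

lemma sems_common:
  assumes "length \<Gamma>s = n" "length ts = n" "length ts' = n" "length As = n"
    and "\<And>i. i < n \<Longrightarrow> \<exists>f. sem (\<Gamma>s ! i) (ts ! i) (As ! i) f \<and> sem (\<Gamma>s ! i) (ts' ! i) (As ! i) f"
  shows "\<exists>f. sems (concat \<Gamma>s) ts As f \<and> sems (concat \<Gamma>s) ts' As f"
  using assms
proof (induction n arbitrary: \<Gamma>s ts ts' As)
  case 0
  then show ?case by (auto intro: sem_sems.Nil)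
next
  case (Suc n)
  then obtain \<Gamma> \<Gamma>s0 t ts0 t' ts0' A As0 where [simp]: "\<Gamma>s = \<Gamma> # \<Gamma>s0" "ts = t # ts0" "ts' = t' # ts0'" "As = A # As0"
    by (auto simp: length_Suc_conv)
  have "\<exists>f. sems (concat \<Gamma>s0) ts0 As0 f \<and> sems (concat \<Gamma>s0) ts0' As0 f"
    by (rule Suc.IH) (use Suc.prems(1-4) Suc.prems(5)[of "Suc _"] in simp_all)
  moreover have "\<exists>f. sem \<Gamma> t A f \<and> sem \<Gamma> t' A f"
    using Suc.prems(5)[of 0] by simp
  ultimately show ?case by (auto intro: sem_sems.Cons)
qed

text \<open>A common arrow is what the induction can carry: congruences rebuild it from the parts,
  and \<open>Trans\<close> glues two of them because the middle term has only one meaning. The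
  premise \<open>typed\<close> depends on the concrete interpretation and is supplied by
  \<open>derives_sem\<close>.\<close>

lemma judg_eq_sem:
  assumes typed: "\<And>\<Gamma> t A. typed acts \<Gamma> t A \<Longrightarrow> \<exists>f. sem \<Gamma> t A f"
    and "judg_eq acts \<Gamma> s t A"
  shows "\<exists>f. sem \<Gamma> s A f \<and> sem \<Gamma> t A f"
  using assms(2)
proof (induction rule: judg_eq.induct)
  case (Basic s t \<Gamma> A)
  then show ?case using typed basic_eq_sem by metis
next
  case (Refl \<Gamma> t A)
  then show ?case using typed by blast
next
  case (Trans \<Gamma> s t A u)
  then show ?case using sem_unique by metis
next
  case (CongSwap \<Gamma> x A y B \<Delta> s t C)
  then obtain f where "sem (\<Gamma> @ (x, A) # (y, B) # \<Delta>) s C f" "sem (\<Gamma> @ (x, A) # (y, B) # \<Delta>) t C f" by blast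
  moreover have "mset (\<Gamma> @ (y, B) # (x, A) # \<Delta>) = mset (\<Gamma> @ (x, A) # (y, B) # \<Delta>)" by simp
  ultimately show ?case using sem_perm by blast
next
  case (CongUnitE \<Gamma> s s' \<Delta> t t' A)
  then show ?case using sem_Unit_let by blast
next
  case (CongGate \<Gamma>s G ts ts')
  have "\<exists>f. sems (concat \<Gamma>s) ts (map TQubit (acts G)) f \<and> sems (concat \<Gamma>s) ts' (map TQubit (acts G)) f"
    by (rule sems_common[OF CongGate(1-3)]) (use CongGate.IH in auto)
  then show ?case using sem_Op[OF ops.App] CongGate.hyps by blast
next
  case (CongTensI \<Gamma> s s' A \<Delta> t t' B)
  then show ?case using sem_Tup by blast
next
  case (CongTensE \<Gamma> s s' A B x y \<Delta> t t' C)
  then show ?case using sem_Pair_let by blast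
next
  case (CongLet \<Gamma> s s' A x \<Delta> t t' C)
  then show ?case using sem_Name_let by blast
qed blast

end

section \<open>Strictification of a symmetric monoidal category\<close>

context symmetric_monoidal_category begin

section \<open>Endpoints and inverses of arrows\<close>

abbreviation "\<iota> \<equiv> ident C"
abbreviation "\<alpha> \<equiv> assoc C"
abbreviation "\<eta> \<equiv> lunit C"
abbreviation "\<rho> \<equiv> runit C"
abbreviation "\<sigma> \<equiv> symm C"

declare tunit_obj [simp] tobj_obj [simp] tarr_ident [simp]

lemma homD: "f \<in> hom C a b \<Longrightarrow> f \<in> Arr C \<and> Dom C f = a \<and> Cod C f = b"
  by (simp add: hom_def)

lemma homI: "f \<in> Arr C \<Longrightarrow> f \<in> hom C (Dom C f) (Cod C f)"
  by (simp add: hom_def)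

lemma obj_dom_cod [simp]: "f \<in> Arr C \<Longrightarrow> Dom C f \<in> Obj C" "f \<in> Arr C \<Longrightarrow> Cod C f \<in> Obj C"
  using dom_cod by auto

lemma arr_ident [simp]:
  "a \<in> Obj C \<Longrightarrow> \<iota> a \<in> Arr C" "a \<in> Obj C \<Longrightarrow> Dom C (\<iota> a) = a" "a \<in> Obj C \<Longrightarrow> Cod C (\<iota> a) = a"
  using ident_hom by (auto simp: hom_def)

lemma arr_comp [simp]:
  assumes "g \<in> Arr C" "f \<in> Arr C" "Dom C g = Cod C f"
  shows "g \<cdot> f \<in> Arr C" "Dom C (g \<cdot> f) = Dom C f" "Cod C (g \<cdot> f) = Cod C g"
  using comp_hom[OF homI[OF assms(1)], of f "Dom C f"] assms by (auto simp: hom_def)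

lemma comp_assoc' [simp]:
  assumes "h \<in> Arr C" "g \<in> Arr C" "f \<in> Arr C" "Dom C h = Cod C g" "Dom C g = Cod C f"
  shows "(h \<cdot> g) \<cdot> f = h \<cdot> (g \<cdot> f)"
  by (rule comp_assoc[of _ "Cod C g" "Cod C h" _ "Cod C f" _ "Dom C f"]) (use assms in \<open>auto simp: hom_def\<close>)

lemma comp_ident' [simp]: "f \<in> Arr C \<Longrightarrow> Dom C f = a \<Longrightarrow> f \<cdot> \<iota> a = f"
  "f \<in> Arr C \<Longrightarrow> Cod C f = a \<Longrightarrow> \<iota> a \<cdot> f = f"
  using comp_ident ident_comp homI by blast+

lemma arr_tarr [simp]:
  assumes "f \<in> Arr C" "g \<in> Arr C"
  shows "f \<otimes> g \<in> Arr C" "Dom C (f \<otimes> g) = Dom C f \<odot> Dom C g" "Cod C (f \<otimes> g) = Cod C f \<odot> Cod C g"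
  using tarr_hom[OF homI homI] assms by (auto simp: hom_def)

lemma tarr_comp':
  assumes "g \<in> Arr C" "f \<in> Arr C" "Dom C g = Cod C f" "g' \<in> Arr C" "f' \<in> Arr C" "Dom C g' = Cod C f'"
  shows "(g \<otimes> g') \<cdot> (f \<otimes> f') = (g \<cdot> f) \<otimes> (g' \<cdot> f')"
  by (rule tarr_comp[symmetric, of _ "Cod C f" "Cod C g" _ "Dom C f" _ "Cod C f'" "Cod C g'" _ "Dom C f'"])
    (use assms in \<open>auto simp: hom_def\<close>)

lemma tarr_comp'':
  assumes "g \<in> Arr C" "f \<in> Arr C" "Dom C g = Cod C f" "g' \<in> Arr C" "f' \<in> Arr C" "Dom C g' = Cod C f'"
    and "h \<in> Arr C" "Cod C h = Dom C f \<odot> Dom C f'"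
  shows "(g \<otimes> g') \<cdot> ((f \<otimes> f') \<cdot> h) = ((g \<cdot> f) \<otimes> (g' \<cdot> f')) \<cdot> h"
  using assms tarr_comp'[OF assms(1-6)] comp_assoc'[of "g \<otimes> g'" "f \<otimes> f'" h] by simp

lemma arr_assoc [simp]:
  assumes "a \<in> Obj C" "b \<in> Obj C" "c \<in> Obj C"
  shows "\<alpha> a b c \<in> Arr C" "Dom C (\<alpha> a b c) = (a \<odot> b) \<odot> c" "Cod C (\<alpha> a b c) = a \<odot> b \<odot> c"
  using assoc_hom assms by (auto simp: hom_def)

lemma arr_lunit [simp]:
  "a \<in> Obj C \<Longrightarrow> \<eta> a \<in> Arr C" "a \<in> Obj C \<Longrightarrow> Dom C (\<eta> a) = \<I> \<odot> a" "a \<in> Obj C \<Longrightarrow> Cod C (\<eta> a) = a"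
  using lunit_hom by (auto simp: hom_def)

lemma arr_runit [simp]:
  "a \<in> Obj C \<Longrightarrow> \<rho> a \<in> Arr C" "a \<in> Obj C \<Longrightarrow> Dom C (\<rho> a) = a \<odot> \<I>" "a \<in> Obj C \<Longrightarrow> Cod C (\<rho> a) = a"
  using runit_hom by (auto simp: hom_def)

lemma arr_symm [simp]:
  assumes "a \<in> Obj C" "b \<in> Obj C"
  shows "\<sigma> a b \<in> Arr C" "Dom C (\<sigma> a b) = a \<odot> b" "Cod C (\<sigma> a b) = b \<odot> a"
  using symm_hom assms by (auto simp: hom_def)

lemma assoc_natural':
  assumes "f \<in> Arr C" "g \<in> Arr C" "h \<in> Arr C"
  shows "\<alpha> (Cod C f) (Cod C g) (Cod C h) \<cdot> ((f \<otimes> g) \<otimes> h) = (f \<otimes> g \<otimes> h) \<cdot> \<alpha> (Dom C f) (Dom C g) (Dom C h)"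
  by (rule assoc_natural) (use assms homI in auto)

lemma lunit_natural': "f \<in> Arr C \<Longrightarrow> \<eta> (Cod C f) \<cdot> (\<iota> \<I> \<otimes> f) = f \<cdot> \<eta> (Dom C f)"
  by (rule lunit_natural) (rule homI)

lemma runit_natural': "f \<in> Arr C \<Longrightarrow> \<rho> (Cod C f) \<cdot> (f \<otimes> \<iota> \<I>) = f \<cdot> \<rho> (Dom C f)"
  by (rule runit_natural) (rule homI)

lemma symm_natural':
  "f \<in> Arr C \<Longrightarrow> g \<in> Arr C \<Longrightarrow> \<sigma> (Cod C f) (Cod C g) \<cdot> (f \<otimes> g) = (g \<otimes> f) \<cdot> \<sigma> (Dom C f) (Dom C g)"
  by (rule symm_natural) (rule homI, assumption)+

lemma inverse_arrsD:
  assumes "inverse_arrs C f g"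
  shows "f \<in> Arr C" "g \<in> Arr C" "Dom C g = Cod C f" "Cod C g = Dom C f"
    "g \<cdot> f = \<iota> (Dom C f)" "f \<cdot> g = \<iota> (Cod C f)"
  using assms by (auto simp: inverse_arrs_def hom_def)

lemma inverse_arrs_sym:
  assumes "inverse_arrs C f g"
  shows "inverse_arrs C g f"
  using inverse_arrsD[OF assms] by (simp add: inverse_arrs_def hom_def)

lemma inverse_arrs_unique:
  assumes "inverse_arrs C f g" "inverse_arrs C f h"
  shows "g = h"
proof -
  note 1 = inverse_arrsD[OF assms(1)] and 2 = inverse_arrsD[OF assms(2)]
  have "g = g \<cdot> (f \<cdot> h)" using 1 2 by simp
  also have "\<dots> = (g \<cdot> f) \<cdot> h" using 1(1-4) 2(1-4) by simp
  also have "\<dots> = h" using 1 2 by simp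
  finally show ?thesis .
qed

lemma inv_arr_eqI: "inverse_arrs C f g \<Longrightarrow> inv_arr C f = g"
  unfolding inv_arr_def using inverse_arrs_unique by blast

lemma iso_inverse: "iso C f \<Longrightarrow> inverse_arrs C f (inv_arr C f)"
  unfolding iso_def by (metis inv_arr_eqI)

lemma inverse_arrs_ident: "a \<in> Obj C \<Longrightarrow> inverse_arrs C (\<iota> a) (\<iota> a)"
  by (simp add: inverse_arrs_def hom_def)

lemma inverse_arrs_comp:
  assumes "inverse_arrs C f f'" "inverse_arrs C g g'" "Dom C g = Cod C f"
  shows "inverse_arrs C (g \<cdot> f) (f' \<cdot> g')"
proof -
  note 1 = inverse_arrsD[OF assms(1)] and 2 = inverse_arrsD[OF assms(2)]
  have "(f' \<cdot> g') \<cdot> (g \<cdot> f) = f' \<cdot> ((g' \<cdot> g) \<cdot> f)" using 1(1-4) 2(1-4) assms(3) by simp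
  moreover have "(g \<cdot> f) \<cdot> (f' \<cdot> g') = g \<cdot> ((f \<cdot> f') \<cdot> g')" using 1(1-4) 2(1-4) assms(3) by simp
  ultimately show ?thesis
    using 1 2 assms(3) by (simp add: inverse_arrs_def hom_def)
qed

lemma inverse_arrs_tarr:
  assumes "inverse_arrs C f f'" "inverse_arrs C g g'"
  shows "inverse_arrs C (f \<otimes> g) (f' \<otimes> g')"
  using inverse_arrsD[OF assms(1)] inverse_arrsD[OF assms(2)]
  by (simp add: inverse_arrs_def hom_def tarr_comp')

lemma cancel_left:
  assumes "inverse_arrs C f f'" "f \<cdot> g = f \<cdot> h" "g \<in> Arr C" "h \<in> Arr C" "Cod C g = Dom C f" "Cod C h = Dom C f"
  shows "g = h"
proof -
  note 1 = inverse_arrsD[OF assms(1)]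
  have "g = (f' \<cdot> f) \<cdot> g" using 1 assms(3-) by simp
  also have "\<dots> = f' \<cdot> (f \<cdot> h)" using 1(1-4) assms(3-) by (simp flip: assms(2))
  also have "\<dots> = (f' \<cdot> f) \<cdot> h" using 1(1-4) assms(3-) by simp
  also have "\<dots> = h" using 1 assms(3-) by simp
  finally show ?thesis .
qed

lemma cancel_right:
  assumes "inverse_arrs C f f'" "g \<cdot> f = h \<cdot> f" "g \<in> Arr C" "h \<in> Arr C" "Dom C g = Cod C f" "Dom C h = Cod C f"
  shows "g = h"
proof -
  note 1 = inverse_arrsD[OF assms(1)]
  have "g = g \<cdot> (f \<cdot> f')" using 1 assms(3-) by simp
  also have "\<dots> = (h \<cdot> f) \<cdot> f'" unfolding assms(2)[symmetric] using 1(1-4) assms(3-) by simp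
  also have "\<dots> = h \<cdot> (f \<cdot> f')" using 1(1-4) assms(3-) by simp
  also have "\<dots> = h" using 1 assms(3-) by simp
  finally show ?thesis .
qed

section \<open>Unit coherence\<close>

lemma inverse_assoc: "a \<in> Obj C \<Longrightarrow> b \<in> Obj C \<Longrightarrow> c \<in> Obj C \<Longrightarrow> inverse_arrs C (\<alpha> a b c) (inv_arr C (\<alpha> a b c))"
  and inverse_lunit: "a \<in> Obj C \<Longrightarrow> inverse_arrs C (\<eta> a) (inv_arr C (\<eta> a))"
  and inverse_runit: "a \<in> Obj C \<Longrightarrow> inverse_arrs C (\<rho> a) (inv_arr C (\<rho> a))"
  by (simp_all add: iso_inverse assoc_iso lunit_iso runit_iso)

text \<open>Tensoring with the unit is faithful: naturality of the left unitor expresses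
  \<open>f\<close> through \<open>\<iota> \<I> \<otimes> f\<close> up to isomorphisms.\<close>

lemma ident_unit_tarr_cancel:
  assumes "\<iota> \<I> \<otimes> f = \<iota> \<I> \<otimes> g" "f \<in> Arr C" "g \<in> Arr C" "Dom C f = Dom C g" "Cod C f = Cod C g"
  shows "f = g"
proof (rule cancel_right[OF inverse_lunit])
  show "f \<cdot> \<eta> (Dom C f) = g \<cdot> \<eta> (Dom C f)"
    using assms lunit_natural'[of f] lunit_natural'[of g] by simp
qed (use assms in simp_all)

lemma tarr_ident_unit_cancel:
  assumes "f \<otimes> \<iota> \<I> = g \<otimes> \<iota> \<I>" "f \<in> Arr C" "g \<in> Arr C" "Dom C f = Dom C g" "Cod C f = Cod C g"
  shows "f = g"
proof (rule cancel_right[OF inverse_runit])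
  show "f \<cdot> \<rho> (Dom C f) = g \<cdot> \<rho> (Dom C f)"
    using assms runit_natural'[of f] runit_natural'[of g] by simp
qed (use assms in simp_all)

text \<open>Kelly's argument: both sides agree after tensoring with \<open>\<I>\<close>, by the pentagon at \<open>\<I>, \<I>, a, b\<close>.\<close>

lemma lunit_tobj:
  assumes a: "a \<in> Obj C" and b: "b \<in> Obj C"
  shows "\<eta> (a \<odot> b) \<cdot> \<alpha> \<I> a b = \<eta> a \<otimes> \<iota> b"
proof (rule ident_unit_tarr_cancel)
  note [simp] = a b
  let ?P = "\<alpha> \<I> (\<I> \<odot> a) b \<cdot> (\<alpha> \<I> \<I> a \<otimes> \<iota> b)"
  have P: "inverse_arrs C ?P ((inv_arr C (\<alpha> \<I> \<I> a) \<otimes> \<iota> b) \<cdot> inv_arr C (\<alpha> \<I> (\<I> \<odot> a) b))"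
    by (rule inverse_arrs_comp[OF inverse_arrs_tarr[OF inverse_assoc inverse_arrs_ident] inverse_assoc]) simp_all
  have "(\<iota> \<I> \<otimes> (\<eta> (a \<odot> b) \<cdot> \<alpha> \<I> a b)) \<cdot> ?P
      = (\<iota> \<I> \<otimes> \<eta> (a \<odot> b)) \<cdot> ((\<iota> \<I> \<otimes> \<alpha> \<I> a b) \<cdot> \<alpha> \<I> (\<I> \<odot> a) b \<cdot> (\<alpha> \<I> \<I> a \<otimes> \<iota> b))"
    by (simp add: tarr_comp'')
  also have "\<dots> = ((\<iota> \<I> \<otimes> \<eta> (a \<odot> b)) \<cdot> \<alpha> \<I> \<I> (a \<odot> b)) \<cdot> \<alpha> (\<I> \<odot> \<I>) a b"
    using pentagon[of \<I> \<I> a b] by simp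
  also have "(\<iota> \<I> \<otimes> \<eta> (a \<odot> b)) \<cdot> \<alpha> \<I> \<I> (a \<odot> b) = \<rho> \<I> \<otimes> \<iota> a \<otimes> \<iota> b"
    by (simp add: triangle)
  also have "(\<rho> \<I> \<otimes> \<iota> a \<otimes> \<iota> b) \<cdot> \<alpha> (\<I> \<odot> \<I>) a b = \<alpha> \<I> a b \<cdot> ((\<rho> \<I> \<otimes> \<iota> a) \<otimes> \<iota> b)"
    using assoc_natural'[of "\<rho> \<I>" "\<iota> a" "\<iota> b"] by simp
  also have "\<rho> \<I> \<otimes> \<iota> a = (\<iota> \<I> \<otimes> \<eta> a) \<cdot> \<alpha> \<I> \<I> a"
    by (simp add: triangle)
  also have "\<dots> \<otimes> \<iota> b = ((\<iota> \<I> \<otimes> \<eta> a) \<otimes> \<iota> b) \<cdot> (\<alpha> \<I> \<I> a \<otimes> \<iota> b)"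
    by (simp add: tarr_comp')
  also have "\<alpha> \<I> a b \<cdot> \<dots> = (\<alpha> \<I> a b \<cdot> ((\<iota> \<I> \<otimes> \<eta> a) \<otimes> \<iota> b)) \<cdot> (\<alpha> \<I> \<I> a \<otimes> \<iota> b)"
    by simp
  also have "\<alpha> \<I> a b \<cdot> ((\<iota> \<I> \<otimes> \<eta> a) \<otimes> \<iota> b) = (\<iota> \<I> \<otimes> \<eta> a \<otimes> \<iota> b) \<cdot> \<alpha> \<I> (\<I> \<odot> a) b"
    using assoc_natural'[of "\<iota> \<I>" "\<eta> a" "\<iota> b"] by simp
  also have "\<dots> \<cdot> (\<alpha> \<I> \<I> a \<otimes> \<iota> b) = (\<iota> \<I> \<otimes> \<eta> a \<otimes> \<iota> b) \<cdot> ?P" by simp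
  finally show "\<iota> \<I> \<otimes> (\<eta> (a \<odot> b) \<cdot> \<alpha> \<I> a b) = \<iota> \<I> \<otimes> (\<eta> a \<otimes> \<iota> b)"
    by (rule cancel_right[OF P]) simp_all
qed (use assms in simp_all)

text \<open>The mirror image of \<open>lunit_tobj\<close>, by the pentagon at \<open>a\<close>,
  \<open>b\<close>, \<open>\<I>\<close>, \<open>\<I>\<close>; besides the unit on the right, the
  associator \<open>\<alpha> a b \<I>\<close> is cancelled.\<close>

lemma runit_tobj:
  assumes a: "a \<in> Obj C" and b: "b \<in> Obj C"
  shows "(\<iota> a \<otimes> \<rho> b) \<cdot> \<alpha> a b \<I> = \<rho> (a \<odot> b)"
proof (rule tarr_ident_unit_cancel, rule cancel_left[OF inverse_assoc])
  note [simp] = a b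
  have "\<alpha> a b \<I> \<cdot> (((\<iota> a \<otimes> \<rho> b) \<cdot> \<alpha> a b \<I>) \<otimes> \<iota> \<I>)
      = (\<alpha> a b \<I> \<cdot> ((\<iota> a \<otimes> \<rho> b) \<otimes> \<iota> \<I>)) \<cdot> (\<alpha> a b \<I> \<otimes> \<iota> \<I>)"
    by (simp add: tarr_comp')
  also have "\<alpha> a b \<I> \<cdot> ((\<iota> a \<otimes> \<rho> b) \<otimes> \<iota> \<I>) = (\<iota> a \<otimes> \<rho> b \<otimes> \<iota> \<I>) \<cdot> \<alpha> a (b \<odot> \<I>) \<I>"
    using assoc_natural'[of "\<iota> a" "\<rho> b" "\<iota> \<I>"] by simp
  also have "\<rho> b \<otimes> \<iota> \<I> = (\<iota> b \<otimes> \<eta> \<I>) \<cdot> \<alpha> b \<I> \<I>"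
    by (simp add: triangle)
  also have "\<iota> a \<otimes> \<dots> = (\<iota> a \<otimes> \<iota> b \<otimes> \<eta> \<I>) \<cdot> (\<iota> a \<otimes> \<alpha> b \<I> \<I>)"
    by (simp add: tarr_comp')
  also have "(\<dots> \<cdot> \<alpha> a (b \<odot> \<I>) \<I>) \<cdot> (\<alpha> a b \<I> \<otimes> \<iota> \<I>)
      = (\<iota> a \<otimes> \<iota> b \<otimes> \<eta> \<I>) \<cdot> ((\<iota> a \<otimes> \<alpha> b \<I> \<I>) \<cdot> \<alpha> a (b \<odot> \<I>) \<I> \<cdot> (\<alpha> a b \<I> \<otimes> \<iota> \<I>))"
    by simp
  also have "\<dots> = ((\<iota> a \<otimes> \<iota> b \<otimes> \<eta> \<I>) \<cdot> \<alpha> a b (\<I> \<odot> \<I>)) \<cdot> \<alpha> (a \<odot> b) \<I> \<I>"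
    using pentagon[of a b \<I> \<I>] by simp
  also have "(\<iota> a \<otimes> \<iota> b \<otimes> \<eta> \<I>) \<cdot> \<alpha> a b (\<I> \<odot> \<I>) = \<alpha> a b \<I> \<cdot> (\<iota> (a \<odot> b) \<otimes> \<eta> \<I>)"
    using assoc_natural'[of "\<iota> a" "\<iota> b" "\<eta> \<I>"] by simp
  also have "\<dots> \<cdot> \<alpha> (a \<odot> b) \<I> \<I> = \<alpha> a b \<I> \<cdot> (\<rho> (a \<odot> b) \<otimes> \<iota> \<I>)"
    by (simp add: triangle)
  finally show "\<alpha> a b \<I> \<cdot> (((\<iota> a \<otimes> \<rho> b) \<cdot> \<alpha> a b \<I>) \<otimes> \<iota> \<I>) = \<alpha> a b \<I> \<cdot> (\<rho> (a \<odot> b) \<otimes> \<iota> \<I>)" .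
qed (use assms in simp_all)

text \<open>Naturality of \<open>\<eta>\<close> at \<open>\<eta> \<I>\<close> gives \<open>\<iota>
  \<I> \<otimes> \<eta> \<I> = \<eta> (\<I> \<odot> \<I>)\<close>. With this,
  \<open>lunit_tobj\<close> and the triangle have equal left sides, and their right sides are the
  two unitors tensored with the unit.\<close>

lemma lunit_unit_eq_runit_unit: "\<eta> \<I> = \<rho> \<I>"
proof (rule tarr_ident_unit_cancel)
  have "\<eta> \<I> \<cdot> (\<iota> \<I> \<otimes> \<eta> \<I>) = \<eta> \<I> \<cdot> \<eta> (\<I> \<odot> \<I>)"
    using lunit_natural'[of "\<eta> \<I>"] by simp
  then have "\<iota> \<I> \<otimes> \<eta> \<I> = \<eta> (\<I> \<odot> \<I>)"
    by (rule cancel_left[OF inverse_lunit, rotated]) simp_all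
  then show "\<eta> \<I> \<otimes> \<iota> \<I> = \<rho> \<I> \<otimes> \<iota> \<I>"
    using lunit_tobj[of \<I> \<I>] triangle[of \<I> \<I>] by simp
qed simp_all

end

text \<open>Lists are taken over an index type with a map to objects, so that types can be entries
  and two types with the same object stay distinct. Their value \<open>T\<close> ends in the unit
  object, as \<open>ctx_obj\<close> does.\<close>

locale monoidal_family = symmetric_monoidal_category C
  for C :: "('o, 'm, 'z) smcat_scheme" (structure) +
  fixes ob :: "'x \<Rightarrow> 'o"
  assumes ob [simp]: "ob x \<in> Obj C"
begin

section \<open>Merging and splitting of iterated tensors\<close>

primrec T :: "'x list \<Rightarrow> 'o" where
  "T [] = \<I>"
| "T (x # xs) = ob x \<odot> T xs"

lemma T_obj [simp]: "T xs \<in> Obj C"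
  by (induction xs) simp_all

primrec merge :: "'x list \<Rightarrow> 'x list \<Rightarrow> 'm" where
  "merge [] ys = \<eta> (T ys)"
| "merge (x # xs) ys = (\<iota> (ob x) \<otimes> merge xs ys) \<cdot> \<alpha> (ob x) (T xs) (T ys)"

text \<open>Spelled out by recursion, not as the inverse of \<open>merge\<close>, to agree clause by
  clause with \<open>split_ctx\<close>.\<close>

primrec split :: "'x list \<Rightarrow> 'x list \<Rightarrow> 'm" where
  "split [] ys = inv_arr C (\<eta> (T ys))"
| "split (x # xs) ys = inv_arr C (\<alpha> (ob x) (T xs) (T ys)) \<cdot> (\<iota> (ob x) \<otimes> split xs ys)"

lemma arr_merge [simp]:
  "merge xs ys \<in> Arr C" "Dom C (merge xs ys) = T xs \<odot> T ys" "Cod C (merge xs ys) = T (xs @ ys)"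
  by (induction xs) simp_all

lemma merge_split: "inverse_arrs C (merge xs ys) (split xs ys)"
proof (induction xs)
  case (Cons x xs)
  then show ?case
    by (simp add: inverse_arrs_comp inverse_arrs_tarr inverse_arrs_ident inverse_assoc)
qed (simp add: inverse_lunit)

lemma arr_split [simp]:
  "split xs ys \<in> Arr C" "Dom C (split xs ys) = T (xs @ ys)" "Cod C (split xs ys) = T xs \<odot> T ys"
  using inverse_arrsD[OF merge_split[of xs ys]] by simp_all

lemma split_comp_merge [simp]: "split xs ys \<cdot> merge xs ys = \<iota> (T xs \<odot> T ys)"
  and merge_comp_split [simp]: "merge xs ys \<cdot> split xs ys = \<iota> (T (xs @ ys))"
  using inverse_arrsD(5,6)[OF merge_split[of xs ys]] by simp_all

lemma split_comp_merge' [simp]: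
  assumes "f \<in> Arr C" "Cod C f = T xs \<odot> T ys"
  shows "split xs ys \<cdot> (merge xs ys \<cdot> f) = f"
  using comp_assoc'[of "split xs ys" "merge xs ys" f] assms by simp

lemma merge_comp_split' [simp]:
  assumes "f \<in> Arr C" "Cod C f = T (xs @ ys)"
  shows "merge xs ys \<cdot> (split xs ys \<cdot> f) = f"
  using comp_assoc'[of "merge xs ys" "split xs ys" f] assms by simp

text \<open>Here unit coherence is spent: \<open>\<eta> \<I> = \<rho> \<I>\<close> at the empty list
  and \<open>runit_tobj\<close> for each entry. It makes the empty list a strict right unit.\<close>

lemma merge_Nil_right: "merge xs [] = \<rho> (T xs)"
  by (induction xs) (simp_all add: lunit_unit_eq_runit_unit runit_tobj)

text \<open>The coherence law behind strict associativity of \<open>sten\<close>.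
  \<open>lunit_tobj\<close> settles the empty list, and each entry costs one pentagon and two uses
  of naturality of the associator.\<close>

lemma merge_assoc:
  "merge xs (ys @ zs) \<cdot> (\<iota> (T xs) \<otimes> merge ys zs) \<cdot> \<alpha> (T xs) (T ys) (T zs)
    = merge (xs @ ys) zs \<cdot> (merge xs ys \<otimes> \<iota> (T zs))"
proof (induction xs)
  case Nil
  have "(\<eta> (T (ys @ zs)) \<cdot> (\<iota> \<I> \<otimes> merge ys zs)) \<cdot> \<alpha> \<I> (T ys) (T zs)
      = merge ys zs \<cdot> (\<eta> (T ys \<odot> T zs) \<cdot> \<alpha> \<I> (T ys) (T zs))"
    using lunit_natural'[of "merge ys zs"] by simp
  then show ?case by (simp add: lunit_tobj)
next
  case (Cons x xs)
  let ?x = "ob x" and ?a = "T xs" and ?b = "T ys" and ?c = "T zs"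
  have "merge (x # xs) (ys @ zs) \<cdot> (\<iota> (T (x # xs)) \<otimes> merge ys zs) \<cdot> \<alpha> (T (x # xs)) ?b ?c
      = (\<iota> ?x \<otimes> merge xs (ys @ zs)) \<cdot> ((\<alpha> ?x ?a (T (ys @ zs)) \<cdot> ((\<iota> ?x \<otimes> \<iota> ?a) \<otimes> merge ys zs)) \<cdot> \<alpha> (?x \<odot> ?a) ?b ?c)"
    by simp
  also have "\<alpha> ?x ?a (T (ys @ zs)) \<cdot> ((\<iota> ?x \<otimes> \<iota> ?a) \<otimes> merge ys zs)
      = (\<iota> ?x \<otimes> \<iota> ?a \<otimes> merge ys zs) \<cdot> \<alpha> ?x ?a (?b \<odot> ?c)"
    using assoc_natural'[of "\<iota> ?x" "\<iota> ?a" "merge ys zs"] by simp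
  also have "(\<iota> ?x \<otimes> merge xs (ys @ zs)) \<cdot> (\<dots> \<cdot> \<alpha> (?x \<odot> ?a) ?b ?c)
      = (\<iota> ?x \<otimes> merge xs (ys @ zs)) \<cdot> ((\<iota> ?x \<otimes> \<iota> ?a \<otimes> merge ys zs) \<cdot> (\<alpha> ?x ?a (?b \<odot> ?c) \<cdot> \<alpha> (?x \<odot> ?a) ?b ?c))"
    by simp
  \<comment> \<open>The pentagon trades two associators for three, one of which lies under
    \<open>\<iota> ?x\<close> and completes the left side of the induction hypothesis.\<close>
  also have "\<dots> = (\<iota> ?x \<otimes> (merge xs (ys @ zs) \<cdot> (\<iota> ?a \<otimes> merge ys zs) \<cdot> \<alpha> ?a ?b ?c)) \<cdot>
      (\<alpha> ?x (?a \<odot> ?b) ?c \<cdot> (\<alpha> ?x ?a ?b \<otimes> \<iota> ?c))"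
    by (simp add: pentagon tarr_comp'')
  also have "\<dots> = (\<iota> ?x \<otimes> merge (xs @ ys) zs) \<cdot>
      (((\<iota> ?x \<otimes> merge xs ys \<otimes> \<iota> ?c) \<cdot> \<alpha> ?x (?a \<odot> ?b) ?c) \<cdot> (\<alpha> ?x ?a ?b \<otimes> \<iota> ?c))"
    unfolding Cons.IH by (simp add: tarr_comp'')
  also have "(\<iota> ?x \<otimes> merge xs ys \<otimes> \<iota> ?c) \<cdot> \<alpha> ?x (?a \<odot> ?b) ?c
      = \<alpha> ?x (T (xs @ ys)) ?c \<cdot> ((\<iota> ?x \<otimes> merge xs ys) \<otimes> \<iota> ?c)"
    using assoc_natural'[of "\<iota> ?x" "merge xs ys" "\<iota> ?c"] by simp
  also have "(\<iota> ?x \<otimes> merge (xs @ ys) zs) \<cdot> (\<dots> \<cdot> (\<alpha> ?x ?a ?b \<otimes> \<iota> ?c))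
      = merge ((x # xs) @ ys) zs \<cdot> (merge (x # xs) ys \<otimes> \<iota> ?c)"
    by (simp add: tarr_comp')
  finally show ?case .
qed

text \<open>The inverse form of \<open>merge_assoc\<close>, obtained by cancelling an invertible
  merge on the left.\<close>

lemma split_assoc:
  "\<alpha> (T xs) (T ys) (T zs) \<cdot> ((split xs ys \<otimes> \<iota> (T zs)) \<cdot> split (xs @ ys) zs)
    = (\<iota> (T xs) \<otimes> split ys zs) \<cdot> split xs (ys @ zs)" (is "?l = ?r")
proof -
  let ?m = "merge xs (ys @ zs) \<cdot> (\<iota> (T xs) \<otimes> merge ys zs)"
  have "?m \<cdot> ?l = (?m \<cdot> \<alpha> (T xs) (T ys) (T zs)) \<cdot> ((split xs ys \<otimes> \<iota> (T zs)) \<cdot> split (xs @ ys) zs)"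
    by simp
  also have "\<dots> = merge (xs @ ys) zs \<cdot> (((merge xs ys \<otimes> \<iota> (T zs)) \<cdot> (split xs ys \<otimes> \<iota> (T zs))) \<cdot> split (xs @ ys) zs)"
    unfolding merge_assoc by simp
  also have "\<dots> = ?m \<cdot> ?r" by (simp add: tarr_comp' tarr_comp'')
  finally have eq: "?m \<cdot> ?l = ?m \<cdot> ?r" .
  have inv: "inverse_arrs C ?m ((\<iota> (T xs) \<otimes> split ys zs) \<cdot> split xs (ys @ zs))"
    by (rule inverse_arrs_comp[OF inverse_arrs_tarr[OF inverse_arrs_ident merge_split] merge_split]) simp_all
  show ?thesis by (rule cancel_left[OF inv eq]) simp_all
qed

text \<open>Resolves a merge followed by a split at another position, which is what stands between
  the two factors in \<open>braid_append\<close>. The tail \<open>f\<close> lets it apply inside a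
  longer composite.\<close>

lemma split_merge_assoc:
  assumes "f \<in> Arr C" "Cod C f = (T xs \<odot> T ys) \<odot> T zs"
  shows "split xs (ys @ zs) \<cdot> (merge (xs @ ys) zs \<cdot> ((merge xs ys \<otimes> \<iota> (T zs)) \<cdot> f))
    = (\<iota> (T xs) \<otimes> merge ys zs) \<cdot> (\<alpha> (T xs) (T ys) (T zs) \<cdot> f)"
proof -
  have "merge (xs @ ys) zs \<cdot> ((merge xs ys \<otimes> \<iota> (T zs)) \<cdot> f)
      = (merge (xs @ ys) zs \<cdot> (merge xs ys \<otimes> \<iota> (T zs))) \<cdot> f"
    using assms by simp
  also have "\<dots> = merge xs (ys @ zs) \<cdot> ((\<iota> (T xs) \<otimes> merge ys zs) \<cdot> (\<alpha> (T xs) (T ys) (T zs) \<cdot> f))"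
    unfolding merge_assoc[symmetric] using assms by simp
  finally show ?thesis using assms by simp
qed

abbreviation braid :: "'x list \<Rightarrow> 'x list \<Rightarrow> 'm" where
  "braid xs ys \<equiv> merge ys xs \<cdot> (\<sigma> (T xs) (T ys) \<cdot> split xs ys)"

text \<open>The hexagon conjugated by merging and splitting: once \<open>split_merge_assoc\<close>
  has removed the list operations between the two braidings, the middle is one side of the
  hexagon.\<close>

lemma braid_append:
  "braid xs (ys @ zs) =
    (merge ys (zs @ xs) \<cdot> ((\<iota> (T ys) \<otimes> braid xs zs) \<cdot> split ys (xs @ zs))) \<cdot>
    (merge (ys @ xs) zs \<cdot> ((braid xs ys \<otimes> \<iota> (T zs)) \<cdot> split (xs @ ys) zs))"
proof -
  let ?a = "T xs" and ?b = "T ys" and ?c = "T zs"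
  let ?s = "(split xs ys \<otimes> \<iota> ?c) \<cdot> split (xs @ ys) zs"
  have "(braid xs ys \<otimes> \<iota> ?c) \<cdot> split (xs @ ys) zs = (merge ys xs \<otimes> \<iota> ?c) \<cdot> ((\<sigma> ?a ?b \<otimes> \<iota> ?c) \<cdot> ?s)"
    by (simp add: tarr_comp'')
  then have "(merge ys (zs @ xs) \<cdot> ((\<iota> ?b \<otimes> braid xs zs) \<cdot> split ys (xs @ zs))) \<cdot>
      (merge (ys @ xs) zs \<cdot> ((braid xs ys \<otimes> \<iota> ?c) \<cdot> split (xs @ ys) zs))
    = merge ys (zs @ xs) \<cdot> ((\<iota> ?b \<otimes> braid xs zs) \<cdot>
      ((\<iota> ?b \<otimes> merge xs zs) \<cdot> (\<alpha> ?b ?a ?c \<cdot> ((\<sigma> ?a ?b \<otimes> \<iota> ?c) \<cdot> ?s))))"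
    using split_merge_assoc[of "(\<sigma> ?a ?b \<otimes> \<iota> ?c) \<cdot> ?s" ys xs zs] by simp
  also have "\<dots> = merge ys (zs @ xs) \<cdot> ((\<iota> ?b \<otimes> merge zs xs) \<cdot>
      (((\<iota> ?b \<otimes> \<sigma> ?a ?c) \<cdot> \<alpha> ?b ?a ?c \<cdot> (\<sigma> ?a ?b \<otimes> \<iota> ?c)) \<cdot> ?s))"
    by (simp add: tarr_comp'')
  also have "\<dots> = merge ys (zs @ xs) \<cdot> ((\<iota> ?b \<otimes> merge zs xs) \<cdot>
      ((\<alpha> ?b ?c ?a \<cdot> \<sigma> ?a (?b \<odot> ?c) \<cdot> \<alpha> ?a ?b ?c) \<cdot> ?s))"
    by (simp only: hexagon T_obj)
  also have "\<dots> = merge ys (zs @ xs) \<cdot> ((\<iota> ?b \<otimes> merge zs xs) \<cdot>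
      (\<alpha> ?b ?c ?a \<cdot> (\<sigma> ?a (?b \<odot> ?c) \<cdot> (\<alpha> ?a ?b ?c \<cdot> ?s))))"
    by simp
  also have "\<alpha> ?a ?b ?c \<cdot> ?s = (\<iota> ?a \<otimes> split ys zs) \<cdot> split xs (ys @ zs)"
    by (rule split_assoc)
  also have "merge ys (zs @ xs) \<cdot> ((\<iota> ?b \<otimes> merge zs xs) \<cdot> (\<alpha> ?b ?c ?a \<cdot>
      (\<sigma> ?a (?b \<odot> ?c) \<cdot> ((\<iota> ?a \<otimes> split ys zs) \<cdot> split xs (ys @ zs)))))
    = (merge ys (zs @ xs) \<cdot> (\<iota> ?b \<otimes> merge zs xs) \<cdot> \<alpha> ?b ?c ?a) \<cdot>
      ((\<sigma> ?a (?b \<odot> ?c) \<cdot> (\<iota> ?a \<otimes> split ys zs)) \<cdot> split xs (ys @ zs))"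
    by simp
  also have "\<sigma> ?a (?b \<odot> ?c) \<cdot> (\<iota> ?a \<otimes> split ys zs) = (split ys zs \<otimes> \<iota> ?a) \<cdot> \<sigma> ?a (T (ys @ zs))"
    using symm_natural'[of "\<iota> ?a" "split ys zs"] by simp
  also have "(merge ys (zs @ xs) \<cdot> (\<iota> ?b \<otimes> merge zs xs) \<cdot> \<alpha> ?b ?c ?a) \<cdot>
      (((split ys zs \<otimes> \<iota> ?a) \<cdot> \<sigma> ?a (T (ys @ zs))) \<cdot> split xs (ys @ zs))
    = braid xs (ys @ zs)"
    unfolding merge_assoc by (simp add: tarr_comp'')
  finally show ?thesis by simp
qed

section \<open>The permutative category of lists\<close>

text \<open>
  \<open>None\<close> is an absorbing error value. It makes composition and tensor associative without any side
  conditions on domains and codomains.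
\<close>

type_synonym ('y, 'n) strict_arr = "('y list \<times> 'n \<times> 'y list) option"

definition sarr :: "('x, 'm) strict_arr \<Rightarrow> bool" where
  "sarr F \<longleftrightarrow> (\<exists>a f b. F = Some (a, f, b) \<and> f \<in> Arr C \<and> Dom C f = T a \<and> Cod C f = T b)"

definition ssrc :: "('x, 'm) strict_arr \<Rightarrow> 'x list" where "ssrc F = fst (the F)"
definition stgt :: "('x, 'm) strict_arr \<Rightarrow> 'x list" where "stgt F = snd (snd (the F))"
definition smor :: "('x, 'm) strict_arr \<Rightarrow> 'm" where "smor F = fst (snd (the F))"

definition scmp :: "('x, 'm) strict_arr \<Rightarrow> ('x, 'm) strict_arr \<Rightarrow> ('x, 'm) strict_arr" where
  "scmp G F = (if sarr G \<and> sarr F \<and> ssrc G = stgt F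
    then Some (ssrc F, smor G \<cdot> smor F, stgt G) else None)"

text \<open>Conjugation by \<open>merge\<close> and \<open>split\<close> turns the endpoints into
  concatenations. Storing the lists keeps apart those with the same value under
  \<open>T\<close>.\<close>

definition sten :: "('x, 'm) strict_arr \<Rightarrow> ('x, 'm) strict_arr \<Rightarrow> ('x, 'm) strict_arr" where
  "sten F G = (if sarr F \<and> sarr G
    then Some (ssrc F @ ssrc G,
      merge (stgt F) (stgt G) \<cdot> ((smor F \<otimes> smor G) \<cdot> split (ssrc F) (ssrc G)), stgt F @ stgt G) else None)"

definition sidn :: "'x list \<Rightarrow> ('x, 'm) strict_arr" where
  "sidn a = Some (a, \<iota> (T a), a)"

definition ssym :: "'x list \<Rightarrow> 'x list \<Rightarrow> ('x, 'm) strict_arr" where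
  "ssym a b = Some (a @ b, braid a b, b @ a)"

lemma strict_simps [simp]:
  "sarr (Some (a, f, b)) \<longleftrightarrow> f \<in> Arr C \<and> Dom C f = T a \<and> Cod C f = T b"
  "\<not> sarr None" "ssrc (Some (a, f, b)) = a" "stgt (Some (a, f, b)) = b" "smor (Some (a, f, b)) = f"
  by (simp_all add: sarr_def ssrc_def stgt_def smor_def)

lemma smor_arr [simp]:
  "sarr F \<Longrightarrow> smor F \<in> Arr C" "sarr F \<Longrightarrow> Dom C (smor F) = T (ssrc F)" "sarr F \<Longrightarrow> Cod C (smor F) = T (stgt F)"
  by (auto simp: sarr_def)

lemma strict_eqI:
  "sarr F \<Longrightarrow> sarr G \<Longrightarrow> ssrc F = ssrc G \<Longrightarrow> stgt F = stgt G \<Longrightarrow> smor F = smor G \<Longrightarrow> F = G"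
  by (auto simp: sarr_def)

lemma strict_eqI_None:
  assumes "sarr F \<longleftrightarrow> sarr G" "F = None \<or> sarr F" "G = None \<or> sarr G"
    and "sarr F \<Longrightarrow> ssrc F = ssrc G \<and> stgt F = stgt G \<and> smor F = smor G"
  shows "F = G"
  using assms strict_eqI by metis

lemma scmp_arr [simp]:
  "sarr (scmp G F) \<longleftrightarrow> sarr G \<and> sarr F \<and> ssrc G = stgt F"
  "sarr G \<Longrightarrow> sarr F \<Longrightarrow> ssrc G = stgt F \<Longrightarrow> ssrc (scmp G F) = ssrc F"
  "sarr G \<Longrightarrow> sarr F \<Longrightarrow> ssrc G = stgt F \<Longrightarrow> stgt (scmp G F) = stgt G"
  "sarr G \<Longrightarrow> sarr F \<Longrightarrow> ssrc G = stgt F \<Longrightarrow> smor (scmp G F) = smor G \<cdot> smor F"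
  by (simp_all add: scmp_def)

lemma sten_arr [simp]:
  "sarr (sten F G) \<longleftrightarrow> sarr F \<and> sarr G"
  "sarr F \<Longrightarrow> sarr G \<Longrightarrow> ssrc (sten F G) = ssrc F @ ssrc G"
  "sarr F \<Longrightarrow> sarr G \<Longrightarrow> stgt (sten F G) = stgt F @ stgt G"
  "sarr F \<Longrightarrow> sarr G \<Longrightarrow>
    smor (sten F G) = merge (stgt F) (stgt G) \<cdot> ((smor F \<otimes> smor G) \<cdot> split (ssrc F) (ssrc G))"
  by (simp_all add: sten_def)

lemma sidn_arr [simp]: "sarr (sidn a)" "ssrc (sidn a) = a" "stgt (sidn a) = a" "smor (sidn a) = \<iota> (T a)"
  by (simp_all add: sidn_def)

lemma ssym_arr [simp]:
  "sarr (ssym a b)" "ssrc (ssym a b) = a @ b" "stgt (ssym a b) = b @ a" "smor (ssym a b) = braid a b"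
  by (simp_all add: ssym_def)

lemma strict_None: "scmp G F = None \<or> sarr (scmp G F)" "sten G F = None \<or> sarr (sten G F)"
  by (simp_all add: scmp_def sten_def)

text \<open>Associativity of the tensor comes from \<open>merge_assoc\<close>, the unit laws from
  naturality of the unitors, and the hexagon from \<open>braid_append\<close>.\<close>

sublocale strict: permutative sarr ssrc stgt scmp sten sidn ssym
proof
  fix F G H :: "('x, 'm) strict_arr"
  show "scmp (scmp H G) F = scmp H (scmp G F)"
  proof (rule strict_eqI_None)
    show "sarr (scmp (scmp H G) F) \<longleftrightarrow> sarr (scmp H (scmp G F))"
      by (simp add: conj_commute conj_left_commute cong: conj_cong)
    assume "sarr (scmp (scmp H G) F)"
    then show "ssrc (scmp (scmp H G) F) = ssrc (scmp H (scmp G F)) \<and>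
        stgt (scmp (scmp H G) F) = stgt (scmp H (scmp G F)) \<and>
        smor (scmp (scmp H G) F) = smor (scmp H (scmp G F))"
      by (auto cong: conj_cong)
  qed (rule strict_None)+
  show "sten (sten F G) H = sten F (sten G H)"
  proof (rule strict_eqI_None)
    show "sarr (sten (sten F G) H) \<longleftrightarrow> sarr (sten F (sten G H))" by simp
    assume "sarr (sten (sten F G) H)"
    then have [simp]: "sarr F" "sarr G" "sarr H" by simp_all
    let ?f = "smor F" and ?g = "smor G" and ?h = "smor H"
    let ?s = "(split (ssrc F) (ssrc G) \<otimes> \<iota> (T (ssrc H))) \<cdot> split (ssrc F @ ssrc G) (ssrc H)"
    let ?a = "stgt F" and ?b = "stgt G" and ?c = "stgt H"
    have "smor (sten (sten F G) H) = (merge (?a @ ?b) ?c \<cdot> (merge ?a ?b \<otimes> \<iota> (T ?c))) \<cdot> (((?f \<otimes> ?g) \<otimes> ?h) \<cdot> ?s)"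
      by (simp add: tarr_comp'')
    also have "\<dots> = merge ?a (?b @ ?c) \<cdot> ((\<iota> (T ?a) \<otimes> merge ?b ?c) \<cdot>
        ((\<alpha> (T ?a) (T ?b) (T ?c) \<cdot> ((?f \<otimes> ?g) \<otimes> ?h)) \<cdot> ?s))"
      unfolding merge_assoc[symmetric] by simp
    also have "\<alpha> (T ?a) (T ?b) (T ?c) \<cdot> ((?f \<otimes> ?g) \<otimes> ?h)
        = (?f \<otimes> ?g \<otimes> ?h) \<cdot> \<alpha> (T (ssrc F)) (T (ssrc G)) (T (ssrc H))"
      using assoc_natural'[of ?f ?g ?h] by simp
    also have "\<dots> \<cdot> ?s = (?f \<otimes> ?g \<otimes> ?h) \<cdot> ((\<iota> (T (ssrc F)) \<otimes> split (ssrc G) (ssrc H)) \<cdot> split (ssrc F) (ssrc G @ ssrc H))"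
      using split_assoc[of "ssrc F" "ssrc G" "ssrc H"] by simp
    also have "merge ?a (?b @ ?c) \<cdot> ((\<iota> (T ?a) \<otimes> merge ?b ?c) \<cdot> \<dots>) = smor (sten F (sten G H))"
      by (simp add: tarr_comp'')
    finally show "ssrc (sten (sten F G) H) = ssrc (sten F (sten G H)) \<and>
        stgt (sten (sten F G) H) = stgt (sten F (sten G H)) \<and> smor (sten (sten F G) H) = smor (sten F (sten G H))"
      by simp
  qed (rule strict_None)+
next
  fix F :: "('x, 'm) strict_arr"
  assume [simp]: "sarr F"
  show "sten F (sidn []) = F"
  proof (rule strict_eqI)
    have "smor (sten F (sidn [])) = (\<rho> (T (stgt F)) \<cdot> (smor F \<otimes> \<iota> \<I>)) \<cdot> split (ssrc F) []"
      using arr_merge[of "stgt F" "[]"] arr_split[of "ssrc F" "[]"] by (simp add: merge_Nil_right)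
    also have "\<rho> (T (stgt F)) \<cdot> (smor F \<otimes> \<iota> \<I>) = smor F \<cdot> merge (ssrc F) []"
      using runit_natural'[of "smor F"] by (simp add: merge_Nil_right)
    finally show "smor (sten F (sidn [])) = smor F"
      using arr_merge[of "ssrc F" "[]"] arr_split[of "ssrc F" "[]"] by simp
  qed simp_all
  show "sten (sidn []) F = F"
  proof (rule strict_eqI)
    have "smor (sten (sidn []) F) = (\<eta> (T (stgt F)) \<cdot> (\<iota> \<I> \<otimes> smor F)) \<cdot> split [] (ssrc F)"
      using arr_split[of "[]" "ssrc F"] by (simp del: split.simps)
    also have "\<eta> (T (stgt F)) \<cdot> (\<iota> \<I> \<otimes> smor F) = smor F \<cdot> merge [] (ssrc F)"
      using lunit_natural'[of "smor F"] by simp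
    finally show "smor (sten (sidn []) F) = smor F"
      using arr_merge[of "[]" "ssrc F"] arr_split[of "[]" "ssrc F"]
      by (simp del: split.simps merge.simps)
  qed simp_all
next
  fix F G F' G' :: "('x, 'm) strict_arr"
  assume [simp]: "sarr G" "sarr F" "ssrc G = stgt F" "sarr G'" "sarr F'" "ssrc G' = stgt F'"
  show "scmp (sten G G') (sten F F') = sten (scmp G F) (scmp G' F')"
    by (rule strict_eqI) (simp_all add: tarr_comp'')
next
  fix F G :: "('x, 'm) strict_arr"
  assume [simp]: "sarr F" "sarr G"
  show "scmp (ssym (stgt F) (stgt G)) (sten F G) = scmp (sten G F) (ssym (ssrc F) (ssrc G))"
  proof (rule strict_eqI)
    have "smor (scmp (ssym (stgt F) (stgt G)) (sten F G))
      = merge (stgt G) (stgt F) \<cdot> ((\<sigma> (T (stgt F)) (T (stgt G)) \<cdot> (smor F \<otimes> smor G)) \<cdot> split (ssrc F) (ssrc G))"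
      by simp
    also have "\<sigma> (T (stgt F)) (T (stgt G)) \<cdot> (smor F \<otimes> smor G) = (smor G \<otimes> smor F) \<cdot> \<sigma> (T (ssrc F)) (T (ssrc G))"
      using symm_natural'[of "smor F" "smor G"] by simp
    finally show "smor (scmp (ssym (stgt F) (stgt G)) (sten F G)) = smor (scmp (sten G F) (ssym (ssrc F) (ssrc G)))"
      by simp
  qed simp_all
next
  fix a b c :: "'x list"
  show "sten (sidn a) (sidn b) = sidn (a @ b)"
    by (rule strict_eqI) simp_all
  show "scmp (ssym b a) (ssym a b) = sidn (a @ b)"
  proof (rule strict_eqI)
    have "smor (scmp (ssym b a) (ssym a b)) = merge a b \<cdot> ((\<sigma> (T b) (T a) \<cdot> \<sigma> (T a) (T b)) \<cdot> split a b)"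
      by simp
    then show "smor (scmp (ssym b a) (ssym a b)) = smor (sidn (a @ b))"
      by (simp add: symm_inverse)
  qed simp_all
  show "ssym a (b @ c) = scmp (sten (sidn b) (ssym a c)) (sten (ssym a b) (sidn c))"
    by (rule strict_eqI) (simp_all add: braid_append)
qed (auto intro: strict_eqI)

section \<open>Arrows between short lists\<close>

abbreviation rinv :: "'o \<Rightarrow> 'm" where
  "rinv a \<equiv> inv_arr C (\<rho> a)"

lemma rinv_arr [simp]:
  assumes "a \<in> Obj C"
  shows "rinv a \<in> Arr C" "Dom C (rinv a) = a" "Cod C (rinv a) = a \<odot> \<I>"
    "rinv a \<cdot> \<rho> a = \<iota> (a \<odot> \<I>)" "\<rho> a \<cdot> rinv a = \<iota> a"
  using inverse_arrsD[OF inverse_runit[OF assms]] assms by simp_all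

lemma rinv_cancel [simp]:
  assumes "a \<in> Obj C" "f \<in> Arr C"
  shows "Cod C f = a \<odot> \<I> \<Longrightarrow> rinv a \<cdot> (\<rho> a \<cdot> f) = f" "Cod C f = a \<Longrightarrow> \<rho> a \<cdot> (rinv a \<cdot> f) = f"
  using comp_assoc'[of "rinv a" "\<rho> a" f] comp_assoc'[of "\<rho> a" "rinv a" f] assms by simp_all

lemma inverse_arrs_rinv: "a \<in> Obj C \<Longrightarrow> inverse_arrs C (rinv a) (\<rho> a)"
  using inverse_arrs_sym inverse_runit by blast

lemma merge_single: "merge [x] ys = \<rho> (ob x) \<otimes> \<iota> (T ys)"
  by (simp add: triangle)

lemma split_single: "split [x] ys = rinv (ob x) \<otimes> \<iota> (T ys)"
proof (rule inverse_arrs_unique[OF merge_split])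
  show "inverse_arrs C (merge [x] ys) (rinv (ob x) \<otimes> \<iota> (T ys))"
    unfolding merge_single by (intro inverse_arrs_tarr inverse_runit inverse_arrs_ident) simp_all
qed

lemma merge_two: "merge [x, y] zs = \<alpha> (ob x) (ob y) (T zs) \<cdot> ((\<iota> (ob x) \<otimes> \<rho> (ob y)) \<otimes> \<iota> (T zs))"
  using assoc_natural'[of "\<iota> (ob x)" "\<rho> (ob y)" "\<iota> (T zs)"] merge_single[of y zs] by simp

lemma split_two:
  "split [x, y] zs = ((\<iota> (ob x) \<otimes> rinv (ob y)) \<otimes> \<iota> (T zs)) \<cdot> inv_arr C (\<alpha> (ob x) (ob y) (T zs))"
proof (rule inverse_arrs_unique[OF merge_split])
  show "inverse_arrs C (merge [x, y] zs) (((\<iota> (ob x) \<otimes> rinv (ob y)) \<otimes> \<iota> (T zs)) \<cdot> inv_arr C (\<alpha> (ob x) (ob y) (T zs)))"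
    unfolding merge_two
    by (intro inverse_arrs_comp inverse_arrs_tarr inverse_runit inverse_arrs_ident inverse_assoc) simp_all
qed

lemma inv_assoc_arr [simp]:
  assumes "a \<in> Obj C" "b \<in> Obj C" "c \<in> Obj C"
  shows "inv_arr C (\<alpha> a b c) \<in> Arr C" "Dom C (inv_arr C (\<alpha> a b c)) = a \<odot> b \<odot> c"
    "Cod C (inv_arr C (\<alpha> a b c)) = (a \<odot> b) \<odot> c"
  using inverse_arrsD[OF inverse_assoc[OF assms]] assms by simp_all

text \<open>The unitors of the singleton cancel, so padding by one entry is plain tensoring, as in
  the recursive clause of \<open>swap_ctx\<close>.\<close>

lemma sten_sidn_single:
  assumes "sarr F"
  shows "smor (sten (sidn [x]) F) = \<iota> (ob x) \<otimes> smor F"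
  using assms by (simp add: merge_single split_single tarr_comp'' tarr_comp' del: merge.simps split.simps)

text \<open>Naturality draws the trailing units of the singletons out of the braiding, leaving the
  symmetry of the two objects.\<close>

lemma braid_single: "braid [y] [x] = (\<iota> (ob x) \<otimes> rinv (ob y)) \<cdot> (\<sigma> (ob y) (ob x) \<cdot> (\<iota> (ob y) \<otimes> \<rho> (ob x)))"
proof -
  have "braid [y] [x] = (\<rho> (ob x) \<otimes> \<iota> (ob y \<odot> \<I>)) \<cdot> (\<sigma> (ob y \<odot> \<I>) (ob x \<odot> \<I>) \<cdot> (rinv (ob y) \<otimes> \<iota> (ob x \<odot> \<I>)))"
    by (simp add: merge_single split_single del: merge.simps split.simps)
  also have "rinv (ob y) \<otimes> \<iota> (ob x \<odot> \<I>) = (rinv (ob y) \<otimes> rinv (ob x)) \<cdot> (\<iota> (ob y) \<otimes> \<rho> (ob x))"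
    by (simp add: tarr_comp' del: tarr_ident)
  also have "\<sigma> (ob y \<odot> \<I>) (ob x \<odot> \<I>) \<cdot> \<dots>
    = (\<sigma> (ob y \<odot> \<I>) (ob x \<odot> \<I>) \<cdot> (rinv (ob y) \<otimes> rinv (ob x))) \<cdot> (\<iota> (ob y) \<otimes> \<rho> (ob x))"
    by simp
  also have "\<sigma> (ob y \<odot> \<I>) (ob x \<odot> \<I>) \<cdot> (rinv (ob y) \<otimes> rinv (ob x)) = (rinv (ob x) \<otimes> rinv (ob y)) \<cdot> \<sigma> (ob y) (ob x)"
    using symm_natural'[of "rinv (ob y)" "rinv (ob x)"] by simp
  finally show ?thesis by (simp add: tarr_comp'' del: tarr_ident)
qed

text \<open>This is the base clause of \<open>swap_ctx\<close>, so the exchange rule is interpreted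
  by a symmetry of the strict category.\<close>

lemma smor_swap:
  "smor (sten (ssym [y] [x]) (sidn zs)) =
    \<alpha> (ob x) (ob y) (T zs) \<cdot> ((\<sigma> (ob y) (ob x) \<otimes> \<iota> (T zs)) \<cdot> inv_arr C (\<alpha> (ob y) (ob x) (T zs)))"
proof -
  have "smor (sten (ssym [y] [x]) (sidn zs)) = merge [x, y] zs \<cdot> ((braid [y] [x] \<otimes> \<iota> (T zs)) \<cdot> split [y, x] zs)"
    by (simp del: merge.simps split.simps)
  also have "\<dots> = \<alpha> (ob x) (ob y) (T zs) \<cdot> ((\<sigma> (ob y) (ob x) \<otimes> \<iota> (T zs)) \<cdot> inv_arr C (\<alpha> (ob y) (ob x) (T zs)))"
    unfolding braid_single merge_two split_two by (simp add: tarr_comp'' tarr_comp')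
  finally show ?thesis .
qed

text \<open>The singleton list denotes \<open>ob x \<odot> \<I>\<close> rather than \<open>ob x\<close>, whence the right unitor.\<close>

definition lift :: "'x list \<Rightarrow> 'x \<Rightarrow> 'm \<Rightarrow> ('x, 'm) strict_arr" where
  "lift a x f = Some (a, rinv (ob x) \<cdot> f, [x])"

lemma lift_arr [simp]:
  assumes "f \<in> Arr C" "Dom C f = T a" "Cod C f = ob x"
  shows "sarr (lift a x f)"
  using assms by (simp add: lift_def)

lemma lift_simps [simp]: "ssrc (lift a x f) = a" "stgt (lift a x f) = [x]" "smor (lift a x f) = rinv (ob x) \<cdot> f"
  by (simp_all add: lift_def)

text \<open>The \<open>\<rho>\<close> in \<open>merge_single\<close> cancels the inverse unitor
  stored in \<open>lift\<close>; what remains is the bare tensor found in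
  \<open>interp\<close>.\<close>

lemma smor_lift_ten:
  assumes "f \<in> Arr C" "Dom C f = T a" "Cod C f = ob x" "sarr G"
  shows "smor (sten (lift a x f) G) = (f \<otimes> smor G) \<cdot> split a (ssrc G)"
  using assms by (simp add: merge_single tarr_comp'' del: merge.simps split.simps)

end

section \<open>Categorical models\<close>

context categorical_model begin

lemma ty_obj_Obj: "ty_obj M A \<in> Obj M"
  by (induction A) (simp_all add: qobj_obj)

sublocale monoidal_family M "ty_obj M"
  by unfold_locales (rule ty_obj_Obj)

lemma ctx_obj_T: "ctx_obj M \<Gamma> = T (map snd \<Gamma>)"
  by (induction \<Gamma>) auto

lemma split_ctx_split: "split_ctx M \<Gamma> \<Delta> = split (map snd \<Gamma>) (map snd \<Delta>)"
  by (induction \<Gamma>) (auto simp: ctx_obj_T)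

text \<open>\<open>[]\<close> stands for \<open>\<I>\<close> and \<open>[TUnit]\<close> for
  \<open>\<I> \<odot> \<I>\<close>, hence the right unitor. For objects \<open>X\<close>,
  \<open>Y\<close> of \<open>A\<close>, \<open>B\<close>, the lists in \<open>mpair\<close> stand
  for \<open>X \<odot> (Y \<odot> \<I>)\<close> and \<open>(X \<odot> Y) \<odot> \<I>\<close>: the
  inner unit is dropped and an outer one added.\<close>

definition "munit = Some ([], rinv \<I>, [TUnit])"
definition "mununit = Some ([TUnit], \<rho> \<I>, [])"

definition "mpair A B = Some ([A, B], rinv (ty_obj M (TTensor A B)) \<cdot> (\<iota> (ty_obj M A) \<otimes> \<rho> (ty_obj M B)), [TTensor A B])"

definition "munpair A B =
  Some ([TTensor A B], (\<iota> (ty_obj M A) \<otimes> rinv (ty_obj M B)) \<cdot> \<rho> (ty_obj M (TTensor A B)), [A, B])"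

lemma munit_arr [simp]: "sarr munit" "ssrc munit = []" "stgt munit = [TUnit]" "smor munit = rinv \<I>"
  by (simp_all add: munit_def)

lemma mununit_arr [simp]: "sarr mununit" "ssrc mununit = [TUnit]" "stgt mununit = []" "smor mununit = \<rho> \<I>"
  by (simp_all add: mununit_def)

lemma mpair_arr [simp]: "sarr (mpair A B)" "ssrc (mpair A B) = [A, B]" "stgt (mpair A B) = [TTensor A B]"
  "smor (mpair A B) = rinv (ty_obj M (TTensor A B)) \<cdot> (\<iota> (ty_obj M A) \<otimes> \<rho> (ty_obj M B))"
  by (simp_all add: mpair_def)

lemma munpair_arr [simp]: "sarr (munpair A B)" "ssrc (munpair A B) = [TTensor A B]" "stgt (munpair A B) = [A, B]"
  "smor (munpair A B) = (\<iota> (ty_obj M A) \<otimes> rinv (ty_obj M B)) \<cdot> \<rho> (ty_obj M (TTensor A B))"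
  by (simp_all add: munpair_def)

text \<open>Drops the trailing unit of \<open>T (map TQubit qs)\<close>, since the tensor in
  \<open>qubits_ty\<close> ends in its last qubit; the empty tensor is already
  \<open>\<I>\<close>.\<close>

fun gather :: "'q list \<Rightarrow> 'm" where
  "gather [] = \<iota> \<I>"
| "gather [q] = \<rho> (qobj M q)"
| "gather (q # r # qs) = \<iota> (qobj M q) \<otimes> gather (r # qs)"

lemma gather_arr [simp]:
  "gather qs \<in> Arr M" "Dom M (gather qs) = T (map TQubit qs)" "Cod M (gather qs) = ty_obj M (qubits_ty qs)"
  by (induction qs rule: gather.induct) (simp_all add: qobj_obj)

lemma tens_objs_qubits: "tens_objs M (map (qobj M) qs) = ty_obj M (qubits_ty qs)"
  by (induction qs rule: gather.induct) simp_all

lemma garr_arr [simp]: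
  "garr M G \<in> Arr M" "Dom M (garr M G) = ty_obj M (qubits_ty (acts G))" "Cod M (garr M G) = ty_obj M (qubits_ty (acts G))"
  using homD[OF garr_hom[of G]] by (simp_all add: tens_objs_qubits)

abbreviation "mgate G \<equiv> lift (map TQubit (acts G)) (qubits_ty (acts G)) (garr M G \<cdot> gather (acts G))"

sublocale lang: plain_semantics sarr ssrc stgt scmp sten sidn ssym acts munit mununit mpair munpair mgate
proof
  show "scmp mununit munit = sidn []" "scmp munit mununit = sidn [TUnit]"
    by (rule strict_eqI; simp)+
  fix A B :: "'q ty"
  show "scmp (munpair A B) (mpair A B) = sidn [A, B]" "scmp (mpair A B) (munpair A B) = sidn [TTensor A B]"
    by (rule strict_eqI; simp add: tarr_comp'' tarr_comp')+
qed simp_all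

lemma smor_swap_ctx:
  "smor (sten (sidn (map snd \<Gamma>)) (sten (ssym [B] [A]) (sidn (map snd \<Delta>)))) = swap_ctx M \<Gamma> A B \<Delta>"
proof (induction \<Gamma>)
  case Nil
  then show ?case by (simp add: smor_swap ctx_obj_T del: sten_arr(4))
next
  case (Cons z \<Gamma>)
  let ?X = "sten (sidn (map snd \<Gamma>)) (sten (ssym [B] [A]) (sidn (map snd \<Delta>)))"
  have "sten (sidn (map snd (z # \<Gamma>))) (sten (ssym [B] [A]) (sidn (map snd \<Delta>))) = sten (sidn [snd z]) ?X"
    using strict.idn_ten[of "[snd z]" "map snd \<Gamma>"] by (simp flip: strict.ten_assoc)
  moreover have "smor (sten (sidn [snd z]) ?X) = \<iota> (ty_obj M (snd z)) \<otimes> smor ?X"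
    by (rule sten_sidn_single) simp
  ultimately have "smor (sten (sidn (map snd (z # \<Gamma>))) (sten (ssym [B] [A]) (sidn (map snd \<Delta>))))
      = \<iota> (ty_obj M (snd z)) \<otimes> swap_ctx M \<Gamma> A B \<Delta>"
    by (simp only: Cons.IH)
  then show ?case by (cases z) simp
qed

section \<open>Agreement of the interpretation with \<open>sem\<close>\<close>

lemma split_ctxs_arr [simp]:
  "split_ctxs M \<Gamma>s \<in> Arr M" "Dom M (split_ctxs M \<Gamma>s) = T (map snd (concat \<Gamma>s))"
  "Cod M (split_ctxs M \<Gamma>s) = tens_objs M (map (ctx_obj M) \<Gamma>s)"
  by (induction \<Gamma>s rule: induct_list012) (simp_all add: ctx_obj_T split_ctx_split)

lemma tens_arrs_arr:
  "\<forall>d \<in> set ds. d \<in> Arr M \<Longrightarrow> tens_arrs M ds \<in> Arr M \<and>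
    Dom M (tens_arrs M ds) = tens_objs M (map (Dom M) ds) \<and> Cod M (tens_arrs M ds) = tens_objs M (map (Cod M) ds)"
  by (induction ds rule: induct_list012) simp_all

text \<open>Gate arguments collected in the strict category carry a unit at the end, whereas
  \<open>tens_arrs\<close> and \<open>split_ctxs\<close> produce none; \<open>gather\<close> makes
  up the difference. The cases of no, one and several qubits follow the recursion that these
  functions share.\<close>

lemma sems_gather:
  assumes "length \<Gamma>s = length qs" "length ds = length qs" "length ts = length qs"
    and "\<And>i. i < length qs \<Longrightarrow> ds ! i \<in> Arr M \<and> Dom M (ds ! i) = T (map snd (\<Gamma>s ! i)) \<and> Cod M (ds ! i) = qobj M (qs ! i)"
    and "\<And>i. i < length qs \<Longrightarrow> lang.sem (\<Gamma>s ! i) (ts ! i) (TQubit (qs ! i)) (lift (map snd (\<Gamma>s ! i)) (TQubit (qs ! i)) (ds ! i))"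
  shows "\<exists>F. lang.sems (concat \<Gamma>s) ts (map TQubit qs) F \<and> gather qs \<cdot> smor F = tens_arrs M ds \<cdot> split_ctxs M \<Gamma>s"
  using assms
proof (induction qs arbitrary: \<Gamma>s ds ts rule: gather.induct)
  case 1
  then show ?case by (auto intro!: exI[of _ "sidn []"] lang.sem_sems.Nil)
next
  case (2 q)
  then obtain \<Gamma> d t where [simp]: "\<Gamma>s = [\<Gamma>]" "ds = [d]" "ts = [t]"
    by (auto simp: length_Suc_conv)
  have "lang.sems (concat \<Gamma>s) ts (map TQubit [q]) (lift (map snd \<Gamma>) (TQubit q) d)"
    using 2(5)[of 0] by (simp add: lang.sems_single)
  moreover have "\<rho> (qobj M q) \<cdot> (rinv (qobj M q) \<cdot> d) = d \<cdot> \<iota> (ctx_obj M \<Gamma>)"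
    using 2(4)[of 0] by (simp add: qobj_obj ctx_obj_T)
  ultimately show ?case by (intro exI[of _ "lift (map snd \<Gamma>) (TQubit q) d"]) simp
next
  case (3 q r qs)
  then obtain \<Gamma> \<Gamma>' \<Gamma>s0 d d' ds0 t ts0 where [simp]: "\<Gamma>s = \<Gamma> # \<Gamma>' # \<Gamma>s0" "ds = d # d' # ds0" "ts = t # ts0"
    by (auto simp: length_Suc_conv)
  have "\<exists>F. lang.sems (concat (\<Gamma>' # \<Gamma>s0)) ts0 (map TQubit (r # qs)) F \<and>
      gather (r # qs) \<cdot> smor F = tens_arrs M (d' # ds0) \<cdot> split_ctxs M (\<Gamma>' # \<Gamma>s0)"
    by (rule "3.IH") (use 3(2-4) 3(5,6)[of "Suc _"] in simp_all)
  then obtain F where F: "lang.sems (concat (\<Gamma>' # \<Gamma>s0)) ts0 (map TQubit (r # qs)) F"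
    "gather (r # qs) \<cdot> smor F = tens_arrs M (d' # ds0) \<cdot> split_ctxs M (\<Gamma>' # \<Gamma>s0)" by blast
  have d: "d \<in> Arr M" "Dom M d = T (map snd \<Gamma>)" "Cod M d = qobj M q"
    using 3(5)[of 0] by simp_all
  let ?G = "sten (lift (map snd \<Gamma>) (TQubit q) d) F"
  have arr: "sarr F" "ssrc F = map snd (concat (\<Gamma>' # \<Gamma>s0))" "stgt F = map TQubit (r # qs)"
    using lang.sems_arr[OF F(1)] by simp_all
  have "\<forall>d \<in> set (d' # ds0). d \<in> Arr M" "map (Dom M) (d' # ds0) = map (ctx_obj M) (\<Gamma>' # \<Gamma>s0)"
  proof -
    have l: "length (d' # ds0) = length (r # qs)" "length (\<Gamma>' # \<Gamma>s0) = length (r # qs)" using 3(2,3) by simp_all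
    have *: "(d' # ds0) ! i \<in> Arr M \<and> Dom M ((d' # ds0) ! i) = ctx_obj M ((\<Gamma>' # \<Gamma>s0) ! i)" if "i < length (r # qs)" for i
      using 3(5)[of "Suc i"] that by (simp add: ctx_obj_T)
    show "\<forall>d \<in> set (d' # ds0). d \<in> Arr M" unfolding all_set_conv_all_nth l using * by blast
    show "map (Dom M) (d' # ds0) = map (ctx_obj M) (\<Gamma>' # \<Gamma>s0)"
      by (rule nth_equalityI) (use l * in \<open>simp_all del: list.map nth_Cons_Suc nth_Cons_0\<close>)
  qed
  then have tens: "tens_arrs M (d' # ds0) \<in> Arr M"
    "Dom M (tens_arrs M (d' # ds0)) = tens_objs M (map (ctx_obj M) (\<Gamma>' # \<Gamma>s0))"
    using tens_arrs_arr[of "d' # ds0"] by simp_all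
  have "lang.sems (concat \<Gamma>s) ts (map TQubit (q # r # qs)) ?G"
    using lang.sem_sems.Cons[OF _ F(1)] 3(6)[of 0] by simp
  moreover have "gather (q # r # qs) \<cdot> smor ?G = tens_arrs M ds \<cdot> split_ctxs M \<Gamma>s"
  proof -
    let ?s = "split (map snd \<Gamma>) (map snd (concat (\<Gamma>' # \<Gamma>s0)))"
    have "gather (q # r # qs) \<cdot> smor ?G = (\<iota> (qobj M q) \<otimes> gather (r # qs)) \<cdot> ((d \<otimes> smor F) \<cdot> ?s)"
      using d arr by (subst smor_lift_ten) simp_all
    also have "\<dots> = (d \<otimes> (gather (r # qs) \<cdot> smor F)) \<cdot> ?s"
      using d arr by (subst tarr_comp'') (simp_all add: qobj_obj)
    also have "\<dots> = (d \<otimes> tens_arrs M (d' # ds0)) \<cdot> ((\<iota> (ctx_obj M \<Gamma>) \<otimes> split_ctxs M (\<Gamma>' # \<Gamma>s0)) \<cdot> ?s)"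
      unfolding F(2) using d tens split_ctxs_arr[of "\<Gamma>' # \<Gamma>s0"]
      by (subst tarr_comp'') (simp_all add: ctx_obj_T del: tens_arrs.simps split_ctxs.simps)
    finally show ?thesis by (simp add: split_ctx_split)
  qed
  ultimately show ?case by blast
qed

text \<open>For each rule the lifted arrow is the one that \<open>sem\<close> builds. The endpoints
  are proved alongside because composition in the strict category yields the error value unless they
  match.\<close>

lemma derives_sem:
  "derives acts D \<Gamma> t A \<Longrightarrow> interp M D \<in> Arr M \<and> Dom M (interp M D) = T (map snd \<Gamma>) \<and>
    Cod M (interp M D) = ty_obj M A \<and> lang.sem \<Gamma> t A (lift (map snd \<Gamma>) A (interp M D))"
proof (induction rule: derives.induct)
  case (Swap D \<Gamma> x A y B \<Delta> t C)
  let ?\<Gamma> = "\<Gamma> @ (y, B) # (x, A) # \<Delta>" and ?\<Gamma>' = "\<Gamma> @ (x, A) # (y, B) # \<Delta>"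
  let ?s = "sten (sidn (map snd \<Gamma>)) (sten (ssym [B] [A]) (sidn (map snd \<Delta>)))"
  have m: "mset ?\<Gamma> = mset ?\<Gamma>'" by simp
  have s: "lang.sem ?\<Gamma>' t C (lift (map snd ?\<Gamma>') C (interp M D))" using Swap by blast
  have "wf_ctx ?\<Gamma>" using lang.sem_wf[OF s] wf_ctx_mset[OF m] by blast
  from lang.perm_swap_ctx[OF this] lang.sem_perm[OF s m]
  have "lang.sem ?\<Gamma> t C (scmp (lift (map snd ?\<Gamma>') C (interp M D)) ?s)" by simp
  moreover have mor: "swap_ctx M \<Gamma> A B \<Delta> \<in> Arr M" "Dom M (swap_ctx M \<Gamma> A B \<Delta>) = T (map snd ?\<Gamma>)"
    "Cod M (swap_ctx M \<Gamma> A B \<Delta>) = T (map snd ?\<Gamma>')"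
    using smor_arr[of ?s] by (simp_all add: smor_swap_ctx del: sten_arr(4))
  moreover have "scmp (lift (map snd ?\<Gamma>') C (interp M D)) ?s = lift (map snd ?\<Gamma>) C (interp M D \<cdot> swap_ctx M \<Gamma> A B \<Delta>)"
    by (rule strict_eqI) (use Swap mor in \<open>simp_all add: smor_swap_ctx del: sten_arr(4)\<close>)
  ultimately show ?case using Swap by simp
next
  case (Var x A)
  \<comment> \<open>\<open>[A]\<close> carries a trailing unit, so the unitor that interprets a
    variable lifts to an identity.\<close>
  have "lift [A] A (\<rho> (ty_obj M A)) = sidn [A]" by (rule strict_eqI) simp_all
  then show ?case using lang.sem_sems.Var[of x A] by simp
next
  case UnitI
  have "lift [] TUnit (\<iota> \<I>) = munit" by (rule strict_eqI) simp_all
  then show ?case using lang.sem_Star by simp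
next
  case (UnitE D \<Gamma> s E \<Delta> t A)
  let ?d = "interp M D" and ?e = "interp M E"
  have [simp]: "?d \<in> Arr M" "Dom M ?d = T (map snd \<Gamma>)" "Cod M ?d = \<I>"
    "?e \<in> Arr M" "Dom M ?e = T (map snd \<Delta>)" "Cod M ?e = ty_obj M A" using UnitE by simp_all
  have "scmp (lift (map snd \<Delta>) A ?e) (sten (scmp mununit (lift (map snd \<Gamma>) TUnit ?d)) (sidn (map snd \<Delta>)))
      = lift (map snd (\<Gamma> @ \<Delta>)) A (interp M (DUnitE \<Gamma> \<Delta> A D E))" (is "?l = ?r")
  proof (rule strict_eqI)
    let ?s = "split (map snd \<Gamma>) (map snd \<Delta>)"
    have "smor ?l = rinv (ty_obj M A) \<cdot> ((?e \<cdot> \<eta> (T (map snd \<Delta>))) \<cdot> ((?d \<otimes> \<iota> (T (map snd \<Delta>))) \<cdot> ?s))"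
      by simp
    \<comment> \<open>\<open>sem\<close> removes the unit before the body acts and
      \<open>interp\<close> afterwards; naturality of \<open>\<eta>\<close> identifies the
      two.\<close>
    also have "?e \<cdot> \<eta> (T (map snd \<Delta>)) = \<eta> (ty_obj M A) \<cdot> (\<iota> \<I> \<otimes> ?e)"
      using lunit_natural'[of ?e] by simp
    finally show "smor ?l = smor ?r" by (simp add: split_ctx_split tarr_comp'')
  qed (simp_all add: split_ctx_split)
  moreover have "lang.sem \<Gamma> s TUnit (lift (map snd \<Gamma>) TUnit ?d)" "lang.sem \<Delta> t A (lift (map snd \<Delta>) A ?e)"
    using UnitE by blast+
  note lang.sem_Unit_let[OF this \<open>wf_ctx (\<Gamma> @ \<Delta>)\<close>]
  ultimately show ?case by (simp add: split_ctx_split)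
next
  case (Gate \<Gamma>s G Ds ts)
  let ?A = "qubits_ty (acts G)" and ?\<Gamma> = "map snd (concat \<Gamma>s)"
  let ?f = "interp M (DGate G \<Gamma>s Ds)"
  have "\<exists>F. lang.sems (concat \<Gamma>s) ts (map TQubit (acts G)) F \<and>
      gather (acts G) \<cdot> smor F = tens_arrs M (map (interp M) Ds) \<cdot> split_ctxs M \<Gamma>s"
    by (rule sems_gather) (use Gate in simp_all)
  then obtain F where F: "lang.sems (concat \<Gamma>s) ts (map TQubit (acts G)) F"
    "gather (acts G) \<cdot> smor F = tens_arrs M (map (interp M) Ds) \<cdot> split_ctxs M \<Gamma>s" by blast
  have arr: "sarr F" "ssrc F = ?\<Gamma>" "stgt F = map TQubit (acts G)"
    using lang.sems_arr[OF F(1)] by simp_all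
  let ?ds = "map (interp M) Ds"
  have *: "?ds ! i \<in> Arr M \<and> Dom M (?ds ! i) = ctx_obj M (\<Gamma>s ! i) \<and> Cod M (?ds ! i) = qobj M (acts G ! i)"
    if "i < length (acts G)" for i
    using Gate that by (simp add: ctx_obj_T)
  have l: "length ?ds = length (acts G)" "length \<Gamma>s = length (acts G)" using Gate by simp_all
  have "\<forall>d \<in> set ?ds. d \<in> Arr M" unfolding all_set_conv_all_nth l using * by blast
  moreover have "map (Dom M) ?ds = map (ctx_obj M) \<Gamma>s" "map (Cod M) ?ds = map (qobj M) (acts G)"
    by (rule nth_equalityI; use l * in simp)+
  ultimately have "tens_arrs M ?ds \<in> Arr M"
    "Dom M (tens_arrs M ?ds) = tens_objs M (map (ctx_obj M) \<Gamma>s)"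
    "Cod M (tens_arrs M ?ds) = ty_obj M (qubits_ty (acts G))"
    using tens_arrs_arr[of ?ds] by (simp_all only: tens_objs_qubits)
  then have f: "?f = garr M G \<cdot> (gather (acts G) \<cdot> smor F)"
    unfolding F(2) by simp
  have "lang.sem (concat \<Gamma>s) (App G ts) ?A (scmp (mgate G) F)"
    using lang.sem_Op[OF lang.ops.App F(1)] Gate by blast
  moreover have "scmp (mgate G) F = lift ?\<Gamma> ?A ?f"
    by (rule strict_eqI) (use arr in \<open>simp_all add: f del: interp.simps\<close>)
  ultimately show ?case using arr by (simp add: f del: interp.simps)
next
  case (TensI D \<Gamma> s A E \<Delta> t B)
  let ?d = "interp M D" and ?e = "interp M E"
  have [simp]: "?d \<in> Arr M" "Dom M ?d = T (map snd \<Gamma>)" "Cod M ?d = ty_obj M A"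
    "?e \<in> Arr M" "Dom M ?e = T (map snd \<Delta>)" "Cod M ?e = ty_obj M B" using TensI by simp_all
  have "scmp (mpair A B) (sten (lift (map snd \<Gamma>) A ?d) (lift (map snd \<Delta>) B ?e))
      = lift (map snd (\<Gamma> @ \<Delta>)) (TTensor A B) (interp M (DTensI \<Gamma> \<Delta> D E))" (is "?l = ?r")
    by (rule strict_eqI) (simp_all add: smor_lift_ten split_ctx_split tarr_comp'' del: sten_arr(4))
  moreover have "lang.sem \<Gamma> s A (lift (map snd \<Gamma>) A ?d)" "lang.sem \<Delta> t B (lift (map snd \<Delta>) B ?e)"
    using TensI by blast+
  note lang.sem_Tup[OF this \<open>wf_ctx (\<Gamma> @ \<Delta>)\<close>]
  ultimately show ?case by (simp add: split_ctx_split)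
next
  case (TensE D \<Gamma> s A B E x y \<Delta> t C)
  let ?d = "interp M D" and ?e = "interp M E"
  have [simp]: "?d \<in> Arr M" "Dom M ?d = T (map snd \<Gamma>)" "Cod M ?d = ty_obj M A \<odot> ty_obj M B"
    "?e \<in> Arr M" "Dom M ?e = ty_obj M A \<odot> ty_obj M B \<odot> T (map snd \<Delta>)" "Cod M ?e = ty_obj M C" using TensE by simp_all
  have "scmp (lift (A # B # map snd \<Delta>) C ?e) (sten (scmp (munpair A B) (lift (map snd \<Gamma>) (TTensor A B) ?d)) (sidn (map snd \<Delta>)))
      = lift (map snd (\<Gamma> @ \<Delta>)) C (interp M (DTensE \<Gamma> x A y B \<Delta> D E))" (is "?l = ?r")
    by (rule strict_eqI)
      (simp_all add: merge_two split_ctx_split ctx_obj_T tarr_comp'' tarr_comp' del: merge.simps split.simps)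
  moreover have "lang.sem \<Gamma> s (TTensor A B) (lift (map snd \<Gamma>) (TTensor A B) ?d)"
    "lang.sem ((x, A) # (y, B) # \<Delta>) t C (lift (map snd ((x, A) # (y, B) # \<Delta>)) C ?e)"
    using TensE by blast+
  note lang.sem_Pair_let[OF this \<open>wf_ctx (\<Gamma> @ \<Delta>)\<close>]
  ultimately show ?case by (simp add: split_ctx_split ctx_obj_T)
next
  case (Let D \<Gamma> s A E x \<Delta> t C)
  let ?d = "interp M D" and ?e = "interp M E"
  have [simp]: "?d \<in> Arr M" "Dom M ?d = T (map snd \<Gamma>)" "Cod M ?d = ty_obj M A"
    "?e \<in> Arr M" "Dom M ?e = ty_obj M A \<odot> T (map snd \<Delta>)" "Cod M ?e = ty_obj M C" using Let by simp_all
  have "scmp (lift (A # map snd \<Delta>) C ?e) (sten (lift (map snd \<Gamma>) A ?d) (sidn (map snd \<Delta>)))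
      = lift (map snd (\<Gamma> @ \<Delta>)) C (interp M (DLet \<Gamma> x A \<Delta> D E))" (is "?l = ?r")
    by (rule strict_eqI) (simp_all add: smor_lift_ten split_ctx_split ctx_obj_T del: sten_arr(4))
  moreover have "lang.sem \<Gamma> s A (lift (map snd \<Gamma>) A ?d)"
    "lang.sem ((x, A) # \<Delta>) t C (lift (map snd ((x, A) # \<Delta>)) C ?e)"
    using Let by blast+
  note lang.sem_Name_let[OF this \<open>wf_ctx (\<Gamma> @ \<Delta>)\<close>]
  ultimately show ?case by (simp add: split_ctx_split ctx_obj_T)
qed

end

theorem proposition4:
  fixes acts :: "'g \<Rightarrow> 'q list"
    and M :: "('q, 'g, 'o, 'm) plain_model"
    and D E :: "('q, 'g) derivation"
  assumes "\<And>G. distinct (acts G)"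
    and "categorical_model acts M"
    and "judg_eq acts \<Gamma> s t A"
    and "derives acts D \<Gamma> s A"
    and "derives acts E \<Gamma> t A"
  shows "interp M D \<in> hom M (ctx_obj M \<Gamma>) (ty_obj M A) \<and>
         interp M E \<in> hom M (ctx_obj M \<Gamma>) (ty_obj M A) \<and>
         interp M D = interp M E"
proof -
  interpret categorical_model acts M by fact
  note D = derives_sem[OF assms(4)] and E = derives_sem[OF assms(5)]
  have "\<exists>f. lang.sem \<Delta> u B f" if "typed acts \<Delta> u B" for \<Delta> u B
    using that derives_sem unfolding typed_def by blast
  from lang.judg_eq_sem[OF this assms(3)]
  obtain f where f: "lang.sem \<Gamma> s A f" "lang.sem \<Gamma> t A f" by blast
  \<comment> \<open>The given derivations enter here: their lifts are meanings of \<open>s\<close>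
    and \<open>t\<close> over \<open>\<Gamma>\<close>, and each term has only one.\<close>
  have "lift (map snd \<Gamma>) A (interp M D) = f" "lift (map snd \<Gamma>) A (interp M E) = f"
    using lang.sem_unique[OF f(1)] lang.sem_unique[OF f(2)] D E by blast+
  \<comment> \<open>\<open>lift\<close> composes with an inverse unitor, which can be cancelled to
    recover the arrows themselves.\<close>
  then have "comp M (rinv (ty_obj M A)) (interp M D) = comp M (rinv (ty_obj M A)) (interp M E)"
    by (metis lift_simps(3))
  then have "interp M D = interp M E"
    by (rule cancel_left[OF inverse_arrs_rinv[OF ob]]) (use D E in simp_all)
  with D E show ?thesis by (simp add: hom_def ctx_obj_T)
qed

end
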